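(* There is a deterministic algorithm that, given integers $n,t,k$ with $1\leq t\leq \min(n,k)$, outputs a $(t,k)$-minimal separating family $\mathcal{H}$ of functions $[n]\to[t+1]$ of size $k^{O(1)}\cdot (k/t)^{2t}\cdot 2^{O(t)}\cdot \log n$, and runs in time $k^{O(1)}\cdot (k/t)^{2t}\cdot 2^{O(t)}\cdot n\cdot \log n$.
   Context: $[n]=\{1,\ldots,n\}$. A family $\mathcal{H}$ of functions $[n]\to[t+1]$ is \emph{$(t,k)$-minimal separating} if for every pair of disjoint subsets $C,D\subseteq[n]$ with $|C|=t$ and $|D|\leq k-t$ there is $h\in\mathcal{H}$ with $h(C)=[t]$ and $h(D)\subseteq\{t+1\}$.
   Formalization: The factor log n is read as max(1, log n) in the size and time bounds; this changes only n = 1, where log n = 0 would force an empty family and zero running time, although a function is needed (n = t = k = 1). *)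

theory Defs
  imports Complex_Main "HOL-Library.FuncSet"
begin

section \<open>Minimal separating families\<close>

definition minimal_separating :: "nat \<Rightarrow> nat \<Rightarrow> nat \<Rightarrow> (nat \<Rightarrow> nat) set \<Rightarrow> bool" where
  "minimal_separating n t k H \<longleftrightarrow>
     H \<subseteq> {1..n} \<rightarrow>\<^sub>E {1..t + 1} \<and>
     (\<forall>C D. C \<subseteq> {1..n} \<and> D \<subseteq> {1..n} \<and> C \<inter> D = {} \<and> card C = t \<and> card D \<le> k - t \<longrightarrow>
        (\<exists>h\<in>H. h ` C = {1..t} \<and> h ` D \<subseteq> {t + 1}))"


section \<open>A word RAM\<close>

text \<open>
  Algorithms are programs of a deterministic structured word RAM with unit-cost operations:
  finitely many registers, finitely many arrays of words, and a write-only output stream.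
  A program is a finite syntactic object that does not depend on the input.  Every operator, every
  access and every command is charged one time unit.

  The machine has words of \<open>w\<close> bits.  A computation in which some value does not fit into a word has
  no derivation in the semantics, so that the unit-cost arithmetic cannot be exploited on huge
  numbers.  Subtraction is truncated, and division by zero follows the HOL convention.
\<close>

type_synonym name = string

datatype aexp =
    Const nat
  | Reg name
  | Arr name aexp
  | Add aexp aexp
  | Sub aexp aexp
  | Mul aexp aexp
  | Div aexp aexp
  | Mod aexp aexp

datatype bexp =
    Less aexp aexp
  | Eq aexp aexp
  | Neg bexp
  | Conj bexp bexp

datatype com =
    Skip
  | Assign name aexp
  | Store name aexp aexp
  | Output aexp
  | Seq com com
  | Cond bexp com com
  | While bexp com

record state =
  reg :: "name \<Rightarrow> nat"
  arr :: "name \<Rightarrow> nat \<Rightarrow> nat"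
  out :: "nat list"

fun aval :: "aexp \<Rightarrow> state \<Rightarrow> nat" where
  "aval (Const v) s = v"
| "aval (Reg x) s = reg s x"
| "aval (Arr A a) s = arr s A (aval a s)"
| "aval (Add a b) s = aval a s + aval b s"
| "aval (Sub a b) s = aval a s - aval b s"
| "aval (Mul a b) s = aval a s * aval b s"
| "aval (Div a b) s = aval a s div aval b s"
| "aval (Mod a b) s = aval a s mod aval b s"

fun bval :: "bexp \<Rightarrow> state \<Rightarrow> bool" where
  "bval (Less a b) s = (aval a s < aval b s)"
| "bval (Eq a b) s = (aval a s = aval b s)"
| "bval (Neg b) s = (\<not> bval b s)"
| "bval (Conj a b) s = (bval a s \<and> bval b s)"

text \<open>All intermediate values of the evaluation, array indices included, fit into \<open>w\<close>-bit words.\<close>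

fun afits :: "nat \<Rightarrow> aexp \<Rightarrow> state \<Rightarrow> bool" where
  "afits w (Const v) s = (v < 2 ^ w)"
| "afits w (Reg x) s = (reg s x < 2 ^ w)"
| "afits w (Arr A a) s = (afits w a s \<and> aval (Arr A a) s < 2 ^ w)"
| "afits w (Add a b) s = (afits w a s \<and> afits w b s \<and> aval (Add a b) s < 2 ^ w)"
| "afits w (Sub a b) s = (afits w a s \<and> afits w b s)"
| "afits w (Mul a b) s = (afits w a s \<and> afits w b s \<and> aval (Mul a b) s < 2 ^ w)"
| "afits w (Div a b) s = (afits w a s \<and> afits w b s)"
| "afits w (Mod a b) s = (afits w a s \<and> afits w b s)"

fun bfits :: "nat \<Rightarrow> bexp \<Rightarrow> state \<Rightarrow> bool" where
  "bfits w (Less a b) s = (afits w a s \<and> afits w b s)"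
| "bfits w (Eq a b) s = (afits w a s \<and> afits w b s)"
| "bfits w (Neg b) s = bfits w b s"
| "bfits w (Conj a b) s = (bfits w a s \<and> bfits w b s)"

fun acost :: "aexp \<Rightarrow> nat" where
  "acost (Const v) = 1"
| "acost (Reg x) = 1"
| "acost (Arr A a) = 1 + acost a"
| "acost (Add a b) = 1 + acost a + acost b"
| "acost (Sub a b) = 1 + acost a + acost b"
| "acost (Mul a b) = 1 + acost a + acost b"
| "acost (Div a b) = 1 + acost a + acost b"
| "acost (Mod a b) = 1 + acost a + acost b"

fun bcost :: "bexp \<Rightarrow> nat" where
  "bcost (Less a b) = 1 + acost a + acost b"
| "bcost (Eq a b) = 1 + acost a + acost b"
| "bcost (Neg b) = 1 + bcost b"
| "bcost (Conj a b) = 1 + bcost a + bcost b"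

text \<open>
  \<open>exec w c s T s'\<close>: on \<open>w\<close>-bit words, program \<open>c\<close> started in state \<open>s\<close> terminates in state \<open>s'\<close>
  after exactly \<open>T\<close> time units.
\<close>

inductive exec :: "nat \<Rightarrow> com \<Rightarrow> state \<Rightarrow> nat \<Rightarrow> state \<Rightarrow> bool" for w :: nat where
  Skip: "exec w Skip s 1 s"
| Assign: "afits w a s \<Longrightarrow>
    exec w (Assign x a) s (1 + acost a) (s\<lparr>reg := (reg s)(x := aval a s)\<rparr>)"
| Store: "afits w i s \<Longrightarrow> afits w a s \<Longrightarrow>
    exec w (Store A i a) s (1 + acost i + acost a)
      (s\<lparr>arr := (arr s)(A := (arr s A)(aval i s := aval a s))\<rparr>)"
| Output: "afits w a s \<Longrightarrow>
    exec w (Output a) s (1 + acost a) (s\<lparr>out := out s @ [aval a s]\<rparr>)"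
| Seq: "exec w c1 s1 T1 s2 \<Longrightarrow> exec w c2 s2 T2 s3 \<Longrightarrow>
    exec w (Seq c1 c2) s1 (1 + T1 + T2) s3"
| CondTrue: "bfits w b s \<Longrightarrow> bval b s \<Longrightarrow> exec w c1 s T s' \<Longrightarrow>
    exec w (Cond b c1 c2) s (1 + bcost b + T) s'"
| CondFalse: "bfits w b s \<Longrightarrow> \<not> bval b s \<Longrightarrow> exec w c2 s T s' \<Longrightarrow>
    exec w (Cond b c1 c2) s (1 + bcost b + T) s'"
| WhileFalse: "bfits w b s \<Longrightarrow> \<not> bval b s \<Longrightarrow>
    exec w (While b c) s (1 + bcost b) s"
| WhileTrue: "bfits w b s1 \<Longrightarrow> bval b s1 \<Longrightarrow> exec w c s1 T1 s2 \<Longrightarrow>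
    exec w (While b c) s2 T2 s3 \<Longrightarrow>
    exec w (While b c) s1 (1 + bcost b + T1 + T2) s3"

lemma exec_deterministic:
  "exec w c s T s' \<Longrightarrow> exec w c s T' s'' \<Longrightarrow> T' = T \<and> s'' = s'"
proof (induction arbitrary: T' s'' rule: exec.induct)
  case (Seq c1 s1 T1 s2 c2 T2 s3)
  from Seq.prems show ?case by cases (use Seq.IH in blast)
next
  case (CondTrue b s c1 T s' c2)
  from CondTrue.prems show ?case by cases (use CondTrue in blast)+
next
  case (CondFalse b s c2 T s' c1)
  from CondFalse.prems show ?case by cases (use CondFalse in blast)+
next
  case (WhileFalse b s c)
  from WhileFalse.prems show ?case by cases (use WhileFalse in blast)+
next
  case (WhileTrue b s1 c T1 s2 T2 s3)
  from WhileTrue.prems show ?case by cases (use WhileTrue in blast)+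
qed (erule exec.cases; simp)+

lemma afits_mono: "afits w a s \<Longrightarrow> w \<le> w' \<Longrightarrow> afits w' a s"
  by (induction a) (auto intro: less_le_trans power_increasing)

lemma bfits_mono: "bfits w b s \<Longrightarrow> w \<le> w' \<Longrightarrow> bfits w' b s"
  by (induction b) (auto intro: afits_mono)

text \<open>A run without overflow is reproduced verbatim by every machine with longer words.\<close>

lemma exec_word_mono: "exec w c s T s' \<Longrightarrow> w \<le> w' \<Longrightarrow> exec w' c s T s'"
  by (induction rule: exec.induct) (blast intro: exec.intros afits_mono bfits_mono)+

definition input :: "nat \<Rightarrow> nat \<Rightarrow> nat \<Rightarrow> state" where
  "input n t k =
     \<lparr>reg = (\<lambda>_. 0)(''n'' := n, ''t'' := t, ''k'' := k), arr = (\<lambda>_ _. 0), out = []\<rparr>"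

text \<open>A family of functions on \<open>{1..n}\<close> is output as the concatenation of the value tables.\<close>

definition tables :: "nat \<Rightarrow> (nat \<Rightarrow> nat) list \<Rightarrow> nat list" where
  "tables n hs = concat (map (\<lambda>h. map h [1..<n + 1]) hs)"


section \<open>The size and time bounds\<close>

text \<open>
  The constant \<open>c\<close> plays the role of the constants hidden in \<open>k\<^sup>O\<^sup>(\<^sup>1\<^sup>)\<close> and \<open>2\<^sup>O\<^sup>(\<^sup>t\<^sup>)\<close>; since \<open>t \<ge> 1\<close>,
  the factor \<open>2 ^ (c * t)\<close> also covers constant factors.  The logarithm is cut off from below at 1,
  which only affects \<open>n = 1\<close>: there \<open>log n = 0\<close>, but no empty family is separating.
\<close>

definition size_bound :: "nat \<Rightarrow> nat \<Rightarrow> nat \<Rightarrow> nat \<Rightarrow> real" where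
  "size_bound c n t k =
     real k ^ c * (real k / real t) ^ (2 * t) * 2 ^ (c * t) * max 1 (log 2 (real n))"

definition time_bound :: "nat \<Rightarrow> nat \<Rightarrow> nat \<Rightarrow> nat \<Rightarrow> real" where
  "time_bound c n t k =
     real k ^ c * (real k / real t) ^ (2 * t) * 2 ^ (c * t) * real n * max 1 (log 2 (real n))"

text \<open>
  Words of logarithmic length: a word holds numbers polynomial in the time bound (which is at least
  \<open>n\<close>), as is needed to address the memory a computation can use.
\<close>

definition word_length_bound :: "nat \<Rightarrow> nat \<Rightarrow> nat \<Rightarrow> nat \<Rightarrow> real" where
  "word_length_bound c n t k = real c * log 2 (time_bound c n t k)"

end

theory Submission
  imports Defs "HOL-Computational_Algebra.Primes"
begin

text \<open>
  The ground set is reduced in two steps to a universe of size \<open>M = 8 k\<^sup>2\<close>, keeping a given set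
  \<open>S = C \<union> D\<close> of at most \<open>k\<close> elements apart.  Reduction modulo one of \<open>O(k\<^sup>2 log n / q)\<close>
  consecutive primes \<open>v > 2 ^ q\<close>, where \<open>2 ^ q\<close> is about \<open>k\<^sup>2 log n\<close>, is injective on \<open>S\<close>, since a
  difference of elements below \<open>n\<close> has few prime factors of that size; all these primes are below
  \<open>2 ^ (3 q)\<close>.  For each of them \<open>3 q M\<close> multipliers \<open>a\<close> are chosen greedily by multiplicative weights
  so that every difference causes collisions under few of the maps \<open>x \<mapsto> (a x mod v) mod M\<close>; one of these
  maps is then injective on the residues of \<open>S\<close>.  The factors \<open>1 / q\<close> and \<open>q\<close> cancel, which leaves
  \<open>k\<^sup>O\<^sup>(\<^sup>1\<^sup>) log n\<close> reductions.

  On the small universe, hash with multipliers modulo a fixed prime \<open>p = k\<^sup>O\<^sup>(\<^sup>1\<^sup>)\<close> into \<open>O(k\<^sup>2 / t)\<close>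
  cells.  Some multiplier isolates all but a fraction \<open>t / (2 k)\<close> of the elements of \<open>C\<close> from the rest
  of \<open>S\<close>.  Colour their cells, and treat the remaining elements of \<open>C\<close> in the same way in further
  rounds.  The cells of a round are specified economically, by moving through blocks of cells and
  giving offsets inside the blocks.  Enumerating all specifications costs \<open>O((k / t)\<^sup>2)\<close> per
  element of \<open>C\<close>, hence \<open>(k / t) ^ (2 t) * 2\<^sup>O\<^sup>(\<^sup>t\<^sup>)\<close> in total, times \<open>p\<close> per round.
\<close>


section \<open>Primes in polynomially bounded intervals\<close>

text \<open>A map injective on all of \<open>S\<close> takes about \<open>k^2\<close> cells; cut
  into \<open>t\<close> blocks, these have up to \<open>k^2 / t\<close> offsets each, too many for
  the exponent \<open>2 * t\<close>. With only \<open>O(k^2 / t)\<close> cells the blocks have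
  length \<open>O((k / t)^2)\<close>, at the price that a small fraction of \<open>C\<close>
  collides; this is what forces several rounds. Moving through blocks instead of naming cells
  absolutely saves a factor \<open>t\<close> per element.

  Multipliers are found by exhaustive search at a cost of about \<open>v^2\<close> each. This is
  affordable because \<open>v <= 2 ^ (3 * q)\<close> and \<open>2 ^ q = O(k^2 log n)\<close>: a
  fixed power of \<open>v\<close> is polynomial in \<open>k\<close> times a power of
  \<open>log n\<close>, and \<open>power_le_exp\<close> trades the latter for a single factor
  \<open>n\<close>. The total weight stays below \<open>2 ^ (5 * (3 * q))\<close>, which is bounded
  in the same way, so it fits into a word of logarithmic length.

  The primes only have to lie in a polynomially long interval, for which an elementary estimate of
  lcm(1, ..., N) suffices. All constants are generous.\<close>

definition prime_power_prod :: "nat \<Rightarrow> nat" where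
  "prime_power_prod N = (\<Prod>p\<in>{p. prime p \<and> p \<le> N}. p ^ Max {i. p ^ i \<le> N})"

lemma finite_exponents:
  fixes p N :: nat
  assumes "2 \<le> p"
  shows "finite {i. p ^ i \<le> N}"
proof (rule finite_subset)
  show "{i. p ^ i \<le> N} \<subseteq> {..N}"
  proof
    fix i assume "i \<in> {i. p ^ i \<le> N}"
    moreover have "i < p ^ i" using less_exp power_mono[OF assms] by (rule less_le_trans) simp
    ultimately show "i \<in> {..N}" by simp
  qed
qed simp

text \<open>\<open>prime_power_prod N\<close> is lcm(1, ..., N). Every prime contributes a power
  that is at most \<open>N\<close>, so the number of primes up to \<open>N\<close> bounds the lcm
  from above; set against the exponential lower bound \<open>prime_power_prod_ge\<close>, this
  forces many primes.\<close>

lemma prime_power_prod_le: "1 \<le> N \<Longrightarrow> prime_power_prod N \<le> N ^ card {p. prime p \<and> p \<le> N}"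
proof -
  assume N: "1 \<le> N"
  have "p ^ Max {i. p ^ i \<le> N} \<le> N" if "prime p" for p
  proof -
    have "Max {i. p ^ i \<le> N} \<in> {i. p ^ i \<le> N}"
    proof (rule Max_in)
      show "finite {i. p ^ i \<le> N}" using that prime_ge_2_nat by (intro finite_exponents) auto
      have "p ^ 0 \<le> N" using N by simp
      then show "{i. p ^ i \<le> N} \<noteq> {}" by blast
    qed
    then show ?thesis by simp
  qed
  then have "prime_power_prod N \<le> (\<Prod>p\<in>{p. prime p \<and> p \<le> N}. N)"
    unfolding prime_power_prod_def by (intro prod_mono) auto
  then show ?thesis by simp
qed

text \<open>Compared prime by prime: \<open>p ^ multiplicity p i\<close> is at most
  \<open>i\<close>, hence at most \<open>N\<close>, so the multiplicity is one of the exponents over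
  which \<open>Max\<close> is taken.\<close>

lemma dvd_prime_power_prod:
  assumes "1 \<le> i" "i \<le> N"
  shows "i dvd prime_power_prod N"
proof (rule multiplicity_le_imp_dvd)
  fix p :: nat assume p: "prime p"
  have fin: "finite {p. prime p \<and> p \<le> N}" by (rule finite_subset[of _ "{..N}"]) auto
  have mult: "multiplicity p (prime_power_prod N) = (if p \<le> N then Max {i. p ^ i \<le> N} else 0)"
    unfolding prime_power_prod_def using p fin
    by (subst multiplicity_prod_prime_powers) auto
  have "p ^ multiplicity p i \<le> i" using assms by (intro dvd_imp_le multiplicity_dvd) auto
  then have le: "p ^ multiplicity p i \<le> N" using assms by simp
  show "multiplicity p i \<le> multiplicity p (prime_power_prod N)"
  proof (cases "p \<le> N")
    case True
    then show ?thesis using mult le p prime_ge_2_nat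
      by (auto intro!: Max_ge finite_exponents)
  next
    case False
    then have "\<not> p dvd i" using assms by (auto dest: dvd_imp_le)
    then show ?thesis by (simp add: not_dvd_imp_multiplicity_0)
  qed
qed (use assms in auto)

text \<open>
  The entries \<open>1 / (k * (n choose k))\<close> of Leibniz's harmonic triangle are integer combinations of
  \<open>1, 1 / 2, \<dots>, 1 / n\<close>.  Hence \<open>prime_power_prod N\<close>, a common multiple of \<open>1, \<dots>, N\<close>, is at
  least exponential in \<open>N\<close>, which forces many primes below \<open>N\<close>.
\<close>

lemma leibniz_triangle:
  assumes "1 \<le> k" "k < n"
  shows "1 / (real (k + 1) * real (n choose (k + 1)))
       = 1 / (real k * real ((n - 1) choose k)) - 1 / (real k * real (n choose k))"
proof -
  obtain m where n: "n = Suc m" using assms by (cases n) auto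
  define C where "C = real (n choose k)"
  define d where "d = real n - real k"
  have C: "C > 0" and d: "d > 0" unfolding C_def d_def using assms by auto
  have k: "real k > 0" using assms by simp
  have "(k + 1) * (n choose (k + 1)) = (n - k) * (n choose k)"
    by (simp only: Suc_eq_plus1[symmetric] binomial_absorption binomial_absorb_comp)
  then have "real (k + 1) * real (n choose (k + 1)) = real (n - k) * real (n choose k)"
    by (simp only: of_nat_mult[symmetric])
  then have 1: "real (k + 1) * real (n choose (k + 1)) = d * C"
    using assms by (simp only: C_def d_def of_nat_diff less_imp_le)
  have "real ((n - k) * (n choose k)) = real (n * ((n - 1) choose k))"
    by (metis binomial_absorb_comp)
  then have "d * C = real n * real ((n - 1) choose k)"
    using assms by (simp add: C_def d_def of_nat_diff)
  then have 2: "real ((n - 1) choose k) = d * C / (k + d)"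
    using assms by (simp add: d_def field_simps)
  show ?thesis unfolding 1 2 using C d k by (simp add: C_def[symmetric] field_simps)
qed

text \<open>Induction on the column \<open>k\<close>. Column 1 of row \<open>n\<close> is the lcm
  divided by \<open>n\<close>; the next column is a difference of entries in rows
  \<open>n - 1\<close> and \<open>n\<close>, hence \<open>n\<close> is kept arbitrary.\<close>

lemma leibniz_dvd:
  assumes "1 \<le> k" "k \<le> n" "n \<le> N"
  shows "real (prime_power_prod N) / (real k * real (n choose k)) \<in> \<int>"
  using assms
proof (induction k arbitrary: n rule: nat_induct_at_least)
  case base
  then obtain c where "prime_power_prod N = n * c" using dvd_prime_power_prod[of n N] by (auto elim: dvdE)
  then have "real (prime_power_prod N) / (real 1 * real (n choose 1)) = of_int (int c)"
    using base by simp
  then show ?case by (metis Ints_of_int)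
next
  case (Suc k)
  define P where "P = real (prime_power_prod N)"
  have "P / (real (Suc k) * real (n choose (Suc k)))
    = P * (1 / (real k * real ((n - 1) choose k)) - 1 / (real k * real (n choose k)))"
  proof -
    have "P / (real (Suc k) * real (n choose (Suc k))) = P * (1 / (real (k + 1) * real (n choose (k + 1))))"
      by simp
    then show ?thesis using leibniz_triangle[of k n] Suc.hyps Suc.prems by (simp only: Suc_le_eq)
  qed
  also have "\<dots> = P / (real k * real ((n - 1) choose k)) - P / (real k * real (n choose k))"
    by (simp add: algebra_simps)
  also have "\<dots> \<in> \<int>"
    unfolding P_def using Suc by (intro Ints_diff Suc.IH) auto
  finally show ?case unfolding P_def .
qed

text \<open>The entry in column \<open>m\<close> of row \<open>2 * m\<close> becomes a positive
  integer when scaled by the lcm, so the lcm is at least \<open>m * (2 * m choose m)\<close>, and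
  the central binomial coefficient is at least \<open>4 ^ m / (2 * m)\<close>.\<close>

lemma prime_power_prod_ge:
  assumes "1 \<le> m"
  shows "4 ^ m \<le> 2 * prime_power_prod (2 * m)"
proof -
  define P where "P = prime_power_prod (2 * m)"
  define Y where "Y = real m * real (2 * m choose m)"
  have Ypos: "Y > 0" unfolding Y_def using assms by simp
  have Ppos: "P > 0" unfolding P_def prime_power_prod_def
    by (auto intro!: prod_pos simp: prime_gt_0_nat)
  have "real P / Y \<in> \<int>" unfolding P_def Y_def using assms by (intro leibniz_dvd) auto
  moreover have "real P / Y > 0" using Ppos Ypos by simp
  ultimately have "real P / Y \<ge> 1"
    by (metis Ints_cases of_int_0_less_iff of_int_1_le_iff int_one_le_iff_zero_less)
  then have "Y \<le> real P" using Ypos by (simp add: field_simps)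
  moreover have "4 ^ m / 2 \<le> Y"
  proof -
    have "4 ^ m / (2 * real m) * real m \<le> real (2 * m choose m) * real m"
      using assms central_binomial_lower_bound[of m] by (intro mult_right_mono) auto
    then show ?thesis unfolding Y_def using assms by (simp add: mult.commute)
  qed
  ultimately have "real (4 ^ m) \<le> real (2 * P)" by simp
  then show ?thesis unfolding P_def by linarith
qed

lemma six_mult_less_four_power: "3 \<le> q \<Longrightarrow> 6 * q < 4 ^ q" for q :: nat
  by (induction q rule: nat_induct_at_least) auto

text \<open>For \<open>N = 2 ^ (3 * q)\<close> and \<open>c\<close> the number of primes, the two
  estimates of the lcm give \<open>2 ^ N <= 2 * N ^ c\<close>, that is
  \<open>N <= 3 * q * c + 1\<close>. Fewer than \<open>2 * 2 ^ q\<close> primes would give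
  \<open>8 ^ q <= 6 * q * 2 ^ q\<close>, which is false from \<open>q = 3\<close> on.\<close>

lemma card_primes_ge:
  assumes q: "3 \<le> q"
  shows "2 * 2 ^ q \<le> card {p::nat. prime p \<and> p \<le> 2 ^ (3 * q)}" (is "_ \<le> ?c")
proof (rule ccontr)
  assume "\<not> ?thesis"
  then have c: "?c + 1 \<le> 2 * 2 ^ q" by simp
  \<comment> \<open>The lower bound on the lcm is stated for even arguments, hence
    \<open>2 ^ (3 * q)\<close> is split as \<open>2 * 2 ^ s\<close>.\<close>
  obtain s where s: "3 * q = Suc s" using q by (cases "3 * q") auto
  have "(2::nat) ^ (2 ^ Suc s) = 4 ^ (2 ^ s)" by (simp add: power_mult)
  also have "\<dots> \<le> 2 * prime_power_prod (2 * 2 ^ s)" by (rule prime_power_prod_ge) simp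
  also have "\<dots> \<le> 2 * (2 ^ Suc s) ^ ?c"
    using prime_power_prod_le[of "2 ^ Suc s"] unfolding s by simp
  also have "\<dots> = 2 ^ (Suc s * ?c + 1)" by (simp only: power_mult power_add) simp
  finally have "2 ^ Suc s \<le> Suc s * ?c + 1" by (rule power_le_imp_le_exp[rotated]) simp
  then have "2 ^ (3 * q) \<le> 3 * q * ?c + 1" unfolding s .
  also have "\<dots> \<le> 3 * q * (?c + 1)" using q by simp
  also have "\<dots> \<le> 3 * q * (2 * 2 ^ q)" using c by (intro mult_left_mono) auto
  also have "\<dots> = (6 * q) * 2 ^ q" by simp
  also have "\<dots> < 4 ^ q * 2 ^ q" using six_mult_less_four_power[OF q] by simp
  also have "\<dots> = (4 * 2) ^ q" by (rule power_mult_distrib[symmetric])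
  also have "\<dots> = 2 ^ (3 * q)" by (subst power_mult) simp
  finally show False by simp
qed

section \<open>The primes above a power of two, in increasing order\<close>

definition next_prime :: "nat \<Rightarrow> nat" where
  "next_prime v = (LEAST p. prime p \<and> v < p)"

lemma next_prime: "prime (next_prime v)" "v < next_prime v"
proof -
  obtain p where "prime p \<and> v < p" using bigger_prime by blast
  then have "prime (next_prime v) \<and> v < next_prime v" unfolding next_prime_def by (rule LeastI)
  then show "prime (next_prime v)" "v < next_prime v" by auto
qed

lemma next_prime_le: "prime p \<Longrightarrow> v < p \<Longrightarrow> next_prime v \<le> p"
  unfolding next_prime_def by (rule Least_le) simp

fun nth_prime_above :: "nat \<Rightarrow> nat \<Rightarrow> nat" where
  "nth_prime_above Q 0 = next_prime Q"
| "nth_prime_above Q (Suc i) = next_prime (nth_prime_above Q i)"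

lemma nth_prime_above: "prime (nth_prime_above Q i)" "Q < nth_prime_above Q i"
  by (induction i) (auto simp: next_prime intro: less_trans next_prime(2))

lemma strict_mono_nth_prime_above: "strict_mono (nth_prime_above Q)"
  by (simp add: strict_mono_Suc_iff next_prime)

lemma primes_below_nth_prime_above:
  "{p. prime p \<and> Q < p \<and> p < nth_prime_above Q i} \<subseteq> nth_prime_above Q ` {..<i}"
proof (induction i)
  case 0
  have "\<not> p < next_prime Q" if "prime p" "Q < p" for p using next_prime_le[OF that] by simp
  then show ?case by auto
next
  case (Suc i)
  show ?case
  proof
    fix p assume p: "p \<in> {p. prime p \<and> Q < p \<and> p < nth_prime_above Q (Suc i)}"
    then have "p \<le> nth_prime_above Q i" using next_prime_le[of p "nth_prime_above Q i"] by force
    then show "p \<in> nth_prime_above Q ` {..<Suc i}"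
    proof (cases "p = nth_prime_above Q i")
      case False
      then have "p \<in> {p. prime p \<and> Q < p \<and> p < nth_prime_above Q i}" using \<open>p \<le> _\<close> p by simp
      then have "p \<in> nth_prime_above Q ` {..<i}" using Suc by blast
      then show ?thesis by (auto simp: lessThan_Suc)
    qed simp
  qed
qed

text \<open>Otherwise every prime up to \<open>2 ^ (3 * q)\<close> would be one of the numbers from
  2 to \<open>2 ^ q\<close> or one of the first \<open>i\<close> primes above \<open>2 ^ q\<close>.
  These are at most \<open>2 ^ q - 1 + 2 ^ q\<close> numbers, fewer than
  \<open>card_primes_ge\<close> provides.\<close>

lemma nth_prime_above_le:
  assumes "3 \<le> q" "i \<le> 2 ^ q"
  shows "nth_prime_above (2 ^ q) i \<le> 2 ^ (3 * q)"
proof (rule ccontr)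
  let ?A = "{p::nat. prime p \<and> p \<le> 2 ^ (3 * q)}"
  assume "\<not> ?thesis"
  then have "?A \<subseteq> {2..2 ^ q} \<union> {p. prime p \<and> 2 ^ q < p \<and> p < nth_prime_above (2 ^ q) i}"
    by (auto dest: prime_ge_2_nat)
  also have "\<dots> \<subseteq> {2..2 ^ q} \<union> nth_prime_above (2 ^ q) ` {..<i}"
    using primes_below_nth_prime_above by blast
  finally have "card ?A \<le> card ({2..2 ^ q} \<union> nth_prime_above (2 ^ q) ` {..<i})"
    by (intro card_mono) auto
  also have "\<dots> \<le> card {2..(2::nat) ^ q} + card (nth_prime_above (2 ^ q) ` {..<i})"
    by (rule card_Un_le)
  also have "\<dots> \<le> (2 ^ q - 1) + i" using card_image_le[of "{..<i}"] by (intro add_mono) auto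
  also have "\<dots> < 2 * 2 ^ q"
  proof -
    have "(0::nat) < 2 ^ q" by simp
    then show ?thesis using assms by linarith
  qed
  finally show False using card_primes_ge[OF assms(1)] by simp
qed

text \<open>The least power of two that is not below \<open>v\<close>, raised to at least
  \<open>2 ^ 3\<close> where \<open>nth_prime_above_le\<close> starts to apply, is at most
  \<open>8 * v\<close>; the first prime above it is at most its cube.\<close>

lemma next_prime_bound:
  assumes "1 \<le> v"
  shows "next_prime v \<le> (8 * v) ^ 3"
proof -
  define e where "e = (LEAST e. v \<le> 2 ^ e)"
  have e: "v \<le> 2 ^ e" unfolding e_def by (rule LeastI[of _ v]) (rule less_imp_le[OF less_exp])
  have e2: "2 ^ e \<le> 2 * v"
  proof (cases e)
    case (Suc e')
    then have "\<not> v \<le> 2 ^ e'" unfolding e_def using not_less_Least[of e' "\<lambda>e. v \<le> 2 ^ e"] by simp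
    then show ?thesis using Suc by simp
  qed (use assms in simp)
  have "next_prime v \<le> nth_prime_above (2 ^ max 3 e) 0"
    using nth_prime_above[of "2 ^ max 3 e" 0] e
  proof (intro next_prime_le)
    have "v \<le> 2 ^ max 3 e" using e by (rule order_trans) (intro power_increasing, auto)
    then show "v < nth_prime_above (2 ^ max 3 e) 0" using nth_prime_above(2) by (rule le_less_trans)
  qed
  also have "\<dots> \<le> 2 ^ (3 * max 3 e)" by (intro nth_prime_above_le) auto
  also have "\<dots> = (2 ^ max 3 e) ^ 3" by (simp only: power_mult[symmetric] mult.commute)
  also have "\<dots> \<le> (8 * v) ^ 3"
  proof (rule power_mono)
    show "2 ^ max 3 e \<le> 8 * v" using e2 assms by (cases "e \<le> 3") (auto simp: max_def)
  qed simp
  finally show ?thesis .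
qed

section \<open>Hashing with few clashes\<close>

text \<open>
  A necessary condition for \<open>x\<close> and \<open>y\<close> to collide under \<open>z \<mapsto> (a * z mod p) mod m\<close> that depends
  only on the difference \<open>d\<close> of \<open>x\<close> and \<open>y\<close>.
\<close>

definition clash :: "nat \<Rightarrow> nat \<Rightarrow> nat \<Rightarrow> nat \<Rightarrow> bool" where
  "clash m p a d \<longleftrightarrow> (a * d mod p) mod m = 0 \<or> (p - a * d mod p) mod m = 0"

lemma card_multiples:
  fixes m p :: nat
  assumes "0 < m"
  shows "card {u\<in>{1..<p}. u mod m = 0} * m \<le> p - 1"
proof -
  have "{u\<in>{1..<p}. u mod m = 0} \<subseteq> (\<lambda>i. m * i) ` {1..(p - 1) div m}"
  proof
    fix u assume u: "u \<in> {u\<in>{1..<p}. u mod m = 0}"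
    then obtain i where i: "u = m * i" by (auto simp: mod_eq_0_iff_dvd elim: dvdE)
    have "u \<le> p - 1" using u by auto
    then have "i \<le> (p - 1) div m" using assms i by (simp add: less_eq_div_iff_mult_less_eq mult.commute)
    then show "u \<in> (\<lambda>i. m * i) ` {1..(p - 1) div m}" using u i by (intro image_eqI[of _ _ i]) (auto simp: Suc_le_eq)
  qed
  then have "card {u\<in>{1..<p}. u mod m = 0} \<le> card ((\<lambda>i. m * i) ` {1..(p - 1) div m})"
    by (intro card_mono) auto
  also have "\<dots> \<le> (p - 1) div m" using card_image_le[of "{1..(p - 1) div m}"] by simp
  finally have "card {u\<in>{1..<p}. u mod m = 0} * m \<le> (p - 1) div m * m" by (rule mult_right_mono) simp
  also have "\<dots> \<le> p - 1" by simp
  finally show ?thesis .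
qed

text \<open>Multiplication by \<open>d\<close> permutes \<open>{1..<p}\<close>, so the clashing
  multipliers are counted by the residues \<open>u\<close> such that \<open>m\<close> divides
  \<open>u\<close> or \<open>p - u\<close>; the reflection \<open>p - u\<close> shows that the
  second kind is no more frequent than the first.\<close>

lemma card_clash:
  assumes p: "prime p" and d: "0 < d" "d < p" and m: "0 < m"
  shows "card {a\<in>{1..<p}. clash m p a d} * m \<le> 2 * (p - 1)"
proof -
  let ?f = "\<lambda>a. a * d mod p"
  have ndvd: "\<not> p dvd d" using d by (auto dest: dvd_imp_le)
  have range: "?f a \<in> {1..<p}" if "a \<in> {1..<p}" for a
  proof -
    have "\<not> p dvd a" using that by (auto dest: dvd_imp_le)
    then have "\<not> p dvd a * d" using ndvd p by (simp add: prime_dvd_mult_iff)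
    then show ?thesis using that by (auto simp: dvd_eq_mod_eq_0)
  qed
  have inj: "inj_on ?f {1..<p}"
  proof (rule linorder_inj_onI)
    fix a b assume ab: "a < b" "a \<in> {1..<p}" "b \<in> {1..<p}"
    show "?f a \<noteq> ?f b"
    proof
      assume "?f a = ?f b"
      then have "p dvd b * d - a * d" using ab by (subst (asm) eq_commute) (simp add: mod_eq_dvd_iff_nat)
      then have "p dvd (b - a) * d" by (simp add: diff_mult_distrib)
      then have "p dvd b - a" using ndvd p by (simp add: prime_dvd_mult_iff)
      then show False using ab by (auto dest: dvd_imp_le)
    qed
  qed auto
  let ?U = "{u\<in>{1..<p}. u mod m = 0}" and ?V = "{u\<in>{1..<p}. (p - u) mod m = 0}"
  have "card {a\<in>{1..<p}. clash m p a d} = card (?f ` {a\<in>{1..<p}. clash m p a d})"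
    by (rule card_image[symmetric], rule inj_on_subset[OF inj]) auto
  also have "\<dots> \<le> card (?U \<union> ?V)"
    using range by (intro card_mono) (auto simp: clash_def)
  also have "\<dots> \<le> card ?U + card ?V" by (rule card_Un_le)
  also have "card ?V \<le> card ?U"
    by (rule card_inj_on_le[of "\<lambda>u. p - u"]) (auto intro: inj_onI)
  finally have "card {a\<in>{1..<p}. clash m p a d} * m \<le> 2 * (card ?U * m)" by simp
  also have "\<dots> \<le> 2 * (p - 1)" using card_multiples[OF m] by (intro mult_left_mono) auto
  finally show ?thesis .
qed

text \<open>The residue \<open>u\<close> of the difference is \<open>A - B\<close> without
  wrap-around and \<open>p - (B - A)\<close> with it; this is why \<open>clash\<close> has two
  alternatives.\<close>

lemma clash_if_hash_eq:
  assumes "y < x" "0 < p" and eq: "(a * x mod p) mod m = (a * y mod p) mod m"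
  shows "clash m p a (x - y)"
proof -
  define A B u where "A = a * x mod p" and "B = a * y mod p" and "u = a * (x - y) mod p"
  have AB: "A < p" "B < p" "u < p" unfolding A_def B_def u_def using assms by auto
  have "int u = (int A - int B) mod int p"
    unfolding A_def B_def u_def using assms(1)
    by (simp add: of_nat_mod of_nat_diff mod_diff_eq right_diff_distrib)
  moreover have "(int A - int B) mod int p = (if B \<le> A then int A - int B else int A - int B + int p)"
  proof (cases "B \<le> A")
    case False
    then have "(int A - int B) mod int p = (int A - int B + int p) mod int p" by simp
    also have "\<dots> = int A - int B + int p" using False AB by (intro mod_pos_pos_trivial) auto
    finally show ?thesis using False by simp
  qed (use AB in auto)
  ultimately have u: "u = (if B \<le> A then A - B else A + p - B)" using AB by (auto split: if_splits)
  have e: "A mod m = B mod m" using eq unfolding A_def B_def .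
  show ?thesis
  proof (cases "B \<le> A")
    case True
    then have "u mod m = 0" using u e by (simp add: mod_eq_dvd_iff_nat[symmetric] flip: dvd_eq_mod_eq_0)
    then show ?thesis unfolding clash_def u_def by simp
  next
    case False
    then have "p - u = B - A" using u AB by simp
    moreover have "(B - A) mod m = 0"
      using False e by (simp add: mod_eq_dvd_iff_nat[symmetric] flip: dvd_eq_mod_eq_0)
    ultimately show ?thesis unfolding clash_def u_def by simp
  qed
qed

definition adiff :: "nat \<Rightarrow> nat \<Rightarrow> nat" where
  "adiff x y = (if x < y then y - x else x - y)"

lemma clash_adiff_if_hash_eq:
  "x \<noteq> y \<Longrightarrow> 0 < p \<Longrightarrow> (a * x mod p) mod m = (a * y mod p) mod m \<Longrightarrow> clash m p a (adiff x y)"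
  using clash_if_hash_eq[of x y p a m] clash_if_hash_eq[of y x p a m]
  by (auto simp: adiff_def)

lemma adiff_bounds: "x \<noteq> y \<Longrightarrow> x < p \<Longrightarrow> y < p \<Longrightarrow> 0 < adiff x y \<and> adiff x y < p"
  by (auto simp: adiff_def)

text \<open>Averaging over \<open>a\<close>: by \<open>card_clash\<close> each index clashes with at
  most a fraction \<open>2 / m\<close> of the multipliers, so some multiplier meets at most that
  fraction of the weight. Indices are distinguished from differences because several pairs of points
  may have the same difference.\<close>

lemma exists_few_clashes:
  fixes W :: "'i \<Rightarrow> nat"
  assumes p: "prime p" and m: "0 < m" and I: "finite I" "\<And>i. i \<in> I \<Longrightarrow> 0 < d i \<and> d i < p"
  shows "\<exists>a\<in>{1..<p}. m * (\<Sum>i\<in>{i\<in>I. clash m p a (d i)}. W i) \<le> 2 * (\<Sum>i\<in>I. W i)"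
proof (rule ccontr)
  let ?S = "\<Sum>i\<in>I. W i"
  let ?B = "\<lambda>a. \<Sum>i\<in>{i\<in>I. clash m p a (d i)}. W i"
  assume "\<not> ?thesis"
  then have "2 * ?S < m * ?B a" if "a \<in> {1..<p}" for a using that by force
  then have "(\<Sum>a\<in>{1..<p}. 2 * ?S) < (\<Sum>a\<in>{1..<p}. m * ?B a)"
    using prime_gt_1_nat[OF p] by (intro sum_strict_mono) auto
  also have "\<dots> = m * (\<Sum>a\<in>{1..<p}. \<Sum>i\<in>I. if clash m p a (d i) then W i else 0)"
    using I(1) by (simp add: sum_distrib_left[symmetric] sum.If_cases Int_def conj_commute)
  also have "\<dots> = m * (\<Sum>i\<in>I. \<Sum>a\<in>{1..<p}. if clash m p a (d i) then W i else 0)"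
    by (subst sum.swap) simp
  also have "\<dots> = (\<Sum>i\<in>I. card {a\<in>{1..<p}. clash m p a (d i)} * m * W i)"
    by (simp add: sum.If_cases Int_def sum_distrib_left mult_ac)
  also have "\<dots> \<le> (\<Sum>i\<in>I. 2 * (p - 1) * W i)"
    using I(2) by (intro sum_mono mult_right_mono card_clash p m) auto
  also have "\<dots> = (p - 1) * (2 * ?S)" by (simp only: sum_distrib_left[symmetric] sum_distrib_right[symmetric] mult_ac)
  finally show False by simp
qed

section \<open>Multipliers chosen greedily by multiplicative weights\<close>

definition clash_weight :: "nat \<Rightarrow> nat \<Rightarrow> (nat \<Rightarrow> nat) \<Rightarrow> nat \<Rightarrow> nat" where
  "clash_weight m p W a = (\<Sum>d\<in>{d\<in>{1..<p}. clash m p a d}. W d)"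

text \<open>The least such multiplier, because the program tries \<open>1, 2, ...\<close> in turn
  and must stop at the very value that the weights are updated with. That it lies below
  \<open>p\<close> comes from \<open>exists_few_clashes\<close>.\<close>

definition good_mult :: "nat \<Rightarrow> nat \<Rightarrow> (nat \<Rightarrow> nat) \<Rightarrow> nat" where
  "good_mult m p W = (LEAST a. 1 \<le> a \<and> m * clash_weight m p W a \<le> 2 * (\<Sum>d\<in>{1..<p}. W d))"

lemma good_mult:
  assumes "prime p" "0 < m"
  shows "1 \<le> good_mult m p W" "good_mult m p W < p"
    "m * clash_weight m p W (good_mult m p W) \<le> 2 * (\<Sum>d\<in>{1..<p}. W d)"
proof -
  let ?P = "\<lambda>a. 1 \<le> a \<and> m * clash_weight m p W a \<le> 2 * (\<Sum>d\<in>{1..<p}. W d)"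
  obtain a where a: "?P a" "a < p"
    using exists_few_clashes[OF assms, of "{1..<p}" "\<lambda>d. d" W] by (auto simp: clash_weight_def)
  then show "good_mult m p W < p" unfolding good_mult_def
    by (blast intro: Least_le le_less_trans)
  have "?P (good_mult m p W)" unfolding good_mult_def by (rule LeastI, rule a)
  then show "1 \<le> good_mult m p W" "m * clash_weight m p W (good_mult m p W) \<le> 2 * (\<Sum>d\<in>{1..<p}. W d)"
    by auto
qed

text \<open>
  Multiplicative weights: the weight of a difference doubles whenever a chosen multiplier clashes
  on it, and each multiplier is chosen so that at most the fraction \<open>2 / m\<close> of the weight doubles.
  So after \<open>m * e\<close> steps no difference has clashed with more than a fraction \<open>5 / m\<close> of the
  multipliers.
\<close>

fun weights :: "nat \<Rightarrow> nat \<Rightarrow> nat \<Rightarrow> nat \<Rightarrow> nat" where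
  "weights m p 0 d = 1"
| "weights m p (Suc j) d =
     (if clash m p (good_mult m p (weights m p j)) d then 2 * weights m p j d else weights m p j d)"

definition mults :: "nat \<Rightarrow> nat \<Rightarrow> nat \<Rightarrow> nat" where
  "mults m p j = good_mult m p (weights m p j)"

lemma weights_eq: "weights m p j d = 2 ^ card {i\<in>{..<j}. clash m p (mults m p i) d}"
proof (induction j)
  case (Suc j)
  have "{i\<in>{..<Suc j}. clash m p (mults m p i) d} =
    (if clash m p (mults m p j) d then {j} else {}) \<union> {i\<in>{..<j}. clash m p (mults m p i) d}"
    by (auto simp: lessThan_Suc)
  then show ?case using Suc by (simp add: mults_def)
qed simp

lemma sum_weights_Suc:
  "(\<Sum>d\<in>{1..<p}. weights m p (Suc j) d) =
   (\<Sum>d\<in>{1..<p}. weights m p j d) + clash_weight m p (weights m p j) (mults m p j)"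
proof -
  have "(\<Sum>d\<in>{1..<p}. weights m p (Suc j) d) =
    (\<Sum>d\<in>{1..<p}. weights m p j d + (if clash m p (mults m p j) d then weights m p j d else 0))"
    by (intro sum.cong) (auto simp: mults_def)
  then show ?thesis by (simp add: sum.distrib sum.If_cases clash_weight_def Int_def conj_commute)
qed

lemma sum_weights_le:
  assumes p: "prime p" and m: "0 < m"
  shows "real (\<Sum>d\<in>{1..<p}. weights m p j d) \<le> real (p - 1) * (1 + 2 / m) ^ j"
proof (induction j)
  case (Suc j)
  let ?S = "\<Sum>d\<in>{1..<p}. weights m p j d"
  have "m * clash_weight m p (weights m p j) (mults m p j) \<le> 2 * ?S"
    unfolding mults_def by (rule good_mult[OF p m])
  then have "real m * clash_weight m p (weights m p j) (mults m p j) \<le> 2 * real ?S"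
    by (metis of_nat_le_iff of_nat_mult of_nat_numeral)
  then have "real (clash_weight m p (weights m p j) (mults m p j)) \<le> 2 / m * real ?S"
    using m by (simp add: field_simps)
  then have "real (\<Sum>d\<in>{1..<p}. weights m p (Suc j) d) \<le> real ?S * (1 + 2 / m)"
    unfolding sum_weights_Suc by (simp add: algebra_simps)
  also have "\<dots> \<le> real (p - 1) * (1 + 2 / m) ^ j * (1 + 2 / m)"
    by (intro mult_right_mono Suc) auto
  finally show ?case by (simp add: mult_ac)
qed simp

text \<open>The total starts below \<open>2 ^ e\<close> and grows by at most
  \<open>(1 + 2 / m) ^ m <= exp 2 <= 9\<close> over every \<open>m\<close> steps; rounding 9 up to
  16 keeps the bound a power of two. It limits the clashes of a single difference and also the word
  length that the weights require.\<close>

lemma sum_weights_bound: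
  assumes p: "prime p" and m: "0 < m" and "p \<le> 2 ^ e" "j \<le> m * e"
  shows "(\<Sum>d\<in>{1..<p}. weights m p j d) < 2 ^ (5 * e)"
proof -
  have "(1 + 2 / real m) ^ j \<le> (1 + 2 / real m) ^ (m * e)"
    using assms by (intro power_increasing) auto
  also have "\<dots> = ((1 + 2 / real m) ^ m) ^ e" by (simp add: power_mult)
  also have "\<dots> \<le> 16 ^ e"
  proof (rule power_mono)
    have "(1 + 2 / real m) ^ m \<le> exp 2" using m by (intro exp_ge_one_plus_x_over_n_power_n) auto
    also have "exp 2 = exp 1 * exp (1::real)" by (simp flip: exp_add)
    also have "\<dots> \<le> 3 * 3" using exp_le by (intro mult_mono) auto
    finally show "(1 + 2 / real m) ^ m \<le> 16" by simp
  qed auto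
  finally have "real (\<Sum>d\<in>{1..<p}. weights m p j d) \<le> real (p - 1) * 16 ^ e"
    using sum_weights_le[OF p m, of j] by (meson mult_left_mono of_nat_0_le_iff order_trans)
  also have "\<dots> < 2 ^ e * 16 ^ e"
  proof (rule mult_strict_right_mono)
    have "real (p - 1) < real (2 ^ e)" using assms(3) prime_gt_1_nat[OF p] by (subst of_nat_less_iff) linarith
    then show "real (p - 1) < 2 ^ e" by simp
  qed simp
  also have "\<dots> = (2 ^ 5) ^ e" by (subst power_mult_distrib[symmetric]) simp
  also have "\<dots> = real (2 ^ (5 * e))" by (simp only: power_mult of_nat_power) simp
  finally show ?thesis by (simp only: of_nat_less_iff)
qed

text \<open>The weight of \<open>d\<close> alone is 2 to the number of its clashes, and it cannot
  exceed the total weight.\<close>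

lemma card_clashing_mults:
  assumes p: "prime p" and m: "0 < m" and "p \<le> 2 ^ e" and d: "0 < d" "d < p"
  shows "card {i\<in>{..<m * e}. clash m p (mults m p i) d} < 5 * e"
proof -
  have "weights m p (m * e) d \<le> (\<Sum>d\<in>{1..<p}. weights m p (m * e) d)"
    using d by (intro member_le_sum) auto
  also have "\<dots> < 2 ^ (5 * e)" using sum_weights_bound assms by blast
  finally have "(2::nat) ^ card {i\<in>{..<m * e}. clash m p (mults m p i) d} < 2 ^ (5 * e)"
    unfolding weights_eq .
  then show ?thesis by (simp add: power_less_imp_less_exp)
qed

section \<open>Injective reductions for small sets\<close>

lemma card_pairs_le:
  fixes S :: "nat set"
  assumes "finite S" "card S \<le> k"
  shows "card {(x, y). x \<in> S \<and> y \<in> S \<and> x < y} \<le> k ^ 2" and "finite {(x, y). x \<in> S \<and> y \<in> S \<and> x < y}"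
proof -
  have sub: "{(x, y). x \<in> S \<and> y \<in> S \<and> x < y} \<subseteq> S \<times> S" by auto
  then have "card {(x, y). x \<in> S \<and> y \<in> S \<and> x < y} \<le> card (S \<times> S)"
    using assms by (intro card_mono) auto
  also have "\<dots> = card S * card S" by (simp add: card_cartesian_product)
  also have "\<dots> \<le> k ^ 2" using assms by (simp add: power2_eq_square mult_mono)
  finally show "card {(x, y). x \<in> S \<and> y \<in> S \<and> x < y} \<le> k ^ 2" .
  show "finite {(x, y). x \<in> S \<and> y \<in> S \<and> x < y}" using sub assms finite_subset by blast
qed

text \<open>Union bound: the members of \<open>P\<close> together rule out at most
  \<open>card P * b\<close> of the \<open>L\<close> candidates.\<close>

lemma exists_avoiding:
  assumes "finite P" "\<And>x. x \<in> P \<Longrightarrow> card {i\<in>{..<L}. R x i} \<le> b" "card P * b < L"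
  shows "\<exists>i<L. \<forall>x\<in>P. \<not> R x i"
proof (rule ccontr)
  assume "\<not> ?thesis"
  then have "{..<L} \<subseteq> (\<Union>x\<in>P. {i\<in>{..<L}. R x i})" by blast
  then have "card {..<L} \<le> card (\<Union>x\<in>P. {i\<in>{..<L}. R x i})"
    using assms(1) by (intro card_mono) auto
  also have "\<dots> \<le> (\<Sum>x\<in>P. card {i\<in>{..<L}. R x i})" by (rule card_UN_le[OF assms(1)])
  also have "\<dots> \<le> card P * b" using sum_bounded_above[of P _ b] assms(2) by simp
  finally show False using assms(3) by simp
qed

text \<open>There are at most \<open>k ^ 2\<close> pairs of points, each spoiled by fewer than
  \<open>5 * e\<close> multipliers. Here \<open>m\<close> is both the size of the target and, up to
  the factor \<open>e\<close>, the number of multipliers; the 8 in it makes \<open>m * e\<close>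
  exceed \<open>5 * e * k ^ 2\<close>.\<close>

lemma exists_injective_mult:
  assumes p: "prime p" and "p \<le> 2 ^ e" "0 < e" and k: "0 < k" and S: "S \<subseteq> {..<p}" "card S \<le> k"
  defines "m \<equiv> 8 * k ^ 2"
  shows "\<exists>j<m * e. inj_on (\<lambda>x. (mults m p j * x mod p) mod m) S"
proof -
  have fin: "finite S" using S finite_subset by auto
  let ?P = "{(x, y). x \<in> S \<and> y \<in> S \<and> x < y}"
  let ?R = "\<lambda>(x, y) j. clash m p (mults m p j) (y - x)"
  have m: "0 < m" unfolding m_def using k by simp
  have "\<exists>j<m * e. \<forall>z\<in>?P. \<not> ?R z j"
  proof (rule exists_avoiding)
    show "finite ?P" by (rule card_pairs_le[OF fin S(2)])
    fix z assume "z \<in> ?P"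
    then obtain x y where z: "z = (x, y)" "x \<in> S" "y \<in> S" "x < y" by auto
    then have "card {i\<in>{..<m * e}. clash m p (mults m p i) (y - x)} < 5 * e"
      using S by (intro card_clashing_mults p m assms) auto
    then show "card {i\<in>{..<m * e}. ?R z i} \<le> 5 * e" using z by simp
  next
    have "card ?P * (5 * e) \<le> k ^ 2 * (5 * e)"
      by (intro mult_right_mono card_pairs_le fin S) simp
    also have "\<dots> < m * e" unfolding m_def using k \<open>0 < e\<close> by simp
    finally show "card ?P * (5 * e) < m * e" .
  qed
  then obtain j where j: "j < m * e" "\<And>x y. x \<in> S \<Longrightarrow> y \<in> S \<Longrightarrow> x < y \<Longrightarrow> \<not> clash m p (mults m p j) (y - x)"
    by auto
  have "inj_on (\<lambda>x. (mults m p j * x mod p) mod m) S"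
  proof (rule linorder_inj_onI)
    fix x y assume xy: "x < y" "x \<in> S" "y \<in> S"
    show "(mults m p j * x mod p) mod m \<noteq> (mults m p j * y mod p) mod m"
      using j(2)[OF xy(2,3,1)] clash_if_hash_eq[of x y p "mults m p j" m] xy prime_gt_0_nat[OF p] by auto
  qed auto
  then show ?thesis using j(1) by blast
qed

text \<open>Distinct primes are coprime, so their product divides \<open>z\<close> and
  \<open>2 ^ (q * card A) < 2 ^ e\<close>. Larger primes divide less often, which is the source of
  the saving \<open>1 / q\<close> in the number of primes.\<close>

lemma card_prime_divisors:
  fixes z :: nat
  assumes "finite A" "\<And>x. x \<in> A \<Longrightarrow> prime x \<and> 2 ^ q \<le> x \<and> x dvd z" "0 < z" "z < 2 ^ e" "0 < q"
  shows "card A \<le> e div q"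
proof -
  have "\<Prod>A dvd z"
    using assms(1,2)
  proof (induction A rule: finite_induct)
    case (insert x A)
    then have "coprime x (\<Prod>A)"
      by (intro prod_coprime_right) (metis insert_iff primes_coprime)
    then show ?case using insert by (auto intro: divides_mult)
  qed simp
  then have "\<Prod>A \<le> z" using assms by (intro dvd_imp_le)
  moreover have "(2 ^ q) ^ card A \<le> \<Prod>A"
    using assms(2) prod_mono[of A "\<lambda>_. 2 ^ q" "\<lambda>x. x"] by simp
  ultimately have "2 ^ (q * card A) < (2::nat) ^ e" using assms by (simp add: power_mult)
  then have "q * card A < e" by (simp add: power_less_imp_less_exp)
  then show ?thesis using assms(5) by (simp add: less_eq_div_iff_mult_less_eq mult.commute)
qed

lemma exists_injective_prime:
  assumes S: "S \<subseteq> {..2 ^ e}" "0 \<notin> S" "card S \<le> k" and q: "0 < q"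
  shows "\<exists>i<k ^ 2 * (e div q) + 1. inj_on (\<lambda>x. x mod nth_prime_above (2 ^ q) i) S"
proof -
  have fin: "finite S" using S finite_subset by auto
  let ?P = "{(x, y). x \<in> S \<and> y \<in> S \<and> x < y}"
  let ?R = "\<lambda>(x, y) i. nth_prime_above (2 ^ q) i dvd y - x"
  let ?K = "k ^ 2 * (e div q) + 1"
  have "\<exists>i<?K. \<forall>z\<in>?P. \<not> ?R z i"
  proof (rule exists_avoiding)
    show "finite ?P" by (rule card_pairs_le[OF fin S(3)])
    fix z assume "z \<in> ?P"
    then obtain x y where z: "z = (x, y)" "x \<in> S" "y \<in> S" "x < y" by auto
    let ?A = "{i\<in>{..<?K}. nth_prime_above (2 ^ q) i dvd y - x}"
    have "card ?A = card (nth_prime_above (2 ^ q) ` ?A)"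
      using strict_mono_nth_prime_above strict_mono_imp_inj_on
      by (intro card_image[symmetric]) (blast intro: inj_on_subset)
    also have "\<dots> \<le> e div q"
    proof (rule card_prime_divisors)
      \<comment> \<open>Elements are positive, so even \<open>y = 2 ^ e\<close> gives a difference
        strictly below \<open>2 ^ e\<close>.\<close>
      have "x \<noteq> 0" using z S by metis
      moreover have "y \<le> 2 ^ e" using z S by auto
      ultimately show "y - x < 2 ^ e" using z by linarith
    qed (use z q in \<open>auto simp: nth_prime_above less_imp_le\<close>)
    finally show "card {i\<in>{..<?K}. ?R z i} \<le> e div q" using z by simp
  next
    have "card ?P * (e div q) \<le> k ^ 2 * (e div q)"
      by (intro mult_right_mono card_pairs_le fin S) simp
    then show "card ?P * (e div q) < ?K" by linarith
  qed
  then obtain i where i: "i < ?K" "\<And>x y. x \<in> S \<Longrightarrow> y \<in> S \<Longrightarrow> x < y \<Longrightarrow> \<not> nth_prime_above (2 ^ q) i dvd y - x"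
    by auto
  have "inj_on (\<lambda>x. x mod nth_prime_above (2 ^ q) i) S"
  proof (rule linorder_inj_onI)
    fix x y assume xy: "x < y" "x \<in> S" "y \<in> S"
    show "x mod nth_prime_above (2 ^ q) i \<noteq> y mod nth_prime_above (2 ^ q) i"
      using i(2)[OF xy(2,3,1)] mod_eq_dvd_iff_nat[OF less_imp_le[OF xy(1)]] by metis
  qed auto
  then show ?thesis using i(1) by blast
qed

section \<open>Isolating codes\<close>

text \<open>
  A code \<open>N\<close> is a string of symbols read from the mixed-radix digits of a number.  The scan keeps a
  multiplier \<open>a\<close>, a block length \<open>w\<close>, the start \<open>b\<close> of the current block of cells and the next
  colour \<open>j\<close>.  Symbol 0 moves to the next block; symbol 1 gives colour \<open>j\<close> to a cell of the current
  block, whose offset follows; symbol 2 starts a new round with the multiplier that follows and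
  blocks twice as long.  The code 0 reads as an endless run of symbols 0, so surplus fuel is harmless.
\<close>

fun decode :: "nat \<Rightarrow> nat \<Rightarrow> nat \<Rightarrow> nat \<Rightarrow> nat \<Rightarrow> nat \<Rightarrow> nat \<Rightarrow> nat \<Rightarrow> nat \<Rightarrow> nat \<Rightarrow> nat" where
  "decode p m t y 0 N w a b j = t + 1"
| "decode p m t y (Suc f) N w a b j =
     (if N mod 3 = 0 then decode p m t y f (N div 3) w a (b + w) j
      else if N mod 3 = 1 then
        (if a * y mod p mod m = b + N div 3 mod w then min j (t + 1)
         else decode p m t y f (N div 3 div w) w a b (j + 1))
      else decode p m t y f (N div 3 div p) (2 * w) (N div 3 mod p) 0 j)"

lemma decode_0: "decode p m t y f 0 w a b j = t + 1"
  by (induction f arbitrary: b) auto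

text \<open>Every number is read as a code, and most are meaningless. The \<open>min\<close> in
  \<open>decode\<close> keeps even these in range, so that every enumerated table is a function into
  \<open>{1..t + 1}\<close>.\<close>

lemma decode_le: "decode p m t y f N w a b j \<le> t + 1"
  by (induction f arbitrary: N w a b j) auto

lemma decode_ge: "1 \<le> j \<Longrightarrow> 1 \<le> decode p m t y f N w a b j"
  by (induction f arbitrary: N w a b j) auto

lemma symbol_code:
  fixes x :: nat
  shows "(1 + 3 * x) mod 3 = 1" "(1 + 3 * x) div 3 = x" "(2 + 3 * x) mod 3 = 2" "(2 + 3 * x) div 3 = x"
  by presburger+

text \<open>One round with the multiplier \<open>a\<close> already chosen; \<open>V\<close> is the
  set of cells to be coloured, all in the blocks \<open>\<beta>\<close> to
  \<open>\<beta> + z\<close>. The code \<open>N0\<close> of the later rounds forms the high digits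
  of \<open>N\<close>: a point whose cell is outside \<open>V\<close> reads past this round and
  reaches \<open>N0\<close> with at least \<open>F\<close> units of fuel left. A block move costs a
  factor 3, a coloured cell a factor \<open>3 * w\<close>.\<close>

lemma decode_block:
  fixes a p m :: nat
  assumes w: "0 < w" and N0: "N0 < B"
  defines "h \<equiv> \<lambda>y. a * y mod p mod m"
  assumes V: "finite V" "\<And>v. v \<in> V \<Longrightarrow> \<beta> \<le> v div w \<and> v div w \<le> \<beta> + z" "j + card V \<le> t + 1"
  shows "\<exists>N \<sigma>. N < 3 ^ z * (3 * w) ^ card V * B \<and> bij_betw \<sigma> V {j..<j + card V} \<and>
    (\<forall>y f. h y \<in> V \<longrightarrow> z + card V \<le> f \<longrightarrow> decode p m t y f N w a (\<beta> * w) j = \<sigma> (h y)) \<and>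
    (\<forall>y f. h y \<notin> V \<longrightarrow> z + card V + F \<le> f \<longrightarrow>
       (\<exists>f' b'. F \<le> f' \<and> decode p m t y f N w a (\<beta> * w) j = decode p m t y f' N0 w a b' (j + card V)))"
  using V
proof (induction "z + card V" arbitrary: V \<beta> z j rule: less_induct)
  case less
  note V = less.prems
  \<comment> \<open>The current block is emptied cell by cell, in any order since offsets are
    explicit, before the next block is entered; either action decreases
    \<open>z + card V\<close>.\<close>
  consider (empty) "V = {}" | (emit) v where "v \<in> V" "v div w = \<beta>"
    | (step) "V \<noteq> {}" "\<And>v. v \<in> V \<Longrightarrow> v div w \<noteq> \<beta>" by blast
  then show ?case
  proof cases
    case empty
    have "B \<le> 3 ^ z * B" by simp
    then have "N0 < 3 ^ z * B" using N0 by (rule less_le_trans[rotated])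
    then have "N0 < 3 ^ z * (3 * w) ^ card V * B" using empty by simp
    moreover have "bij_betw (\<lambda>_. 0) V {j..<j + card V}" using empty by (simp add: bij_betw_def)
    moreover have "\<forall>y f. h y \<notin> V \<longrightarrow> z + card V + F \<le> f \<longrightarrow>
       (\<exists>f' b'. F \<le> f' \<and> decode p m t y f N0 w a (\<beta> * w) j = decode p m t y f' N0 w a b' (j + card V))"
      using empty by (intro allI impI exI conjI) auto
    ultimately show ?thesis using empty by blast
  next
    case emit
    let ?V = "V - {v}"
    have card: "card V = Suc (card ?V)" using V(1) emit(1) by (rule card.remove)
    obtain N \<sigma> where IH: "N < 3 ^ z * (3 * w) ^ card ?V * B" "bij_betw \<sigma> ?V {Suc j..<Suc j + card ?V}"
      "\<forall>y f. h y \<in> ?V \<longrightarrow> z + card ?V \<le> f \<longrightarrow> decode p m t y f N w a (\<beta> * w) (Suc j) = \<sigma> (h y)"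
      "\<forall>y f. h y \<notin> ?V \<longrightarrow> z + card ?V + F \<le> f \<longrightarrow>
       (\<exists>f' b'. F \<le> f' \<and> decode p m t y f N w a (\<beta> * w) (Suc j) = decode p m t y f' N0 w a b' (Suc j + card ?V))"
    proof -
      have "z + card ?V < z + card V" "finite ?V" "Suc j + card ?V \<le> t + 1" using V card by auto
      moreover have "\<And>u. u \<in> ?V \<Longrightarrow> \<beta> \<le> u div w \<and> u div w \<le> \<beta> + z" using V(2) by blast
      ultimately show thesis using less.hyps[of z ?V \<beta> "Suc j"] that by blast
    qed
    \<comment> \<open>From the lowest digit upwards: symbol 1, the offset of \<open>v\<close> in its
      block, the remaining code \<open>N\<close>.\<close>
    define N' where "N' = 1 + 3 * (v mod w + w * N)"
    have mod: "N' mod 3 = 1" "N' div 3 = v mod w + w * N" unfolding N'_def by (simp_all only: symbol_code)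
    have dm: "N' div 3 mod w = v mod w" "N' div 3 div w = N" using w unfolding mod by auto
    have v: "\<beta> * w + v mod w = v" using emit(2) by (metis div_mult_mod_eq)
    have decode: "decode p m t y (Suc f) N' w a (\<beta> * w) j = (if h y = v then min j (t + 1) else
      decode p m t y f N w a (\<beta> * w) (Suc j))" for y f
      by (simp add: mod(1) dm v h_def)
    have bound: "N' < 3 ^ z * (3 * w) ^ card V * B"
    proof -
      have "N' < 3 * w * (N + 1)" using mod_less_divisor[OF w, of v] unfolding N'_def
        by (simp add: algebra_simps)
      also have "\<dots> \<le> 3 * w * (3 ^ z * (3 * w) ^ card ?V * B)" using IH(1) by (intro mult_left_mono) auto
      also have "\<dots> = 3 ^ z * (3 * w) ^ card V * B" unfolding card by (simp add: mult_ac)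
      finally show ?thesis .
    qed
    have bij: "bij_betw (\<sigma>(v := j)) V {j..<j + card V}"
    proof -
      have "bij_betw (\<sigma>(v := j)) ?V {Suc j..<Suc j + card ?V}"
        using IH(2) by (subst bij_betw_cong[of _ _ \<sigma>]) auto
      then have "bij_betw (\<sigma>(v := j)) (?V \<union> {v}) ({Suc j..<Suc j + card ?V} \<union> {j})"
        using notIn_Un_bij_betw[of v ?V "\<sigma>(v := j)" "{Suc j..<Suc j + card ?V}"] by simp
      moreover have "?V \<union> {v} = V" using emit by auto
      moreover have "{Suc j..<Suc j + card ?V} \<union> {j} = {j..<j + card V}" unfolding card by auto
      ultimately show ?thesis by simp
    qed
    have "decode p m t y f N' w a (\<beta> * w) j = (\<sigma>(v := j)) (h y)" if "h y \<in> V" "z + card V \<le> f" for y f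

    proof -
      have "0 < f" using that card by simp
      then obtain f1 where f1: "f = Suc f1" by (cases f) auto
      have "z + card ?V \<le> f1" using that(2) f1 card by simp
      then show ?thesis using that IH(3) V(3) card unfolding f1 decode by simp
    qed
    moreover have "\<exists>f' b'. F \<le> f' \<and> decode p m t y f N' w a (\<beta> * w) j = decode p m t y f' N0 w a b' (j + card V)"
      if "h y \<notin> V" "z + card V + F \<le> f" for y f
    proof -
      have "0 < f" using that card by simp
      then obtain f1 where f1: "f = Suc f1" by (cases f) auto
      have "z + card ?V + F \<le> f1" using that(2) f1 card by simp
      moreover have "h y \<notin> ?V" "h y \<noteq> v" using that emit by auto
      ultimately show ?thesis using IH(4) card unfolding f1 decode by (auto simp del: decode.simps)
    qed
    ultimately show ?thesis using bound bij by blast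
  next
    case step
    \<comment> \<open>No cell of \<open>V\<close> lies in block \<open>\<beta>\<close>, so the
      window may start at \<open>Suc \<beta>\<close> with one block less; \<open>z\<close> is
      positive because \<open>V\<close> is nonempty.\<close>
    have ge: "Suc \<beta> \<le> v div w" if "v \<in> V" for v using V(2)[OF that] step(2)[OF that] by auto
    obtain v where "v \<in> V" using step(1) by blast
    then obtain z' where z: "z = Suc z'" using V(2)[of v] ge[of v] by (cases z) auto
    have V': "\<And>v. v \<in> V \<Longrightarrow> Suc \<beta> \<le> v div w \<and> v div w \<le> Suc \<beta> + z'" using V(2) ge z by auto
    obtain N \<sigma> where IH: "N < 3 ^ z' * (3 * w) ^ card V * B" "bij_betw \<sigma> V {j..<j + card V}"
      "\<forall>y f. h y \<in> V \<longrightarrow> z' + card V \<le> f \<longrightarrow> decode p m t y f N w a (Suc \<beta> * w) j = \<sigma> (h y)"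
      "\<forall>y f. h y \<notin> V \<longrightarrow> z' + card V + F \<le> f \<longrightarrow>
       (\<exists>f' b'. F \<le> f' \<and> decode p m t y f N w a (Suc \<beta> * w) j = decode p m t y f' N0 w a b' (j + card V))"
    proof -
      have "z' + card V < z + card V" using z by simp
      then show thesis using less.hyps[of z' V "Suc \<beta>" j] V(1) V' V(3) that by blast
    qed
    have decode: "decode p m t y (Suc f) (3 * N) w a (\<beta> * w) j = decode p m t y f N w a (Suc \<beta> * w) j" for y f
      by (simp add: add.commute)
    have "3 * N < 3 ^ z * (3 * w) ^ card V * B" using IH(1) z by simp
    moreover have "decode p m t y f (3 * N) w a (\<beta> * w) j = \<sigma> (h y)" if "h y \<in> V" "z + card V \<le> f" for y f
    proof -
      have "0 < f" using that z by simp
      then obtain f1 where f1: "f = Suc f1" by (cases f) auto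
      show ?thesis unfolding f1 decode by (rule IH(3)[rule_format]) (use that z f1 in auto)
    qed
    moreover have "\<exists>f' b'. F \<le> f' \<and> decode p m t y f (3 * N) w a (\<beta> * w) j = decode p m t y f' N0 w a b' (j + card V)"
      if "h y \<notin> V" "z + card V + F \<le> f" for y f
    proof -
      have "0 < f" using that z by simp
      then obtain f1 where f1: "f = Suc f1" by (cases f) auto
      show ?thesis unfolding f1 decode by (rule IH(4)[rule_format]) (use that z f1 in auto)
    qed
    ultimately show ?thesis using IH(2) by blast
  qed
qed

text \<open>\<open>exists_few_clashes\<close> with weight 1 on the pairs of some \<open>c\<close> in
  \<open>C\<close> and another \<open>x\<close> in \<open>S\<close>, at most
  \<open>card C * k\<close> in number. A \<open>c\<close> that is not isolated is the first
  component of a clashing pair.\<close>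

lemma exists_isolating:
  assumes p: "prime p" and m: "0 < m" and S: "S \<subseteq> {..<p}" "card S \<le> k" and C: "C \<subseteq> S"
  shows "\<exists>a<p. m * card {c\<in>C. \<exists>x\<in>S. x \<noteq> c \<and> a * x mod p mod m = a * c mod p mod m} \<le> 2 * (card C * k)"
proof -
  have "finite S" using S(1) finite_subset by auto
  with C have fin: "finite S" "finite C" using finite_subset by auto
  let ?I = "{(c, x). c \<in> C \<and> x \<in> S \<and> x \<noteq> c}"
  let ?d = "\<lambda>(c, x). adiff c x"
  have sub: "?I \<subseteq> C \<times> S" by auto
  then have finI: "finite ?I" using fin finite_subset by blast
  have "card ?I \<le> card (C \<times> S)" using sub fin by (intro card_mono) auto
  then have cardI: "card ?I \<le> card C * k"
    using S(2) by (simp add: card_cartesian_product) (meson le_trans mult_le_mono2)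
  have "\<exists>a\<in>{1..<p}. m * (\<Sum>i\<in>{i\<in>?I. clash m p a (?d i)}. 1) \<le> 2 * (\<Sum>i\<in>?I. 1)"
    using finI
  proof (rule exists_few_clashes[OF p m])
    fix i assume "i \<in> ?I"
    then obtain c x where "i = (c, x)" "c \<noteq> x" "c \<in> S" "x \<in> S" using C by auto
    then show "0 < ?d i \<and> ?d i < p" using adiff_bounds[of c x p] S by auto
  qed
  then obtain a where a: "a < p" "m * card {i\<in>?I. clash m p a (?d i)} \<le> 2 * card ?I" by auto
  let ?B = "{c\<in>C. \<exists>x\<in>S. x \<noteq> c \<and> a * x mod p mod m = a * c mod p mod m}"
  have "?B \<subseteq> fst ` {i\<in>?I. clash m p a (?d i)}"
  proof
    fix c assume "c \<in> ?B"
    then obtain x where x: "c \<in> C" "x \<in> S" "x \<noteq> c" "a * x mod p mod m = a * c mod p mod m" by auto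
    then have "clash m p a (adiff c x)"
      using clash_adiff_if_hash_eq[of c x p a m] prime_gt_0_nat[OF p] by metis
    then show "c \<in> fst ` {i\<in>?I. clash m p a (?d i)}" using x by (intro image_eqI[of _ _ "(c, x)"]) auto
  qed
  then have "card ?B \<le> card {i\<in>?I. clash m p a (?d i)}" using finI by (intro surj_card_le) auto
  then have "m * card ?B \<le> m * card {i\<in>?I. clash m p a (?d i)}" by (rule mult_left_mono) simp
  then have "m * card ?B \<le> 2 * (card C * k)" using a(2) cardI by linarith
  then show ?thesis using a(1) by blast
qed

text \<open>By \<open>exists_isolating\<close>, at most \<open>2 * x * k / m\<close> of
  \<open>x\<close> elements fail to be isolated; for \<open>4 * k ^ 2 <= m * t\<close> this is at
  most \<open>x * t / (2 * k)\<close>.\<close>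

definition decay :: "nat \<Rightarrow> nat \<Rightarrow> nat \<Rightarrow> nat" where
  "decay t k x = x * t div (2 * k)"

lemma decay_mono: "x \<le> y \<Longrightarrow> decay t k x \<le> decay t k y"
  unfolding decay_def by (intro div_le_mono mult_right_mono) auto

text \<open>
  In each round, the elements of \<open>C\<close> isolated by a multiplier with few clashes receive their
  colours, and the remaining ones, at most \<open>decay t k\<close> of them, are left to later rounds.  Their
  number at least halves, so that doubling the block length in each round costs at most a factor
  \<open>2 ^ card C\<close> in the offsets, while the numbers of blocks passed form a geometric series.
\<close>

lemma exists_code:
  assumes p: "prime p" and tk: "0 < t" "t \<le> k" and m: "4 * k ^ 2 \<le> m * t"
  assumes "C \<inter> D = {}" "C \<union> D \<subseteq> {..<p}" "card (C \<union> D) \<le> k" "card C \<le> X" "(decay t k ^^ r) X = 0"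
    "j + card C \<le> t + 1" "0 < w"
  shows "\<exists>N \<sigma>. N < (3 * p) ^ r * 9 ^ (m div (2 * w)) * (12 * w) ^ card C \<and>
    bij_betw \<sigma> C {j..<j + card C} \<and>
    (\<forall>f a b. r + 2 * (m div (2 * w)) + card C \<le> f \<longrightarrow>
      (\<forall>y\<in>C. decode p m t y f N w a b j = \<sigma> y) \<and> (\<forall>y\<in>D. decode p m t y f N w a b j = t + 1))"
  using assms(5-)
proof (induction r arbitrary: C X j w)
  case 0
  then have "finite C" using finite_subset by auto
  then have "C = {}" using 0 by auto
  then show ?case by (intro exI[of _ 0]) (auto simp: decode_0 bij_betw_def)
next
  case (Suc r)
  have fin: "finite (C \<union> D)" using Suc.prems(2) finite_subset by auto
  have m0: "0 < m" using m tk by (cases m) auto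
  define h where "h = (\<lambda>a y. a * y mod p mod m)"
  obtain a where a: "a < p"
    "m * card {c\<in>C. \<exists>x\<in>C \<union> D. x \<noteq> c \<and> h a x = h a c} \<le> 2 * (card C * k)"
    using exists_isolating[OF p m0 Suc.prems(2,3), of C] unfolding h_def by blast
  define C2 where "C2 = {c\<in>C. \<exists>x\<in>C \<union> D. x \<noteq> c \<and> h a x = h a c}"
  define C1 where "C1 = C - C2"
  define V where "V = h a ` C1"
  have C: "C = C1 \<union> C2" "C1 \<inter> C2 = {}" unfolding C1_def C2_def by auto
  have fin12: "finite C1" "finite C2" using fin C by auto
  have cardC: "card C = card C1 + card C2" using C fin12 card_Un_disjoint by metis
  have iso: "h a x \<noteq> h a c" if "c \<in> C1" "x \<in> C \<union> D" "x \<noteq> c" for c x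
    using that unfolding C1_def C2_def by blast
  have inj: "inj_on (h a) C1" by (rule inj_onI) (use iso C in blast)
  have cardV: "card V = card C1" unfolding V_def using inj by (rule card_image)
  have "card C2 * (2 * k) \<le> card C * t"
  proof -
    have "card C2 * (4 * k ^ 2) \<le> card C2 * (m * t)" using m by (rule mult_left_mono) simp
    also have "\<dots> = (m * card C2) * t" by (simp add: mult_ac)
    also have "\<dots> \<le> 2 * (card C * k) * t" using a(2) unfolding C2_def by (rule mult_right_mono) simp
    finally have "(card C2 * (2 * k)) * (2 * k) \<le> (card C * t) * (2 * k)"
      by (simp add: power2_eq_square mult_ac)
    then show ?thesis using tk by (simp only: mult_le_cancel2)
  qed
  then have "card C2 \<le> decay t k (card C)"
    unfolding decay_def using tk by (simp add: less_eq_div_iff_mult_less_eq)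
  then have C2X: "card C2 \<le> decay t k X" using decay_mono[OF Suc.prems(4)] by (rule order_trans)
  have half: "2 * card C2 \<le> card C"
  proof -
    have "(2 * card C2) * k \<le> card C * t" using \<open>card C2 * (2 * k) \<le> card C * t\<close> by (simp add: mult_ac)
    also have "\<dots> \<le> card C * k" using tk by simp
    finally show ?thesis using tk by simp
  qed
  let ?B = "(3 * p) ^ r * 9 ^ (m div (2 * (2 * w))) * (12 * (2 * w)) ^ card C2"
  let ?F = "r + 2 * (m div (2 * (2 * w))) + card C2"
  \<comment> \<open>Symbol 2 doubles the block length before any cell of the round is read, so this
    round already has blocks of length \<open>2 * w\<close> and needs at most \<open>?z\<close>
    block moves, and the induction hypothesis is used at \<open>2 * w\<close>.\<close>
  let ?z = "m div (2 * w)"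
  let ?P = "\<lambda>N \<sigma>. N < ?B \<and>
    bij_betw \<sigma> C2 {j + card C1..<j + card C1 + card C2} \<and>
    (\<forall>f a b. ?F \<le> f \<longrightarrow>
      (\<forall>y\<in>C2. decode p m t y f N (2 * w) a b (j + card C1) = \<sigma> y) \<and>
      (\<forall>y\<in>D. decode p m t y f N (2 * w) a b (j + card C1) = t + 1))"
  have "\<exists>N \<sigma>. ?P N \<sigma>"
  proof (rule Suc.IH)
    have "C2 \<union> D \<subseteq> C \<union> D" using C by blast
    then show "card (C2 \<union> D) \<le> k" using card_mono[OF fin] Suc.prems(3) by (blast intro: order_trans)
    show "(decay t k ^^ r) (decay t k X) = 0" using Suc.prems(5) by (simp add: funpow_swap1)
    show "C2 \<inter> D = {}" "C2 \<union> D \<subseteq> {..<p}" using Suc.prems(1,2) C by blast+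
    show "card C2 \<le> decay t k X" by (rule C2X)
    show "j + card C1 + card C2 \<le> t + 1" "0 < 2 * w" using Suc.prems(6,7) cardC by auto
  qed
  then obtain N2 \<sigma>2 where P: "?P N2 \<sigma>2" by blast
  note N2 = P[THEN conjunct1] P[THEN conjunct2, THEN conjunct1] P[THEN conjunct2, THEN conjunct2]
  have Vdiv: "0 \<le> v div (2 * w) \<and> v div (2 * w) \<le> 0 + ?z" if "v \<in> V" for v
  proof -
    have "v < m" using that m0 unfolding V_def h_def by auto
    then show ?thesis by (simp add: div_le_mono)
  qed
  let ?Q = "\<lambda>N \<sigma>. N < 3 ^ ?z * (3 * (2 * w)) ^ card V * ?B \<and> bij_betw \<sigma> V {j..<j + card V} \<and>
    (\<forall>y f. h a y \<in> V \<longrightarrow> ?z + card V \<le> f \<longrightarrow> decode p m t y f N (2 * w) a (0 * (2 * w)) j = \<sigma> (h a y)) \<and>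
    (\<forall>y f. h a y \<notin> V \<longrightarrow> ?z + card V + ?F \<le> f \<longrightarrow>
       (\<exists>f' b'. ?F \<le> f' \<and> decode p m t y f N (2 * w) a (0 * (2 * w)) j = decode p m t y f' N2 (2 * w) a b' (j + card V)))"
  have "\<exists>N \<sigma>. ?Q N \<sigma>"
    unfolding h_def
  proof (rule decode_block[OF _ N2(1)])
    show "0 < 2 * w" using Suc.prems(7) by simp
    show "finite V" unfolding V_def using fin12 by simp
    show "j + card V \<le> t + 1" using Suc.prems(6) cardC cardV by simp
  qed (rule Vdiv)
  then obtain N1 \<sigma>1 where "?Q N1 \<sigma>1" by blast
  note Q = this[unfolded cardV mult_0]
  note N1 = Q[THEN conjunct1] Q[THEN conjunct2, THEN conjunct1]
    Q[THEN conjunct2, THEN conjunct2, THEN conjunct1] Q[THEN conjunct2, THEN conjunct2, THEN conjunct2]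
  \<comment> \<open>Symbol 2, then the multiplier \<open>a\<close>, then the code of the round. It
    overwrites the multiplier and the block start in force before, which is why the claim can hold
    for all of them.\<close>
  define N where "N = 2 + 3 * (a + p * N1)"
  have mod: "N mod 3 = 2" "N div 3 = a + p * N1" unfolding N_def by (simp_all only: symbol_code)
  have dm: "N div 3 mod p = a" "N div 3 div p = N1" using a(1) unfolding mod by auto
  have decode: "decode p m t y (Suc f) N w a' b j = decode p m t y f N1 (2 * w) a 0 j" for y f a' b
    by (simp add: mod(1) dm)
  have zz: "2 * (m div (2 * (2 * w))) \<le> ?z"
    by (metis div_mult2_eq mult.commute times_div_less_eq_dividend)
  have bound: "N < (3 * p) ^ Suc r * 9 ^ ?z * (12 * w) ^ card C"
  proof -
    have "N < 3 * p * (N1 + 1)" using a(1) unfolding N_def by (simp add: algebra_simps)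
    also have "\<dots> \<le> 3 * p * (3 ^ ?z * (3 * (2 * w)) ^ card C1 * ?B)" using N1(1) by (intro mult_left_mono) auto
    also have "\<dots> = (3 * p) ^ Suc r * (3 ^ ?z * 9 ^ (m div (2 * (2 * w)))) * ((6 * w) ^ card C1 * (24 * w) ^ card C2)"
      by (simp add: mult_ac)
    \<comment> \<open>The exponent of 9 is at most half of \<open>?z\<close> by \<open>zz\<close>,
      so the two powers together are at most \<open>9 ^ ?z\<close>. The offsets of later rounds cost
      an extra \<open>4 ^ card C2\<close>, which is at most \<open>2 ^ card C\<close> because at
      most half of \<open>C\<close> is left.\<close>
    also have "\<dots> \<le> (3 * p) ^ Suc r * 9 ^ ?z * (12 * w) ^ card C"
    proof (intro mult_mono mult_left_mono)
      have "(9::nat) ^ (m div (2 * (2 * w))) = (3 ^ 2) ^ (m div (2 * (2 * w)))" by simp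
      also have "\<dots> = 3 ^ (2 * (m div (2 * (2 * w))))" by (simp only: power_mult)
      also have "\<dots> \<le> 3 ^ ?z" using zz by (intro power_increasing) auto
      finally have "(3::nat) ^ ?z * 9 ^ (m div (2 * (2 * w))) \<le> 3 ^ ?z * 3 ^ ?z"
        by (rule mult_left_mono) simp
      also have "\<dots> = (3 * 3) ^ ?z" by (rule power_mult_distrib[symmetric])
      finally show "(3::nat) ^ ?z * 9 ^ (m div (2 * (2 * w))) \<le> 9 ^ ?z" by simp
      have "(24 * w) ^ card C2 = (4 * (6 * w)) ^ card C2" by simp
      also have "\<dots> = 2 ^ (2 * card C2) * (6 * w) ^ card C2"
        by (simp only: power_mult power_mult_distrib) simp
      finally have "(6 * w) ^ card C1 * (24 * w) ^ card C2 = 2 ^ (2 * card C2) * (6 * w) ^ card C"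
        by (simp only: cardC power_add mult_ac)
      also have "\<dots> \<le> 2 ^ card C * (6 * w) ^ card C" using half by (intro mult_right_mono power_increasing) auto
      also have "\<dots> = (2 * (6 * w)) ^ card C" by (rule power_mult_distrib[symmetric])
      also have "2 * (6 * w) = 12 * w" by simp
      finally show "(6 * w) ^ card C1 * (24 * w) ^ card C2 \<le> (12 * w) ^ card C" .
    qed auto
    finally show ?thesis .
  qed
  define \<sigma> where "\<sigma> = (\<lambda>y. if y \<in> C1 then \<sigma>1 (h a y) else \<sigma>2 y)"
  have bij: "bij_betw \<sigma> C {j..<j + card C}"
  proof -
    have "bij_betw (\<sigma>1 \<circ> h a) C1 {j..<j + card C1}"
      using inj N1(2) unfolding V_def by (intro bij_betw_trans) (auto simp: bij_betw_def)
    then have "bij_betw \<sigma> C1 {j..<j + card C1}"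
      by (subst bij_betw_cong[of _ _ "\<sigma>1 \<circ> h a"]) (auto simp: \<sigma>_def)
    moreover have "bij_betw \<sigma> C2 {j + card C1..<j + card C1 + card C2}"
      using N2(2) C by (subst bij_betw_cong[of _ _ \<sigma>2]) (auto simp: \<sigma>_def)
    ultimately have "bij_betw \<sigma> (C1 \<union> C2) ({j..<j + card C1} \<union> {j + card C1..<j + card C1 + card C2})"
      by (rule bij_betw_combine) auto
    moreover have "{j..<j + card C1} \<union> {j + card C1..<j + card C1 + card C2} = {j..<j + card C}"
      using cardC by auto
    ultimately show ?thesis using C by simp
  qed
  have "(\<forall>y\<in>C. decode p m t y f N w a' b j = \<sigma> y) \<and> (\<forall>y\<in>D. decode p m t y f N w a' b j = t + 1)"
    if f: "Suc r + 2 * ?z + card C \<le> f" for f a' b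
  proof -
    obtain f1 where f1: "f = Suc f1" using f by (cases f) auto
    have le: "?z + card C1 + ?F \<le> f1" using f f1 zz cardC by linarith
    have 1: "decode p m t y f N w a' b j = \<sigma> y" if "y \<in> C1" for y
      unfolding f1 decode using that le N1(3) by (simp add: V_def \<sigma>_def)
    \<comment> \<open>The elements of \<open>C1\<close> are isolated from all of
      \<open>C \<union> D\<close>, so no other point falls into a coloured cell.\<close>
    have notV: "h a y \<notin> V" if "y \<in> C2 \<union> D" for y
    proof
      assume "h a y \<in> V"
      then obtain c where "c \<in> C1" "h a c = h a y" unfolding V_def by auto
      then show False using iso[of c y] that C Suc.prems(1) by auto
    qed
    have 2: "decode p m t y f N w a' b j = \<sigma> y" if "y \<in> C2" for y
    proof -
      have "y \<notin> C1" using that C by auto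
      moreover have "h a y \<notin> V" using notV that by blast
      then obtain f' b' where "?F \<le> f'"
        "decode p m t y f1 N1 (2 * w) a 0 j = decode p m t y f' N2 (2 * w) a b' (j + card C1)"
        using N1(4) le by blast
      moreover from this have "decode p m t y f' N2 (2 * w) a b' (j + card C1) = \<sigma>2 y" using N2(3) that by blast
      ultimately show ?thesis unfolding f1 decode \<sigma>_def by simp
    qed
    have 3: "decode p m t y f N w a' b j = t + 1" if "y \<in> D" for y
    proof -
      have "h a y \<notin> V" using notV that by blast
      then obtain f' b' where "?F \<le> f'"
        "decode p m t y f1 N1 (2 * w) a 0 j = decode p m t y f' N2 (2 * w) a b' (j + card C1)"
        using N1(4) le by blast
      moreover from this have "decode p m t y f' N2 (2 * w) a b' (j + card C1) = t + 1" using N2(3) that by blast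
      ultimately show ?thesis unfolding f1 decode by simp
    qed
    show ?thesis using 1 2 3 C(1) by blast
  qed
  then show ?case using bound bij by blast
qed

section \<open>Program correctness with exact running times\<close>

text \<open>A weakest precondition for total correctness whose postcondition also sees the running
  time. The rules for loop-free commands are equivalences, so that rewriting executes such code
  symbolically.\<close>

definition runs :: "nat \<Rightarrow> com \<Rightarrow> state \<Rightarrow> (nat \<Rightarrow> state \<Rightarrow> bool) \<Rightarrow> bool" where
  "runs w c s Q \<longleftrightarrow> (\<exists>T s'. exec w c s T s' \<and> Q T s')"

lemma runs_mono: "runs w c s Q \<Longrightarrow> (\<And>T s'. Q T s' \<Longrightarrow> Q' T s') \<Longrightarrow> runs w c s Q'"
  unfolding runs_def by blast

lemma runs_Skip: "runs w Skip s Q \<longleftrightarrow> Q 1 s"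
proof
  show "runs w Skip s Q \<Longrightarrow> Q 1 s" unfolding runs_def by (auto elim: exec.cases)
  show "Q 1 s \<Longrightarrow> runs w Skip s Q" unfolding runs_def using exec.Skip by blast
qed

lemma runs_Assign: "runs w (Assign x a) s Q \<longleftrightarrow>
    afits w a s \<and> Q (1 + acost a) (s\<lparr>reg := (reg s)(x := aval a s)\<rparr>)" (is "?L \<longleftrightarrow> ?R")
proof
  show "?L \<Longrightarrow> ?R" unfolding runs_def by (auto elim: exec.cases)
  show "?R \<Longrightarrow> ?L" unfolding runs_def using exec.Assign by blast
qed

lemma runs_Store: "runs w (Store A i a) s Q \<longleftrightarrow> afits w i s \<and> afits w a s \<and>
    Q (1 + acost i + acost a) (s\<lparr>arr := (arr s)(A := (arr s A)(aval i s := aval a s))\<rparr>)"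
  (is "?L \<longleftrightarrow> ?R")
proof
  show "?L \<Longrightarrow> ?R" unfolding runs_def by (auto elim: exec.cases)
  show "?R \<Longrightarrow> ?L" unfolding runs_def using exec.Store by blast
qed

lemma runs_Output: "runs w (Output a) s Q \<longleftrightarrow>
    afits w a s \<and> Q (1 + acost a) (s\<lparr>out := out s @ [aval a s]\<rparr>)" (is "?L \<longleftrightarrow> ?R")
proof
  show "?L \<Longrightarrow> ?R" unfolding runs_def by (auto elim: exec.cases)
  show "?R \<Longrightarrow> ?L" unfolding runs_def using exec.Output by blast
qed

lemma runs_Seq: "runs w (Seq c1 c2) s Q \<longleftrightarrow>
    runs w c1 s (\<lambda>T1 s1. runs w c2 s1 (\<lambda>T2 s2. Q (1 + T1 + T2) s2))"
proof
  assume "runs w (Seq c1 c2) s Q"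
  then obtain T s' where "exec w (Seq c1 c2) s T s'" "Q T s'" unfolding runs_def by blast
  then show "runs w c1 s (\<lambda>T1 s1. runs w c2 s1 (\<lambda>T2 s2. Q (1 + T1 + T2) s2))"
    by cases (auto simp: runs_def)
next
  assume "runs w c1 s (\<lambda>T1 s1. runs w c2 s1 (\<lambda>T2 s2. Q (1 + T1 + T2) s2))"
  then show "runs w (Seq c1 c2) s Q" unfolding runs_def by (blast intro: exec.Seq)
qed

lemma runs_Cond: "runs w (Cond b c1 c2) s Q \<longleftrightarrow> bfits w b s \<and>
    (if bval b s then runs w c1 s (\<lambda>T. Q (1 + bcost b + T)) else runs w c2 s (\<lambda>T. Q (1 + bcost b + T)))"
proof
  assume "runs w (Cond b c1 c2) s Q"
  then obtain T s' where "exec w (Cond b c1 c2) s T s'" "Q T s'" unfolding runs_def by blast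
  then show "bfits w b s \<and>
    (if bval b s then runs w c1 s (\<lambda>T. Q (1 + bcost b + T)) else runs w c2 s (\<lambda>T. Q (1 + bcost b + T)))"
    by cases (auto simp: runs_def)
next
  assume "bfits w b s \<and>
    (if bval b s then runs w c1 s (\<lambda>T. Q (1 + bcost b + T)) else runs w c2 s (\<lambda>T. Q (1 + bcost b + T)))"
  then show "runs w (Cond b c1 c2) s Q" unfolding runs_def
    using exec.CondTrue exec.CondFalse by (cases "bval b s") (simp, blast)+
qed

lemmas runs_simps = runs_Skip runs_Assign runs_Store runs_Output runs_Seq runs_Cond

lemma runs_Assign_Seq: "runs w (Seq (Assign x a) c) s Q \<longleftrightarrow> afits w a s \<and>
    runs w c (s\<lparr>reg := (reg s)(x := aval a s)\<rparr>) (\<lambda>T. Q (1 + (1 + acost a) + T))"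
  unfolding runs_Seq runs_Assign by simp

lemma runs_SeqI:
  assumes "runs w c1 s Q1" "\<And>T1 s1. Q1 T1 s1 \<Longrightarrow> runs w c2 s1 (\<lambda>T2 s2. Q (1 + T1 + T2) s2)"
  shows "runs w (Seq c1 c2) s Q"
  unfolding runs_Seq using assms by (rule runs_mono)

text \<open>
  Registers, arrays and output that a program does not mention are preserved; this frame is supplied
  to loop bodies, so that invariants need only mention what changes.
\<close>

fun regs :: "com \<Rightarrow> name set" where
  "regs (Assign x a) = {x}"
| "regs (Seq c1 c2) = regs c1 \<union> regs c2"
| "regs (Cond b c1 c2) = regs c1 \<union> regs c2"
| "regs (While b c) = regs c"
| "regs _ = {}"

fun arrs :: "com \<Rightarrow> name set" where
  "arrs (Store A i a) = {A}"
| "arrs (Seq c1 c2) = arrs c1 \<union> arrs c2"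
| "arrs (Cond b c1 c2) = arrs c1 \<union> arrs c2"
| "arrs (While b c) = arrs c"
| "arrs _ = {}"

fun outputs :: "com \<Rightarrow> bool" where
  "outputs (Output a) = True"
| "outputs (Seq c1 c2) = (outputs c1 \<or> outputs c2)"
| "outputs (Cond b c1 c2) = (outputs c1 \<or> outputs c2)"
| "outputs (While b c) = outputs c"
| "outputs _ = False"

definition frame :: "com \<Rightarrow> state \<Rightarrow> state \<Rightarrow> bool" where
  "frame c s s' \<longleftrightarrow> (\<forall>x. x \<notin> regs c \<longrightarrow> reg s' x = reg s x) \<and>
     (\<forall>A. A \<notin> arrs c \<longrightarrow> arr s' A = arr s A) \<and> (\<not> outputs c \<longrightarrow> out s' = out s)"

lemma frame_refl: "frame c s s" by (simp add: frame_def)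

lemma frame_trans: "frame c s s' \<Longrightarrow> frame c s' s'' \<Longrightarrow> frame c s s''" by (simp add: frame_def)

lemma exec_frame: "exec w c s T s' \<Longrightarrow> frame c s s'"
  by (induction rule: exec.induct) (auto simp: frame_def)

lemma runs_frame: "runs w c s Q \<Longrightarrow> runs w c s (\<lambda>T s'. Q T s' \<and> frame c s s')"
  unfolding runs_def using exec_frame by blast

lemma runs_frame2:
  "runs w c s (\<lambda>T s'. P T s' \<and> Q T s') \<Longrightarrow> runs w c s (\<lambda>T s'. P T s' \<and> Q T s' \<and> frame c s s')"
  by (rule runs_frame[THEN runs_mono]) auto

lemma frame_reg: "frame c s s' \<Longrightarrow> x \<notin> regs c \<Longrightarrow> reg s' x = reg s x"
  by (simp add: frame_def)

text \<open>For the decoder, which may stop early: the measure bounds the number of iterations and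
  may drop by more than one. Loops with a number of iterations fixed in advance are handled by
  \<open>runs_While\<close>.\<close>

lemma runs_While_measure:
  assumes "I s0"
    and "\<And>s. I s \<Longrightarrow> frame c s0 s \<Longrightarrow> bfits w b s \<and>
      (bval b s \<longrightarrow> runs w c s (\<lambda>T s'. T \<le> B \<and> I s' \<and> \<mu> s' < \<mu> s))"
  shows "runs w (While b c) s0 (\<lambda>T s'. T \<le> \<mu> s0 * (1 + bcost b + B) + (1 + bcost b) \<and>
    I s' \<and> \<not> bval b s' \<and> frame c s0 s')"
proof -
  have "\<exists>T s'. exec w (While b c) s T s' \<and> T \<le> \<mu> s * (1 + bcost b + B) + (1 + bcost b) \<and>
    I s' \<and> \<not> bval b s' \<and> frame c s0 s'" if "I s" "frame c s0 s" for s
    using that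
  proof (induction "\<mu> s" arbitrary: s rule: less_induct)
    case less
    show ?case
    proof (cases "bval b s")
      case False
      then have "exec w (While b c) s (1 + bcost b) s"
        using assms(2)[OF less.prems] by (intro exec.WhileFalse) auto
      then show ?thesis using less.prems False
        by (intro exI[of _ "1 + bcost b"] exI[of _ s]) simp
    next
      case True
      then obtain T1 s1 where 1: "exec w c s T1 s1" "T1 \<le> B" "I s1" "\<mu> s1 < \<mu> s"
        using assms(2)[OF less.prems] unfolding runs_def by blast
      then have "frame c s0 s1" using less.prems exec_frame frame_trans by blast
      then obtain T2 s2 where 2: "exec w (While b c) s1 T2 s2"
        "T2 \<le> \<mu> s1 * (1 + bcost b + B) + (1 + bcost b)" "I s2" "\<not> bval b s2" "frame c s0 s2"
        using less.hyps 1 by blast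
      have "exec w (While b c) s (1 + bcost b + T1 + T2) s2"
        using exec.WhileTrue[OF _ True 1(1) 2(1)] assms(2)[OF less.prems] by blast
      moreover have "1 + bcost b + T1 + T2 \<le> \<mu> s * (1 + bcost b + B) + (1 + bcost b)"
      proof -
        have "1 + bcost b + T1 + T2 \<le> Suc (\<mu> s1) * (1 + bcost b + B) + (1 + bcost b)"
          using 1(2) 2(2) by simp
        also have "\<dots> \<le> \<mu> s * (1 + bcost b + B) + (1 + bcost b)"
          using 1(4) by (intro add_right_mono mult_right_mono) auto
        finally show ?thesis .
      qed
      ultimately show ?thesis using 2 by blast
    qed
  qed
  then show ?thesis unfolding runs_def using assms(1) frame_refl by blast
qed

lemma runs_While:
  assumes "I 0 s0"
    and "\<And>i s. i < n \<Longrightarrow> I i s \<Longrightarrow> frame c s0 s \<Longrightarrow>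
      bfits w b s \<and> bval b s \<and> runs w c s (\<lambda>T s'. T \<le> B \<and> I (Suc i) s')"
    and "\<And>s. I n s \<Longrightarrow> frame c s0 s \<Longrightarrow> bfits w b s \<and> \<not> bval b s"
  shows "runs w (While b c) s0 (\<lambda>T s'. T \<le> n * (1 + bcost b + B) + (1 + bcost b) \<and>
    I n s' \<and> frame c s0 s')"
proof -
  have "\<exists>T s'. exec w (While b c) s T s' \<and> T \<le> (n - i) * (1 + bcost b + B) + (1 + bcost b) \<and>
    I n s' \<and> frame c s0 s'" if "i \<le> n" "I i s" "frame c s0 s" for i s
    using that
  proof (induction "n - i" arbitrary: i s)
    case 0
    then have "exec w (While b c) s (1 + bcost b) s"
      using assms(3)[of s] by (intro exec.WhileFalse) auto
    then show ?case using 0 by (intro exI[of _ "1 + bcost b"] exI[of _ s]) simp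
  next
    case (Suc r)
    then have i: "i < n" by simp
    note step = assms(2)[OF i Suc.prems(2,3)]
    then obtain T1 s1 where 1: "exec w c s T1 s1" "T1 \<le> B" "I (Suc i) s1"
      unfolding runs_def by blast
    then have "frame c s0 s1" using Suc.prems exec_frame frame_trans by blast
    moreover have "r = n - Suc i" "Suc i \<le> n" using Suc.hyps(2) by auto
    ultimately obtain T2 s2 where 2: "exec w (While b c) s1 T2 s2"
      "T2 \<le> r * (1 + bcost b + B) + (1 + bcost b)" "I n s2" "frame c s0 s2"
      using Suc.hyps(1)[of "Suc i" s1] 1 by blast
    have "exec w (While b c) s (1 + bcost b + T1 + T2) s2"
      using exec.WhileTrue[OF _ _ 1(1) 2(1)] step by blast
    moreover have "1 + bcost b + T1 + T2 \<le> (n - i) * (1 + bcost b + B) + (1 + bcost b)"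
      using 1(2) 2(2) by (simp flip: Suc.hyps(2))
    ultimately show ?case using 2 by blast
  qed
  from this[of 0 s0] show ?thesis unfolding runs_def using assms(1) frame_refl by auto
qed

abbreviation seq_syntax :: "com \<Rightarrow> com \<Rightarrow> com" (infixr ";;" 60) where
  "c1 ;; c2 \<equiv> Seq c1 c2"

abbreviation "Disj a b \<equiv> Neg (Conj (Neg a) (Neg b))"

section \<open>Searching for primes by trial division\<close>

definition trial_division :: com where
  "trial_division =
     Assign ''f'' (Const 1);; Assign ''d'' (Const 2);;
     While (Less (Reg ''d'') (Reg ''v''))
       (Cond (Eq (Mod (Reg ''v'') (Reg ''d'')) (Const 0)) (Assign ''f'' (Const 0)) Skip;;
        Assign ''d'' (Add (Reg ''d'') (Const 1)))"

definition find_prime :: com where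
  "find_prime =
     Assign ''f'' (Const 0);;
     While (Eq (Reg ''f'') (Const 0))
       (Assign ''v'' (Add (Reg ''v'') (Const 1));; trial_division)"

lemma trial_division_frame [simp]:
  "regs trial_division = {''f'', ''d''}" "arrs trial_division = {}" "\<not> outputs trial_division"
  by (auto simp: trial_division_def)

lemma find_prime_frame [simp]:
  "regs find_prime = {''f'', ''d'', ''v''}" "arrs find_prime = {}" "\<not> outputs find_prime"
  by (auto simp: find_prime_def)

lemma no_divisor_iff_prime: "2 \<le> v \<Longrightarrow> (\<forall>e\<in>{2..<v}. \<not> e dvd v) \<longleftrightarrow> prime v" for v :: nat
  by (auto simp: prime_nat_iff')

lemma runs_trial_division:
  assumes v: "reg s ''v'' = v" "2 \<le> v" "v < 2 ^ w" "2 < (2::nat) ^ w"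
  shows "runs w trial_division s (\<lambda>T s'. T \<le> 20 * v \<and>
    reg s' ''f'' = (if prime v then 1 else 0) \<and> frame trial_division s s')"
proof -
  let ?c = "Cond (Eq (Mod (Reg ''v'') (Reg ''d'')) (Const 0)) (Assign ''f'' (Const 0)) Skip;;
        Assign ''d'' (Add (Reg ''d'') (Const 1))"
  let ?s = "s\<lparr>reg := (reg s)(''f'' := 1, ''d'' := 2)\<rparr>"
  have "runs w (While (Less (Reg ''d'') (Reg ''v'')) ?c) ?s
    (\<lambda>T s'. T \<le> (v - 2) * (1 + bcost (Less (Reg ''d'') (Reg ''v'')) + 13) + (1 + bcost (Less (Reg ''d'') (Reg ''v''))) \<and>
     (reg s' ''d'' = 2 + (v - 2) \<and> reg s' ''f'' = (if \<forall>e\<in>{2..<2 + (v - 2)}. \<not> e dvd v then 1 else 0)) \<and> frame ?c ?s s')"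
  proof (rule runs_While[where I = "\<lambda>i s'. reg s' ''d'' = 2 + i \<and>
      reg s' ''f'' = (if \<forall>e\<in>{2..<2 + i}. \<not> e dvd v then 1 else 0)"])
    fix i s' assume i: "i < v - 2" and I: "reg s' ''d'' = 2 + i \<and>
      reg s' ''f'' = (if \<forall>e\<in>{2..<2 + i}. \<not> e dvd v then 1 else 0)" and fr: "frame ?c ?s s'"
    have [simp]: "reg s' ''v'' = v" using fr v by (simp add: frame_def)
    have iv: "{2..<Suc (2 + i)} = insert (2 + i) {2..<2 + i}" by auto
    show "bfits w (Less (Reg ''d'') (Reg ''v'')) s' \<and> bval (Less (Reg ''d'') (Reg ''v'')) s' \<and>
      runs w ?c s' (\<lambda>T s'. T \<le> 13 \<and> reg s' ''d'' = 2 + Suc i \<and>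
      reg s' ''f'' = (if \<forall>e\<in>{2..<2 + Suc i}. \<not> e dvd v then 1 else 0))"
      using i I v iv by (auto simp: runs_simps mod_eq_0_iff_dvd)
  next
    fix s' assume I: "reg s' ''d'' = 2 + (v - 2) \<and>
      reg s' ''f'' = (if \<forall>e\<in>{2..<2 + (v - 2)}. \<not> e dvd v then 1 else 0)" and fr: "frame ?c ?s s'"
    have [simp]: "reg s' ''v'' = v" using fr v by (simp add: frame_def)
    show "bfits w (Less (Reg ''d'') (Reg ''v'')) s' \<and> \<not> bval (Less (Reg ''d'') (Reg ''v'')) s'"
      using I v by auto
  qed auto
  note W = this
  have eq: "2 + (v - 2) = v" using v by simp
  have "runs w (While (Less (Reg ''d'') (Reg ''v'')) ?c) ?s
    (\<lambda>T s'. T \<le> (v - 2) * 17 + 4 \<and> reg s' ''f'' = (if prime v then 1 else 0))"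
    by (rule runs_mono[OF W[unfolded eq]]) (use no_divisor_iff_prime[OF v(2)] in simp)
  then have "runs w trial_division s (\<lambda>T s'. T \<le> 20 * v \<and>
    reg s' ''f'' = (if prime v then 1 else 0))"
    using v unfolding trial_division_def
    by (auto simp: runs_Seq runs_Assign elim!: runs_mono)
  then show ?thesis by (rule runs_frame[THEN runs_mono]) auto
qed

lemma runs_find_prime:
  assumes v: "reg s ''v'' = v0" "1 \<le> v0" "next_prime v0 < 2 ^ w"
  shows "runs w find_prime s (\<lambda>T s'. T \<le> 40 * next_prime v0 ^ 2 \<and>
    reg s' ''v'' = next_prime v0 \<and> frame find_prime s s')"
proof -
  let ?c = "Assign ''v'' (Add (Reg ''v'') (Const 1));; trial_division"
  let ?s = "s\<lparr>reg := (reg s)(''f'' := 0)\<rparr>"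
  let ?b = "Eq (Reg ''f'') (Const 0)"
  let ?p = "next_prime v0"
  define n where "n = ?p - v0"
  note np = next_prime[of v0]
  have n: "0 < n" "v0 + n = ?p" unfolding n_def using np by auto
  let ?I = "\<lambda>i (s'::state). reg s' ''v'' = v0 + i \<and> reg s' ''f'' = (if i = n then 1 else 0)"
  have notprime: "\<not> prime (v0 + Suc i)" if "Suc i < n" for i
    using next_prime_le[of "v0 + Suc i" v0] that n by auto
  have "runs w (While ?b ?c) ?s
    (\<lambda>T s'. T \<le> n * (1 + bcost ?b + (20 * ?p + 5)) + (1 + bcost ?b) \<and> ?I n s' \<and> frame ?c ?s s')"
  proof (rule runs_While[where I = ?I])
    fix i and s' :: state assume i: "i < n" and I: "?I i s'"
    let ?s1 = "s'\<lparr>reg := (reg s')(''v'' := v0 + Suc i)\<rparr>"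
    have "runs w trial_division ?s1 (\<lambda>T s''. T \<le> 20 * (v0 + Suc i) \<and>
      reg s'' ''f'' = (if prime (v0 + Suc i) then 1 else 0) \<and> frame trial_division ?s1 s'')"
      using i n v prime_gt_1_nat[OF np(1)]
      by (intro runs_trial_division) auto
    then show "bfits w ?b s' \<and> bval ?b s' \<and> runs w ?c s' (\<lambda>T s'. T \<le> 20 * ?p + 5 \<and> ?I (Suc i) s')"
      using i I n v notprime[of i] np
      by (auto simp: runs_Seq runs_Assign dest: frame_reg[of _ _ _ "''v''"] elim!: runs_mono)
  qed (use v n in auto)
  then have "runs w find_prime s (\<lambda>T s'. T \<le> n * (20 * ?p + 9) + 7 \<and> reg s' ''v'' = ?p)"
    unfolding find_prime_def using n v
    by (auto simp: runs_Seq runs_Assign algebra_simps elim!: runs_mono)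
  moreover have "n * (20 * ?p + 9) + 7 \<le> 40 * ?p ^ 2"
  proof -
    have p2: "2 \<le> ?p" using np(1) by (rule prime_ge_2_nat)
    have "n * (20 * ?p + 9) \<le> ?p * (20 * ?p + 9)" using n by (intro mult_right_mono) auto
    also have "\<dots> = 20 * ?p ^ 2 + 9 * ?p" by (simp add: power2_eq_square algebra_simps)
    moreover have "2 * ?p \<le> ?p ^ 2" unfolding power2_eq_square using p2 by (intro mult_right_mono) auto
    ultimately show ?thesis using p2 by linarith
  qed
  ultimately have "runs w find_prime s (\<lambda>T s'. T \<le> 40 * ?p ^ 2 \<and> reg s' ''v'' = ?p)"
    by (auto elim: runs_mono)
  then show ?thesis by (rule runs_frame[THEN runs_mono]) auto
qed

section \<open>Choosing multipliers\<close>

declare One_nat_def [simp del]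

definition init_weights :: com where
  "init_weights =
     Assign ''d'' (Const 1);;
     While (Less (Reg ''d'') (Reg ''v''))
       (Store ''W'' (Reg ''d'') (Const 1);; Assign ''d'' (Add (Reg ''d'') (Const 1)))"

definition test_clash :: bexp where
  "test_clash = Disj (Eq (Mod (Reg ''u'') (Reg ''M'')) (Const 0))
     (Eq (Mod (Sub (Reg ''v'') (Reg ''u'')) (Reg ''M'')) (Const 0))"

definition sum_clashes :: com where
  "sum_clashes =
     Assign ''s'' (Const 0);; Assign ''d'' (Const 1);;
     While (Less (Reg ''d'') (Reg ''v''))
       (Assign ''u'' (Mod (Mul (Reg ''a'') (Reg ''d'')) (Reg ''v''));;
        Cond test_clash (Assign ''s'' (Add (Reg ''s'') (Arr ''W'' (Reg ''d'')))) Skip;;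
        Assign ''d'' (Add (Reg ''d'') (Const 1)))"

definition double_clashes :: com where
  "double_clashes =
     Assign ''d'' (Const 1);;
     While (Less (Reg ''d'') (Reg ''v''))
       (Assign ''u'' (Mod (Mul (Reg ''a'') (Reg ''d'')) (Reg ''v''));;
        Cond test_clash (Store ''W'' (Reg ''d'') (Mul (Const 2) (Arr ''W'' (Reg ''d'')))) Skip;;
        Assign ''d'' (Add (Reg ''d'') (Const 1)))"

definition find_mult :: com where
  "find_mult =
     Assign ''a'' (Const 0);; Assign ''g'' (Const 1);;
     While (Eq (Reg ''g'') (Const 1))
       (Assign ''a'' (Add (Reg ''a'') (Const 1));;
        sum_clashes;;
        Cond (Less (Mul (Const 2) (Reg ''S'')) (Mul (Reg ''M'') (Reg ''s''))) Skip (Assign ''g'' (Const 0)))"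

lemma init_weights_frame [simp]:
  "regs init_weights = {''d''}" "arrs init_weights = {''W''}" "\<not> outputs init_weights"
  by (auto simp: init_weights_def)

lemma sum_clashes_frame [simp]:
  "regs sum_clashes = {''s'', ''d'', ''u''}" "arrs sum_clashes = {}" "\<not> outputs sum_clashes"
  by (auto simp: sum_clashes_def)

lemma double_clashes_frame [simp]:
  "regs double_clashes = {''d'', ''u''}" "arrs double_clashes = {''W''}" "\<not> outputs double_clashes"
  by (auto simp: double_clashes_def)

lemma find_mult_frame [simp]:
  "regs find_mult = {''a'', ''g'', ''s'', ''d'', ''u''}" "arrs find_mult = {}" "\<not> outputs find_mult"
  by (auto simp: find_mult_def)

lemma runs_init_weights:
  assumes v: "reg s ''v'' = v" "2 \<le> v" "v < 2 ^ w"
  shows "runs w init_weights s (\<lambda>T s'. T \<le> 12 * v \<and>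
    (\<forall>d\<in>{1..<v}. arr s' ''W'' d = 1) \<and> frame init_weights s s')"
proof -
  note [simp] = v(1)
  let ?c = "Store ''W'' (Reg ''d'') (Const 1);; Assign ''d'' (Add (Reg ''d'') (Const 1))"
  let ?b = "Less (Reg ''d'') (Reg ''v'')"
  let ?s = "s\<lparr>reg := (reg s)(''d'' := 1)\<rparr>"
  let ?I = "\<lambda>i (s'::state). reg s' ''d'' = 1 + i \<and> (\<forall>d\<in>{1..<1 + i}. arr s' ''W'' d = 1)"
  have W: "runs w (While ?b ?c) ?s
    (\<lambda>T s'. T \<le> (v - 1) * (1 + bcost ?b + 8) + (1 + bcost ?b) \<and> ?I (v - 1) s' \<and> frame ?c ?s s')"
  proof (rule runs_While[where I = ?I])
    fix i and s' :: state assume i: "i < v - 1" and I: "?I i s'" and fr: "frame ?c ?s s'"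
    have [simp]: "reg s' ''v'' = v" using fr v by (simp add: frame_def)
    show "bfits w ?b s' \<and> bval ?b s' \<and> runs w ?c s' (\<lambda>T s'. T \<le> 8 \<and> ?I (Suc i) s')"
      using i I v(2,3) by (auto simp: runs_simps less_Suc_eq)
  next
    fix s' :: state assume I: "?I (v - 1) s'" and fr: "frame ?c ?s s'"
    have [simp]: "reg s' ''v'' = v" using fr v by (simp add: frame_def)
    show "bfits w ?b s' \<and> \<not> bval ?b s'" using I v by auto
  qed auto
  have eq: "1 + (v - 1) = v" using v by simp
  show ?thesis
    by (rule runs_frame2, unfold init_weights_def runs_Seq runs_Assign)
      (use v(2,3) in \<open>auto intro!: runs_mono[OF W[unfolded eq]]\<close>)
qed

lemma bfits_test_clash: "bfits w test_clash s \<longleftrightarrow> reg s ''u'' < 2 ^ w \<and> reg s ''v'' < 2 ^ w \<and> reg s ''M'' < 2 ^ w"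
  by (auto simp: test_clash_def)

lemma bval_test_clash: "reg s ''u'' = a * d mod p \<Longrightarrow> reg s ''v'' = p \<Longrightarrow> reg s ''M'' = m \<Longrightarrow>
    bval test_clash s \<longleftrightarrow> clash m p a d"
  by (auto simp: test_clash_def clash_def)

lemma bcost_test_clash: "bcost test_clash = 16"
  by (simp add: test_clash_def)

lemma runs_sum_clashes:
  assumes v: "reg s ''v'' = v" "2 \<le> v" "v < 2 ^ w" and M: "reg s ''M'' = m" "m < 2 ^ w"
    and a: "reg s ''a'' = a" "a * v < 2 ^ w" "a < 2 ^ w"
    and W: "\<And>d. d \<in> {1..<v} \<Longrightarrow> arr s ''W'' d = W d" and sumW: "(\<Sum>d\<in>{1..<v}. W d) < 2 ^ w"
  shows "runs w sum_clashes s (\<lambda>T s'. T \<le> 50 * v \<and>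
    reg s' ''s'' = clash_weight m v W a \<and> frame sum_clashes s s')"
proof -
  note [simp] = v(1) M(1) a(1)
  let ?c = "Assign ''u'' (Mod (Mul (Reg ''a'') (Reg ''d'')) (Reg ''v''));;
        Cond test_clash (Assign ''s'' (Add (Reg ''s'') (Arr ''W'' (Reg ''d'')))) Skip;;
        Assign ''d'' (Add (Reg ''d'') (Const 1))"
  let ?b = "Less (Reg ''d'') (Reg ''v'')"
  let ?s = "s\<lparr>reg := (reg s)(''s'' := 0, ''d'' := 1)\<rparr>"
  let ?S = "\<lambda>n. \<Sum>d\<in>{d\<in>{1..<n}. clash m v a d}. W d"
  let ?I = "\<lambda>i (s'::state). reg s' ''d'' = 1 + i \<and> reg s' ''s'' = ?S (1 + i)"
  have W: "runs w (While ?b ?c) ?s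
    (\<lambda>T s'. T \<le> (v - 1) * (1 + bcost ?b + 40) + (1 + bcost ?b) \<and> ?I (v - 1) s' \<and> frame ?c ?s s')"
  proof (rule runs_While[where I = ?I])
    fix i and s' :: state assume i: "i < v - 1" and I: "?I i s'" and fr: "frame ?c ?s s'"
    note [simp] = bfits_test_clash bcost_test_clash
    have [simp]: "reg s' ''v'' = v" "reg s' ''M'' = m" "reg s' ''a'' = a" "arr s' ''W'' = arr s ''W''"
      using fr v M a by (auto simp: frame_def)
    have d: "1 + i \<in> {1..<v}" using i by auto
    have "a * (1 + i) \<le> a * v" using d by (intro mult_left_mono) auto
    then have au: "a * (1 + i) < 2 ^ w" using a by linarith
    have "a * (1 + i) mod v < v" using v by (intro mod_less_divisor) auto
    then have um: "a * (1 + i) mod v < 2 ^ w" using v by linarith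
    have S: "?S (1 + Suc i) = (if clash m v a (1 + i) then ?S (1 + i) + W (1 + i) else ?S (1 + i))"
    proof (cases "clash m v a (1 + i)")
      case True
      then have "{d\<in>{1..<1 + Suc i}. clash m v a d} = insert (1 + i) {d\<in>{1..<1 + i}. clash m v a d}"
        by auto
      then show ?thesis using True by simp
    next
      case False
      then have "{d\<in>{1..<1 + Suc i}. clash m v a d} = {d\<in>{1..<1 + i}. clash m v a d}"
        by (auto simp: less_Suc_eq)
      then show ?thesis using False by simp
    qed
    define si si' where "si = ?S (1 + i)" and "si' = ?S (1 + Suc i)"
    have "si' \<le> (\<Sum>d\<in>{1..<v}. W d)" unfolding si'_def using i by (intro sum_mono2) auto
    then have Sb: "si' < 2 ^ w" using sumW by linarith
    have "si \<le> (\<Sum>d\<in>{1..<v}. W d)" unfolding si_def using i by (intro sum_mono2) auto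
    then have Sb': "si < 2 ^ w" using sumW by linarith
    note S = S[folded si_def si'_def]
    have Wb: "W (1 + i) < 2 ^ w"
      using member_le_sum[OF d, of W] sumW by simp
    note cl = bval_test_clash[of _ a "1 + i" v m]
    have "bfits w ?b s' \<and> bval ?b s' \<and> runs w ?c s' (\<lambda>T s'. T \<le> 40 \<and> reg s' ''d'' = 1 + Suc i \<and> reg s' ''s'' = si')"
      using i I[folded si_def] v(2,3) d au um Sb Sb' Wb assms(9)[OF d] M(2) a(2,3) S
      by (cases "clash m v a (1 + i)") (simp_all add: runs_simps cl)
    then show "bfits w ?b s' \<and> bval ?b s' \<and> runs w ?c s' (\<lambda>T s'. T \<le> 40 \<and> ?I (Suc i) s')"
      unfolding si'_def .
  next
    fix s' :: state assume I: "?I (v - 1) s'" and fr: "frame ?c ?s s'"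
    have [simp]: "reg s' ''v'' = v" using fr v by (simp add: frame_def)
    show "bfits w ?b s' \<and> \<not> bval ?b s'" using I v by auto
  qed auto
  have eq: "1 + (v - 1) = v" using v by simp
  show ?thesis
    by (rule runs_frame2, unfold sum_clashes_def runs_Seq runs_Assign)
      (use v(2,3) in \<open>auto intro!: runs_mono[OF W[unfolded eq]] simp: clash_weight_def\<close>)
qed

lemma runs_double_clashes:
  assumes v: "reg s ''v'' = v" "2 \<le> v" "v < 2 ^ w" and M: "reg s ''M'' = m" "m < 2 ^ w"
    and a: "reg s ''a'' = a" "a * v < 2 ^ w" "a < 2 ^ w"
    and W: "\<And>d. d \<in> {1..<v} \<Longrightarrow> arr s ''W'' d = W d" and sumW: "2 * (\<Sum>d\<in>{1..<v}. W d) < 2 ^ w"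
  shows "runs w double_clashes s (\<lambda>T s'. T \<le> 50 * v \<and>
    (\<forall>d\<in>{1..<v}. arr s' ''W'' d = (if clash m v a d then 2 * W d else W d)) \<and> frame double_clashes s s')"
proof -
  note [simp] = v(1) M(1) a(1)
  let ?c = "Assign ''u'' (Mod (Mul (Reg ''a'') (Reg ''d'')) (Reg ''v''));;
        Cond test_clash (Store ''W'' (Reg ''d'') (Mul (Const 2) (Arr ''W'' (Reg ''d'')))) Skip;;
        Assign ''d'' (Add (Reg ''d'') (Const 1))"
  let ?b = "Less (Reg ''d'') (Reg ''v'')"
  let ?s = "s\<lparr>reg := (reg s)(''d'' := 1)\<rparr>"
  let ?I = "\<lambda>i (s'::state). reg s' ''d'' = 1 + i \<and>
    (\<forall>d\<in>{1..<v}. arr s' ''W'' d = (if d < 1 + i \<and> clash m v a d then 2 * W d else W d))"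
  have W: "runs w (While ?b ?c) ?s
    (\<lambda>T s'. T \<le> (v - 1) * (1 + bcost ?b + 40) + (1 + bcost ?b) \<and> ?I (v - 1) s' \<and> frame ?c ?s s')"
  proof (rule runs_While[where I = ?I])
    show "?I 0 ?s" using W by auto
    fix i and s' :: state assume i: "i < v - 1" and I: "?I i s'" and fr: "frame ?c ?s s'"
    note [simp] = bfits_test_clash bcost_test_clash
    have [simp]: "reg s' ''v'' = v" "reg s' ''M'' = m" "reg s' ''a'' = a"
      using fr v M a by (auto simp: frame_def)
    have d: "1 + i \<in> {1..<v}" using i by auto
    have "a * (1 + i) \<le> a * v" using d by (intro mult_left_mono) auto
    then have au: "a * (1 + i) < 2 ^ w" using a by linarith
    have "a * (1 + i) mod v < v" using v by (intro mod_less_divisor) auto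
    then have um: "a * (1 + i) mod v < 2 ^ w" using v by linarith
    have "W (1 + i) \<le> (\<Sum>d\<in>{1..<v}. W d)" using member_le_sum[OF d, of W] by simp
    then have Wb: "2 * W (1 + i) < 2 ^ w" "W (1 + i) < 2 ^ w" using sumW by auto
    have Wi: "arr s' ''W'' (Suc i) = W (Suc i)" using I d by auto
    note cl = bval_test_clash[of _ a "1 + i" v m]
    show "bfits w ?b s' \<and> bval ?b s' \<and> runs w ?c s' (\<lambda>T s'. T \<le> 40 \<and> ?I (Suc i) s')"
      using i I v(2,3) d au um Wb Wi M(2) a(2,3) by (auto simp add: runs_simps cl less_Suc_eq)
  next
    fix s' :: state assume I: "?I (v - 1) s'" and fr: "frame ?c ?s s'"
    have [simp]: "reg s' ''v'' = v" using fr v by (simp add: frame_def)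
    show "bfits w ?b s' \<and> \<not> bval ?b s'" using I v by auto
  qed
  have eq: "1 + (v - 1) = v" using v by simp
  show ?thesis
    by (rule runs_frame2, unfold double_clashes_def runs_Seq runs_Assign)
      (use v(2,3) in \<open>auto intro!: runs_mono[OF W[unfolded eq]]\<close>)
qed

lemma runs_find_mult:
  assumes v: "reg s ''v'' = v" "prime v" "v * v < 2 ^ w" and M: "reg s ''M'' = m" "0 < m" "m < 2 ^ w"
    and W: "\<And>d. d \<in> {1..<v} \<Longrightarrow> arr s ''W'' d = W d"
    and S: "reg s ''S'' = (\<Sum>d\<in>{1..<v}. W d)" "2 * (\<Sum>d\<in>{1..<v}. W d) < 2 ^ w" "m * (\<Sum>d\<in>{1..<v}. W d) < 2 ^ w"
  shows "runs w find_mult s (\<lambda>T s'. T \<le> 80 * v ^ 2 \<and> reg s' ''a'' = good_mult m v W \<and>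
    reg s' ''s'' = clash_weight m v W (good_mult m v W) \<and> frame find_mult s s')"
proof -
  note [simp] = v(1) M(1) S(1)
  let ?c = "Assign ''a'' (Add (Reg ''a'') (Const 1));;
        sum_clashes;;
        Cond (Less (Mul (Const 2) (Reg ''S'')) (Mul (Reg ''M'') (Reg ''s''))) Skip (Assign ''g'' (Const 0))"
  let ?b = "Eq (Reg ''g'') (Const 1)"
  let ?s = "s\<lparr>reg := (reg s)(''a'' := 0, ''g'' := 1)\<rparr>"
  let ?S = "\<Sum>d\<in>{1..<v}. W d"
  define A where "A = good_mult m v W"
  note gm = good_mult[OF v(2) M(2), of W, folded A_def]
  let ?I = "\<lambda>i (s'::state). reg s' ''a'' = i \<and> reg s' ''g'' = (if i = A then 0 else 1) \<and>
    (0 < i \<longrightarrow> reg s' ''s'' = clash_weight m v W i)"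
  have v2: "2 \<le> v" using v(2) by (rule prime_ge_2_nat)
  have "v \<le> v * v" by simp
  then have vw: "v < 2 ^ w" using v(3) by linarith
  have W: "runs w (While ?b ?c) ?s
    (\<lambda>T s'. T \<le> A * (1 + bcost ?b + (50 * v + 16)) + (1 + bcost ?b) \<and> ?I A s' \<and> frame ?c ?s s')"
  proof (rule runs_While[where I = ?I])
    fix i and s' :: state assume i: "i < A" and I: "?I i s'" and fr: "frame ?c ?s s'"
    have [simp]: "reg s' ''v'' = v" "reg s' ''M'' = m" "reg s' ''S'' = ?S" "arr s' ''W'' = arr s ''W''"
      using fr v M S by (auto simp: frame_def)
    have iv: "Suc i < v" using i gm(2) by simp
    have iw: "Suc i < 2 ^ w" using iv vw by linarith
    have "Suc i * v \<le> v * v" using iv by (intro mult_right_mono) auto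
    then have ivw: "Suc i * v < 2 ^ w" using v(3) by linarith
    have Sw: "?S < 2 ^ w" using S(2) by linarith
    let ?s1 = "s'\<lparr>reg := (reg s')(''a'' := Suc i)\<rparr>"
    have 1: "runs w sum_clashes ?s1 (\<lambda>T s''. T \<le> 50 * v \<and>
      reg s'' ''s'' = clash_weight m v W (Suc i) \<and> frame sum_clashes ?s1 s'')"
      by (rule runs_sum_clashes) (use v2 vw M iw ivw W Sw in auto)
    have cs: "clash_weight m v W (Suc i) \<le> ?S" unfolding clash_weight_def by (intro sum_mono2) auto
    then have "m * clash_weight m v W (Suc i) \<le> m * ?S" by (rule mult_left_mono) simp
    then have cw: "m * clash_weight m v W (Suc i) < 2 ^ w" "clash_weight m v W (Suc i) < 2 ^ w"
      using S(3) cs Sw by linarith+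
    have least: "\<not> m * clash_weight m v W (Suc i) \<le> 2 * ?S" if "Suc i < A"
      using not_less_Least[OF that[unfolded A_def good_mult_def]] by simp
    have c2: "(2::nat) < 2 ^ w" "(1::nat) < 2 ^ w" using iw vw v2 iv by linarith+
    have 2: "runs w (Cond (Less (Mul (Const 2) (Reg ''S'')) (Mul (Reg ''M'') (Reg ''s''))) Skip (Assign ''g'' (Const 0))) s''
       (\<lambda>T s'''. T \<le> 10 \<and> ?I (Suc i) s''')"
      if "reg s'' ''s'' = clash_weight m v W (Suc i)" "frame sum_clashes ?s1 s''" for s''
    proof -
      have [simp]: "reg s'' ''a'' = Suc i" "reg s'' ''g'' = 1" "reg s'' ''M'' = m" "reg s'' ''S'' = ?S"
        using that(2) I i by (auto simp: frame_def)
      define C Sg where "C = clash_weight m v W (Suc i)" and "Sg = ?S"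
      \<comment> \<open>By minimality of \<open>good_mult\<close>, the flag \<open>g\<close> is
        cleared exactly at candidate \<open>A\<close>; hence the loop runs \<open>A\<close>
        times.\<close>
      have iA: "Suc i = A \<longleftrightarrow> m * C \<le> 2 * Sg"
        unfolding C_def Sg_def using least gm(3) i by (metis Suc_lessI)
      have fits: "m * C < 2 ^ w" "C < 2 ^ w" "2 * Sg < 2 ^ w" "Sg < 2 ^ w" "m < 2 ^ w"
        "reg s'' ''s'' = C" "reg s'' ''S'' = Sg"
        unfolding C_def Sg_def using cw S(2) Sw M(3) that(1) by simp_all
      show ?thesis unfolding C_def[symmetric]
        by (cases "m * C \<le> 2 * Sg") (use fits c2 iA in \<open>simp_all add: runs_simps not_less\<close>)
    qed
    show "bfits w ?b s' \<and> bval ?b s' \<and> runs w ?c s' (\<lambda>T s'. T \<le> 50 * v + 16 \<and> ?I (Suc i) s')"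
    proof (intro conjI)
      show "runs w ?c s' (\<lambda>T s'. T \<le> 50 * v + 16 \<and> ?I (Suc i) s')"
      proof -
        have "runs w (sum_clashes;;
          Cond (Less (Mul (Const 2) (Reg ''S'')) (Mul (Reg ''M'') (Reg ''s''))) Skip (Assign ''g'' (Const 0))) ?s1
          (\<lambda>T s''. T \<le> 50 * v + 11 \<and> ?I (Suc i) s'')"
        proof (rule runs_SeqI[OF 1], goal_cases)
          case A: (1 T2 s2)
          show ?case by (rule runs_mono[OF 2]) (use A in auto)
        qed
        note rest = this
        have "aval (Add (Reg ''a'') (Const 1)) s' = Suc i" using I by simp
        then show ?thesis unfolding runs_Assign_Seq
          using I iw c2 by (intro conjI) (simp, simp only:, rule runs_mono[OF rest], auto)
      qed
    qed (use I i c2 in auto)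
  qed (use gm vw v2 in auto)
  have "runs w find_mult s (\<lambda>T s'. T \<le> 80 * v ^ 2 \<and> reg s' ''a'' = A \<and> reg s' ''s'' = clash_weight m v W A)"
  proof -
    have "A * (50 * v + 20) \<le> v * (50 * v + 20)" using gm by (intro mult_right_mono) auto
    also have "\<dots> = 50 * v ^ 2 + 20 * v" by (simp add: power2_eq_square algebra_simps)
    moreover have "2 * v \<le> v ^ 2" unfolding power2_eq_square using v2 by (intro mult_right_mono) auto
    ultimately have "A * (50 * v + 20) + 10 \<le> 80 * v ^ 2" using v2 by linarith
    then show ?thesis
      unfolding find_mult_def runs_Seq runs_Assign
      using vw v2 gm by (auto intro!: runs_mono[OF W] simp: algebra_simps)
  qed
  then show ?thesis unfolding A_def by (rule runs_frame[THEN runs_mono]) auto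
qed

section \<open>Running the decoder\<close>

text \<open>One unfolding of \<open>decode\<close>: \<open>z\<close> holds the code,
  \<open>F\<close> the fuel, \<open>w\<close> the block length, \<open>e\<close> the multiplier,
  \<open>h\<close> the block start and \<open>o\<close> the next colour. The result register
  \<open>r\<close> holds \<open>t + 1\<close> beforehand, so a conditional assignment yields the
  minimum; a hit ends the loop by emptying the fuel.\<close>

definition decode_step :: com where
  "decode_step =
     Assign ''u'' (Mod (Reg ''z'') (Const 3));; Assign ''z'' (Div (Reg ''z'') (Const 3));;
     Assign ''F'' (Sub (Reg ''F'') (Const 1));;
     Cond (Eq (Reg ''u'') (Const 0)) (Assign ''h'' (Add (Reg ''h'') (Reg ''w'')))
       (Cond (Eq (Reg ''u'') (Const 1))
         (Cond (Eq (Mod (Mod (Mul (Reg ''e'') (Reg ''y'')) (Reg ''p'')) (Reg ''m''))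
                   (Add (Reg ''h'') (Mod (Reg ''z'') (Reg ''w''))))
           (Cond (Less (Reg ''o'') (Reg ''r'')) (Assign ''r'' (Reg ''o'')) Skip;; Assign ''F'' (Const 0))
           (Assign ''z'' (Div (Reg ''z'') (Reg ''w''));; Assign ''o'' (Add (Reg ''o'') (Const 1))))
         (Assign ''w'' (Mul (Const 2) (Reg ''w''));; Assign ''h'' (Const 0);;
          Assign ''e'' (Mod (Reg ''z'') (Reg ''p''));; Assign ''z'' (Div (Reg ''z'') (Reg ''p''))))"

lemma decode_step_frame [simp]:
  "regs decode_step = {''u'', ''z'', ''F'', ''h'', ''r'', ''o'', ''w'', ''e''}"
  "arrs decode_step = {}" "\<not> outputs decode_step"
  by (auto simp: decode_step_def)

lemma runs_decode_step:
  fixes B W :: nat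
  assumes s [simp]: "reg s ''p'' = p" "reg s ''m'' = m" "reg s ''y'' = y" "reg s ''F'' = Suc F"
      "reg s ''z'' = z" "reg s ''w'' = W" "reg s ''e'' = e" "reg s ''h'' = h" "reg s ''o'' = j" "reg s ''r'' = t + 1"
    and fits: "p < 2 ^ w" "m < 2 ^ w" "y < 2 ^ w" "p * y < 2 ^ w" "Suc F < 2 ^ w" "z < 2 ^ w" "2 * W < 2 ^ w"
      "e \<le> p" "h + W < 2 ^ w" "j + 1 < 2 ^ w" "t + 1 < 2 ^ w" "3 < (2::nat) ^ w" "0 < W"
  shows "runs w decode_step s (\<lambda>T s'. T \<le> 60 \<and>
    (if z mod 3 = 0 then reg s' ''F'' = F \<and> reg s' ''z'' = z div 3 \<and> reg s' ''w'' = W \<and> reg s' ''e'' = e \<and>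
       reg s' ''h'' = h + W \<and> reg s' ''o'' = j \<and> reg s' ''r'' = t + 1
     else if z mod 3 = 1 then
       (if e * y mod p mod m = h + z div 3 mod W then reg s' ''F'' = 0 \<and> reg s' ''r'' = min j (t + 1) \<and>
          reg s' ''z'' = z div 3 \<and> reg s' ''w'' = W \<and> reg s' ''e'' = e \<and> reg s' ''h'' = h \<and> reg s' ''o'' = j
        else reg s' ''F'' = F \<and> reg s' ''z'' = z div 3 div W \<and> reg s' ''w'' = W \<and> reg s' ''e'' = e \<and>
          reg s' ''h'' = h \<and> reg s' ''o'' = j + 1 \<and> reg s' ''r'' = t + 1)
     else reg s' ''F'' = F \<and> reg s' ''z'' = z div 3 div p \<and> reg s' ''w'' = 2 * W \<and>
       reg s' ''e'' = z div 3 mod p \<and> reg s' ''h'' = 0 \<and> reg s' ''o'' = j \<and> reg s' ''r'' = t + 1))"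
proof -
  have "e * y \<le> p * y" using fits(8) by (rule mult_right_mono) simp
  then have ey: "e * y < 2 ^ w" using fits(4) by linarith
  have z3w: "z div 3 < 2 ^ w" using fits(6) div_le_dividend[of z 3] by linarith
  have ew: "e < 2 ^ w" using fits by linarith
  have W: "W < 2 ^ w" "h < 2 ^ w" "j < 2 ^ w" "1 < (2::nat) ^ w" using fits by linarith+
  have "z div 3 mod W < W" using fits(13) by simp
  then have zw: "h + z div 3 mod W < 2 ^ w" "z div 3 mod W < 2 ^ w" using fits(9) by linarith+
  consider "z mod 3 = 0" | "z mod 3 = 1" "e * y mod p mod m = h + z div 3 mod W"
    | "z mod 3 = 1" "e * y mod p mod m \<noteq> h + z div 3 mod W" | "z mod 3 = 2" by linarith
  then show ?thesis
  proof cases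
    case 1
    then show ?thesis using fits W ew ey z3w zw by (simp add: decode_step_def runs_simps)
  next
    case 2
    then show ?thesis using fits W ew ey z3w zw
      by (cases "j < t + 1") (simp_all add: decode_step_def runs_simps)
  next
    case 3
    then show ?thesis using fits W ew ey z3w zw by (simp add: decode_step_def runs_simps)
  next
    case 4
    then show ?thesis using fits W ew ey z3w zw by (simp add: decode_step_def runs_simps)
  qed
qed

definition decode_loop :: com where
  "decode_loop = While (Less (Const 0) (Reg ''F'')) decode_step"

lemma decode_loop_frame [simp]:
  "regs decode_loop = {''u'', ''z'', ''F'', ''h'', ''r'', ''o'', ''w'', ''e''}"
  "arrs decode_loop = {}" "\<not> outputs decode_loop"
  by (auto simp: decode_loop_def)

lemma runs_decode_loop:
  assumes s: "reg s ''p'' = p" "reg s ''m'' = m" "reg s ''y'' = y" "reg s ''F'' = f"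
      "reg s ''z'' = N" "reg s ''w'' = b" "reg s ''e'' = 0" "reg s ''h'' = 0" "reg s ''o'' = 1" "reg s ''r'' = t + 1"
    and fits: "p < 2 ^ w" "m < 2 ^ w" "y < 2 ^ w" "p * y < 2 ^ w" "N < 2 ^ w" "(f + 2) * (b * 2 ^ f) < 2 ^ w"
      "0 < b" "t + 1 < 2 ^ w" "3 < (2::nat) ^ w" "0 < p"
  shows "runs w decode_loop s (\<lambda>T s'. T \<le> 70 * f + 4 \<and>
    reg s' ''r'' = decode p m t y f N b 0 0 1 \<and> frame decode_loop s s')"
proof -
  let ?b = "Less (Const 0) (Reg ''F'')"
  define B where "B = b * 2 ^ f"
  define R where "R = decode p m t y f N b 0 0 1"
  define D where "D = decode p m t y"
  have D_simps: "D 0 z' w' e' h' j' = t + 1"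
    "D (Suc F) z' w' e' h' j' = (if z' mod 3 = 0 then D F (z' div 3) w' e' (h' + w') j'
      else if z' mod 3 = 1 then
        (if e' * y mod p mod m = h' + z' div 3 mod w' then min j' (t + 1)
         else D F (z' div 3 div w') w' e' h' (j' + 1))
      else D F (z' div 3 div p) (2 * w') (z' div 3 mod p) 0 j')" for F z' w' e' h' j'
    unfolding D_def by simp_all
  have "b * 1 \<le> B" unfolding B_def by (intro mult_left_mono) auto
  then have B: "0 < B" "f * B + 2 * B < 2 ^ w" using fits(6,7) by (auto simp: B_def algebra_simps)
  have "f * 1 \<le> f * B" using B(1) by (intro mult_left_mono) auto
  then have fw: "f + 2 < 2 ^ w" using B by linarith
  \<comment> \<open>Overflow is excluded by budgets tied to the remaining fuel: per unit of fuel the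
    block length at most doubles, the block start grows by at most \<open>B\<close> and the colour
    by at most one. The final disjunction separates a decoder still running from one that has found
    its colour.\<close>
  let ?I = "\<lambda>s'. reg s' ''F'' \<le> f \<and> reg s' ''z'' \<le> N \<and> 0 < reg s' ''w'' \<and>
    reg s' ''w'' * 2 ^ reg s' ''F'' \<le> B \<and> reg s' ''e'' \<le> p \<and>
    reg s' ''h'' + reg s' ''F'' * B \<le> f * B \<and> reg s' ''o'' + reg s' ''F'' \<le> f + 1 \<and>
    (reg s' ''r'' = t + 1 \<and>
       D (reg s' ''F'') (reg s' ''z'') (reg s' ''w'') (reg s' ''e'') (reg s' ''h'') (reg s' ''o'') = R \<or>
     reg s' ''F'' = 0 \<and> reg s' ''r'' = R)"
  have W: "runs w decode_loop s (\<lambda>T s'. T \<le> reg s ''F'' * (1 + bcost ?b + 60) + (1 + bcost ?b) \<and>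
    ?I s' \<and> \<not> bval ?b s' \<and> frame decode_step s s')"
    unfolding decode_loop_def
  proof (rule runs_While_measure[where I = ?I and \<mu> = "\<lambda>s'. reg s' ''F''"])
    show "?I s" unfolding R_def D_def using s fits(7) by (simp add: B_def)
    fix s' assume I: "?I s'" and fr: "frame decode_step s s'"
    have [simp]: "reg s' ''p'' = p" "reg s' ''m'' = m" "reg s' ''y'' = y"
      using fr s by (simp_all add: frame_def)
    have "runs w decode_step s' (\<lambda>T s''. T \<le> 60 \<and> ?I s'' \<and> reg s'' ''F'' < reg s' ''F'')"
      if "0 < reg s' ''F''"
    proof -
      from that obtain F where F: "reg s' ''F'' = Suc F" by (cases "reg s' ''F''") auto
      define z W e h j where "z = reg s' ''z''" and "W = reg s' ''w''" and "e = reg s' ''e''"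
        and "h = reg s' ''h''" and "j = reg s' ''o''"
      have r: "reg s' ''r'' = t + 1" and R: "D (Suc F) z W e h j = R"
        using I F unfolding z_def W_def e_def h_def j_def by auto
      have I': "Suc F \<le> f" "z \<le> N" "0 < W" "2 * W * 2 ^ F \<le> B" "e \<le> p" "h + B + F * B \<le> f * B" "j + F \<le> f"
        using I F unfolding z_def W_def e_def h_def j_def by (simp_all add: algebra_simps)
      have "2 * W * 1 \<le> 2 * W * 2 ^ F" by (intro mult_left_mono) auto
      then have WB: "2 * W \<le> B" using I'(4) by linarith
      have WF: "W * 2 ^ F \<le> B" using I'(4) by linarith
      have step: "z div 3 \<le> N" "z div 3 div W \<le> N" "z div 3 div p \<le> N" "0 \<le> N"
        using I'(2) by (meson div_le_dividend le_trans le0)+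
      show ?thesis
      proof (rule runs_mono[OF runs_decode_step[where p = p and m = m and y = y and F = F and z = z
            and W = W and e = e and h = h and j = j and t = t], rotated -1], goal_cases)
        case post: (1 T s'')
        consider "z mod 3 = 0" | "z mod 3 = 1" "e * y mod p mod m = h + z div 3 mod W"
          | "z mod 3 = 1" "e * y mod p mod m \<noteq> h + z div 3 mod W" | "z mod 3 = 2" by linarith
        then show ?case
        proof cases
          case 1
          then show ?thesis using post R I' WB WF step F by (simp add: D_simps)
        next
          case 2
          then show ?thesis using post R I' WB step F by (simp add: D_simps)
        next
          case 3
          then show ?thesis using post R I' WB WF step F by (simp add: D_simps)
        next
          case 4
          have "z div 3 mod p \<le> p" using fits(10) by (intro less_imp_le mod_less_divisor)
          then show ?thesis using 4 post R I' WB step F by (simp add: D_simps)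
        qed
      qed (use r F I' WB B fw fits in \<open>auto simp: z_def W_def e_def h_def j_def\<close>)
    qed
    moreover have "reg s' ''F'' < 2 ^ w" using I fw by linarith
    ultimately show "bfits w ?b s' \<and> (bval ?b s' \<longrightarrow>
      runs w decode_step s' (\<lambda>T s''. T \<le> 60 \<and> ?I s'' \<and> reg s'' ''F'' < reg s' ''F''))"
      by simp
  qed
  have "runs w decode_loop s (\<lambda>T s'. T \<le> 70 * f + 4 \<and> reg s' ''r'' = R)"
    by (rule runs_mono[OF W]) (use s(4) in \<open>auto simp: D_simps\<close>)
  then show ?thesis unfolding R_def by (rule runs_frame[THEN runs_mono]) auto
qed

section \<open>The enumeration\<close>

text \<open>Reduces \<open>x\<close> to the small universe and decodes there. The fuel
  \<open>4 * t\<close> pays for at most \<open>t\<close> round changes, \<open>2 * t\<close> block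
  moves and \<open>t\<close> colours, as \<open>exists_code\<close> requires; the initial multiplier
  0 is replaced as soon as a code starts with symbol 2.\<close>

definition code_value :: "nat \<Rightarrow> nat \<Rightarrow> nat \<Rightarrow> nat \<Rightarrow> nat \<Rightarrow> nat \<Rightarrow> nat \<Rightarrow> nat \<Rightarrow> nat \<Rightarrow> nat" where
  "code_value p m t b M v a N x = decode p m t (a * (x mod v) mod v mod M) (4 * t) N b 0 0 1"

definition emit_init :: com where
  "emit_init =
     Assign ''y'' (Mod (Mod (Mul (Reg ''a'') (Mod (Reg ''x'') (Reg ''v''))) (Reg ''v'')) (Reg ''M''));;
     Assign ''z'' (Reg ''N'');; Assign ''w'' (Reg ''b'');; Assign ''e'' (Const 0);; Assign ''h'' (Const 0);;
     Assign ''o'' (Const 1);; Assign ''r'' (Add (Reg ''t'') (Const 1));; Assign ''F'' (Mul (Const 4) (Reg ''t''))"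

definition emit :: com where
  "emit = emit_init;; decode_loop;; Output (Reg ''r'')"

definition loop_x :: com where
  "loop_x =
     Assign ''x'' (Const 1);;
     While (Less (Reg ''x'') (Add (Reg ''n'') (Const 1)))
       (emit;; Assign ''x'' (Add (Reg ''x'') (Const 1)))"

definition loop_N :: com where
  "loop_N =
     Assign ''N'' (Const 0);;
     While (Less (Reg ''N'') (Reg ''T''))
       (loop_x;; Assign ''N'' (Add (Reg ''N'') (Const 1)))"

text \<open>\<open>find_mult\<close> leaves the clash weight of its choice in \<open>s\<close>;
  adding it to \<open>S\<close> keeps \<open>S\<close> equal to the total of the doubled weights, by
  \<open>sum_weights_Suc\<close>.\<close>

definition body_j :: com where
  "body_j = find_mult;; double_clashes;; Assign ''S'' (Add (Reg ''S'') (Reg ''s''));;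
     loop_N;; Assign ''j'' (Add (Reg ''j'') (Const 1))"

definition loop_j :: com where
  "loop_j =
     Assign ''S'' (Sub (Reg ''v'') (Const 1));; Assign ''j'' (Const 0);;
     While (Less (Reg ''j'') (Reg ''L'')) body_j"

definition loop_v :: com where
  "loop_v =
     Assign ''c'' (Const 0);;
     While (Less (Reg ''c'') (Reg ''K''))
       (find_prime;; init_weights;; loop_j;; Assign ''c'' (Add (Reg ''c'') (Const 1)))"

lemma emit_init_frame [simp]:
  "regs emit_init = {''y'', ''z'', ''w'', ''e'', ''h'', ''o'', ''r'', ''F''}"
  "arrs emit_init = {}" "\<not> outputs emit_init"
  by (auto simp: emit_init_def)

lemma emit_frame [simp]:
  "regs emit = {''y'', ''z'', ''w'', ''e'', ''h'', ''o'', ''r'', ''F'', ''u''}" "arrs emit = {}"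
  by (auto simp: emit_def)

lemma loop_x_frame [simp]: "regs loop_x = insert ''x'' (regs emit)" "arrs loop_x = {}"
  by (auto simp: loop_x_def)

lemma loop_N_frame [simp]: "regs loop_N = insert ''N'' (regs loop_x)" "arrs loop_N = {}"
  by (auto simp: loop_N_def)

lemma body_j_frame [simp]:
  "regs body_j = {''a'', ''g'', ''s'', ''d'', ''S'', ''j''} \<union> regs loop_N" "arrs body_j = {''W''}"
  by (auto simp: body_j_def)

lemma loop_j_frame [simp]: "regs loop_j = regs body_j" "arrs loop_j = {''W''}"
  by (auto simp: loop_j_def)

lemma loop_v_frame [simp]:
  "regs loop_v = {''c'', ''v'', ''f''} \<union> regs body_j" "arrs loop_v = {''W''}"
  by (auto simp: loop_v_def)

text \<open>The word-size requirements in the form in which the loops use them. The primes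
  \<open>v\<close> are at most \<open>2 ^ e\<close>, so \<open>2 ^ (2 * e)\<close> covers products
  of residues; \<open>2 ^ (5 * e)\<close> bounds the total weight, whose clashing part is multiplied
  by \<open>M\<close> in \<open>find_mult\<close>; the bound containing \<open>b\<close> is that of
  \<open>runs_decode_loop\<close> at fuel \<open>4 * t\<close>.\<close>

locale machine =
  fixes n t w p m b M Tot L K e :: nat
  assumes n: "n + 1 < 2 ^ w" and Tot: "Tot < 2 ^ w" and L: "L < 2 ^ w" "L = M * e" and K: "K < 2 ^ w"
    and t: "t + 1 < 2 ^ w" and p: "0 < p" "p < 2 ^ w" "p * M < 2 ^ w" and m: "m < 2 ^ w"
    and b: "0 < b" "(4 * t + 2) * (b * 2 ^ (4 * t)) < 2 ^ w" and w: "4 < (2::nat) ^ w"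
    and M: "0 < M" "2 * M * 2 ^ (5 * e) < 2 ^ w" and e: "2 ^ (2 * e) < (2::nat) ^ w"
begin

definition env :: "state \<Rightarrow> bool" where
  "env s \<longleftrightarrow> reg s ''n'' = n \<and> reg s ''t'' = t \<and> reg s ''p'' = p \<and> reg s ''m'' = m \<and> reg s ''b'' = b \<and>
     reg s ''M'' = M \<and> reg s ''T'' = Tot \<and> reg s ''L'' = L \<and> reg s ''K'' = K"

lemma env_frame:
  "frame c s s' \<Longrightarrow> regs c \<inter> {''n'', ''t'', ''p'', ''m'', ''b'', ''M'', ''T'', ''L'', ''K''} = {} \<Longrightarrow>
    env s \<Longrightarrow> env s'"
  by (auto simp: env_def frame_def)

lemma env_upd [simp]:
  "x \<notin> {''n'', ''t'', ''p'', ''m'', ''b'', ''M'', ''T'', ''L'', ''K''} \<Longrightarrow>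
    env (s\<lparr>reg := (reg s)(x := a)\<rparr>) = env s"
  by (auto simp: env_def)

lemma M_fits: "M < 2 ^ w" "2 * 2 ^ (5 * e) < (2::nat) ^ w"
proof -
  have "M * 1 \<le> M * 2 ^ (5 * e)" by (intro mult_left_mono) auto
  then show "M < 2 ^ w" using M by linarith
  have "2 * 1 * 2 ^ (5 * e) \<le> 2 * M * 2 ^ (5 * e)" using M by (intro mult_mono) auto
  then show "2 * 2 ^ (5 * e) < (2::nat) ^ w" using M by linarith
qed

lemma t4_fits: "4 * t < 2 ^ w" "b < 2 ^ w"
proof -
  have "1 * (b * 1) \<le> (4 * t + 2) * (b * 2 ^ (4 * t))" by (intro mult_mono) auto
  then show "b < 2 ^ w" using b by linarith
  have "0 < b * 2 ^ (4 * t)" using b(1) by simp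
  then have "1 \<le> b * 2 ^ (4 * t)" by linarith
  then have "(4 * t + 2) * 1 \<le> (4 * t + 2) * (b * 2 ^ (4 * t))" by (rule mult_left_mono) simp
  then show "4 * t < 2 ^ w" using b(2) by (simp only: mult_1_right)
qed

lemma v_fits:
  fixes v :: nat
  assumes v: "v \<le> 2 ^ e"
  shows "v * v < 2 ^ w" "v < 2 ^ w"
proof -
  have "v * v \<le> 2 ^ e * 2 ^ e" using v by (intro mult_mono) auto
  also have "\<dots> = 2 ^ (2 * e)" by (simp add: mult_2 power_add)
  finally show 1: "v * v < 2 ^ w" using e by linarith
  have "v \<le> v * v" by simp
  then show "v < 2 ^ w" using 1 by linarith
qed

lemma runs_emit_init:
  assumes "env s" and [simp]: "reg s ''v'' = v" "reg s ''a'' = a" "reg s ''N'' = N" "reg s ''x'' = x"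
    and "0 < v" "v \<le> 2 ^ e" "a < v" "N < 2 ^ w" "x \<le> n"
  shows "runs w emit_init s (\<lambda>T s'. T \<le> 60 \<and> reg s' ''y'' = a * (x mod v) mod v mod M \<and>
    reg s' ''z'' = N \<and> reg s' ''w'' = b \<and> reg s' ''e'' = 0 \<and> reg s' ''h'' = 0 \<and>
    reg s' ''o'' = 1 \<and> reg s' ''r'' = t + 1 \<and> reg s' ''F'' = 4 * t \<and> frame emit_init s s')"
proof -
  have [simp]: "reg s ''b'' = b" "reg s ''t'' = t" "reg s ''M'' = M" using assms(1) by (simp_all add: env_def)
  have "x mod v < v" using assms by simp
  then have "a * (x mod v) \<le> v * v" using assms by (intro mult_mono) auto
  then have ax: "a * (x mod v) < 2 ^ w" using v_fits(1)[OF assms(7)] by linarith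
  have aw: "a < 2 ^ w" "x < 2 ^ w" "x mod v < 2 ^ w" using v_fits(2)[OF assms(7)] assms n \<open>x mod v < v\<close> by linarith+
  have "runs w emit_init s (\<lambda>T s'. T \<le> 60 \<and> reg s' ''y'' = a * (x mod v) mod v mod M \<and>
    reg s' ''z'' = N \<and> reg s' ''w'' = b \<and> reg s' ''e'' = 0 \<and> reg s' ''h'' = 0 \<and>
    reg s' ''o'' = 1 \<and> reg s' ''r'' = t + 1 \<and> reg s' ''F'' = 4 * t)"
    using assms(9) ax aw M_fits t4_fits v_fits(2)[OF assms(7)] t w
    by (simp add: emit_init_def runs_simps)
  then show ?thesis by (rule runs_frame[THEN runs_mono]) auto
qed

lemma runs_emit:
  assumes "env s" "reg s ''v'' = v" "reg s ''a'' = a" "reg s ''N'' = N" "reg s ''x'' = x"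
    and v: "0 < v" "v \<le> 2 ^ e" "a < v" "N < 2 ^ w" "x \<le> n"
  shows "runs w emit s (\<lambda>T s'. T \<le> 280 * t + 70 \<and>
    out s' = out s @ [code_value p m t b M v a N x] \<and> frame emit s s')"
proof -
  let ?y = "a * (x mod v) mod v mod M"
  have y: "?y < M" using M by simp
  have "runs w emit s (\<lambda>T s'. T \<le> 280 * t + 70 \<and> out s' = out s @ [code_value p m t b M v a N x])"
    unfolding emit_def
  proof (rule runs_SeqI[OF runs_emit_init[OF assms]], goal_cases)
    case A: (1 T1 s1)
    then have fr: "frame emit_init s s1" by blast
    have env1: "reg s1 ''p'' = p" "reg s1 ''m'' = m"
      using fr assms(1) by (simp_all add: frame_def env_def)
    have D: "runs w decode_loop s1 (\<lambda>T s'. T \<le> 70 * (4 * t) + 4 \<and>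
      reg s' ''r'' = decode p m t ?y (4 * t) N b 0 0 1 \<and> frame decode_loop s1 s')"
    proof (rule runs_decode_loop)
      have "p * ?y \<le> p * M" using y by (intro mult_left_mono) auto
      then show "p * ?y < 2 ^ w" using p by linarith
      show "?y < 2 ^ w" using y M_fits by linarith
      show "3 < (2::nat) ^ w" using w by linarith
    qed (use A env1 p m v b t in simp_all)
    show ?case
    proof (rule runs_SeqI[OF D], goal_cases)
      case B: (1 T2 s2)
      have "out s2 = out s" using B fr by (simp add: frame_def)
      moreover have "reg s2 ''r'' \<le> t + 1" using B decode_le by simp
      ultimately show ?case
        using A B t by (simp add: runs_Output code_value_def)
    qed
  qed
  then show ?thesis by (rule runs_frame[THEN runs_mono]) auto
qed

definition time_x :: nat where "time_x = n * (280 * t + 90) + 20"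

lemma runs_loop_x:
  assumes "env s" "reg s ''v'' = v" "reg s ''a'' = a" "reg s ''N'' = N"
    and v: "0 < v" "v \<le> 2 ^ e" "a < v" "N < 2 ^ w"
  shows "runs w loop_x s (\<lambda>T s'. T \<le> time_x \<and>
    out s' = out s @ map (code_value p m t b M v a N) [1..<n + 1] \<and> frame loop_x s s')"
proof -
  let ?b = "Less (Reg ''x'') (Add (Reg ''n'') (Const 1))"
  let ?c = "emit;; Assign ''x'' (Add (Reg ''x'') (Const 1))"
  let ?s = "s\<lparr>reg := (reg s)(''x'' := 1)\<rparr>"
  let ?f = "code_value p m t b M v a N"
  let ?I = "\<lambda>i (s'::state). reg s' ''x'' = 1 + i \<and> out s' = out s @ map ?f [1..<1 + i]"
  have W: "runs w (While ?b ?c) ?s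
    (\<lambda>T s'. T \<le> n * (1 + bcost ?b + (280 * t + 75)) + (1 + bcost ?b) \<and> ?I n s' \<and> frame ?c ?s s')"
  proof (rule runs_While[where I = ?I])
    fix i and s' :: state assume i: "i < n" and I: "?I i s'" and fr: "frame ?c ?s s'"
    have env': "env s'" by (rule env_frame[OF fr]) (use assms(1) in auto)
    have r: "reg s' ''v'' = v" "reg s' ''a'' = a" "reg s' ''N'' = N"
      using fr assms by (simp_all add: frame_def)
    have E: "runs w emit s' (\<lambda>T s''. T \<le> 280 * t + 70 \<and> out s'' = out s' @ [?f (1 + i)] \<and> frame emit s' s'')"
      by (rule runs_emit[OF env' r]) (use I i v in auto)
    have "runs w ?c s' (\<lambda>T s'. T \<le> 280 * t + 75 \<and> ?I (Suc i) s')"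
    proof (rule runs_SeqI[OF E], goal_cases)
      case A: (1 T1 s1)
      then have "reg s1 ''x'' = 1 + i" using frame_reg[of emit s' s1 "''x''"] I by simp
      moreover have "[1..<1 + Suc i] = [1..<1 + i] @ [1 + i]" by simp
      ultimately show ?case
        using A I i n w by (simp add: runs_Assign)
    qed
    then show "bfits w ?b s' \<and> bval ?b s' \<and> runs w ?c s' (\<lambda>T s'. T \<le> 280 * t + 75 \<and> ?I (Suc i) s')"
      using I i n env' by (auto simp: env_def)
  next
    fix s' :: state assume I: "?I n s'" and fr: "frame ?c ?s s'"
    have env': "env s'" by (rule env_frame[OF fr]) (use assms(1) in auto)
    then show "bfits w ?b s' \<and> \<not> bval ?b s'" using I n by (auto simp: env_def)
  qed auto
  show ?thesis
    by (rule runs_frame2, unfold loop_x_def runs_Assign_Seq)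
      (use w in \<open>auto simp: time_x_def algebra_simps intro!: runs_mono[OF W]\<close>)
qed

definition time_N :: nat where "time_N = Tot * (time_x + 20) + 20"

lemma runs_loop_N:
  assumes "env s" "reg s ''v'' = v" "reg s ''a'' = a"
    and v: "0 < v" "v \<le> 2 ^ e" "a < v"
  shows "runs w loop_N s (\<lambda>T s'. T \<le> time_N \<and>
    out s' = out s @ tables n (map (code_value p m t b M v a) [0..<Tot]) \<and> frame loop_N s s')"
proof -
  let ?b = "Less (Reg ''N'') (Reg ''T'')"
  let ?c = "loop_x;; Assign ''N'' (Add (Reg ''N'') (Const 1))"
  let ?s = "s\<lparr>reg := (reg s)(''N'' := 0)\<rparr>"
  let ?f = "code_value p m t b M v a"
  let ?I = "\<lambda>i (s'::state). reg s' ''N'' = i \<and> out s' = out s @ tables n (map ?f [0..<i])"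
  have W: "runs w (While ?b ?c) ?s
    (\<lambda>T s'. T \<le> Tot * (1 + bcost ?b + (time_x + 5)) + (1 + bcost ?b) \<and> ?I Tot s' \<and> frame ?c ?s s')"
  proof (rule runs_While[where I = ?I])
    fix i and s' :: state assume i: "i < Tot" and I: "?I i s'" and fr: "frame ?c ?s s'"
    have env': "env s'" by (rule env_frame[OF fr]) (use assms(1) in auto)
    have r: "reg s' ''v'' = v" "reg s' ''a'' = a" "reg s' ''N'' = i"
      using fr I assms by (simp_all add: frame_def)
    have iw: "i < 2 ^ w" "Suc i < 2 ^ w" using i Tot by linarith+
    have "runs w ?c s' (\<lambda>T s'. T \<le> time_x + 5 \<and> ?I (Suc i) s')"
    proof (rule runs_SeqI[OF runs_loop_x[OF env' r v iw(1)]], goal_cases)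
      case A: (1 T1 s1)
      then have "reg s1 ''N'' = i" using frame_reg[of loop_x s' s1 "''N''"] I by simp
      then show ?case
        using A I iw w by (simp add: runs_Assign tables_def)
    qed
    then show "bfits w ?b s' \<and> bval ?b s' \<and> runs w ?c s' (\<lambda>T s'. T \<le> time_x + 5 \<and> ?I (Suc i) s')"
      using I i iw Tot env' by (auto simp: env_def)
  next
    fix s' :: state assume I: "?I Tot s'" and fr: "frame ?c ?s s'"
    have env': "env s'" by (rule env_frame[OF fr]) (use assms(1) in auto)
    then show "bfits w ?b s' \<and> \<not> bval ?b s'" using I Tot by (auto simp: env_def)
  qed (auto simp: tables_def)
  show ?thesis
    by (rule runs_frame2, unfold loop_N_def runs_Assign_Seq)
      (use w in \<open>auto simp: time_N_def algebra_simps intro!: runs_mono[OF W]\<close>)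
qed

end

context machine
begin

definition time_body :: nat where "time_body = 130 * (2 ^ e) ^ 2 + time_N + 30"

definition codes :: "nat \<Rightarrow> nat \<Rightarrow> (nat \<Rightarrow> nat) list" where
  "codes v j = map (code_value p m t b M v (mults M v j)) [0..<Tot]"

lemma tables_append: "tables n (xs @ ys) = tables n xs @ tables n ys"
  by (simp add: tables_def)

lemma runs_body_j:
  assumes "env s" "reg s ''v'' = v" "reg s ''j'' = j" and v: "prime v" "v \<le> 2 ^ e" and j: "j < L"
    and W: "\<And>d. d \<in> {1..<v} \<Longrightarrow> arr s ''W'' d = weights M v j d"
    and S: "reg s ''S'' = (\<Sum>d\<in>{1..<v}. weights M v j d)"
  shows "runs w body_j s (\<lambda>T s'. T \<le> time_body \<and> reg s' ''j'' = Suc j \<and>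
    (\<forall>d\<in>{1..<v}. arr s' ''W'' d = weights M v (Suc j) d) \<and>
    reg s' ''S'' = (\<Sum>d\<in>{1..<v}. weights M v (Suc j) d) \<and>
    out s' = out s @ tables n (codes v j) \<and> frame body_j s s')"
proof -
  let ?a = "mults M v j"
  define sum where "sum = (\<Sum>d\<in>{1..<v}. weights M v j d)"
  define sum' where "sum' = (\<Sum>d\<in>{1..<v}. weights M v (Suc j) d)"
  define cw where "cw = clash_weight M v (weights M v j) ?a"
  have sums: "sum' = sum + cw" unfolding sum'_def sum_def cw_def by (rule sum_weights_Suc)
  have v2: "2 \<le> v" using v(1) by (rule prime_ge_2_nat)
  have "sum < 2 ^ (5 * e)" unfolding sum_def
    by (rule sum_weights_bound) (use v M j L in auto)
  moreover have "sum' < 2 ^ (5 * e)" unfolding sum'_def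
    by (rule sum_weights_bound) (use v M j L in auto)
  ultimately have sumw: "2 * sum < 2 ^ w" "sum < 2 ^ w" "sum' < 2 ^ w" "M * sum < 2 ^ w"
  proof -
    assume A: "sum < 2 ^ (5 * e)" "sum' < 2 ^ (5 * e)"
    show "2 * sum < 2 ^ w" "sum < 2 ^ w" "sum' < 2 ^ w" using A M_fits by linarith+
    have "M * sum \<le> M * 2 ^ (5 * e)" using A by (intro mult_left_mono) auto
    then show "M * sum < 2 ^ w" using M by linarith
  qed
  have cww: "cw < 2 ^ w" using sumw(3) sums by linarith
  have a: "?a < v" unfolding mults_def by (rule good_mult(2)[OF v(1) M(1)])
  have "?a * v \<le> v * v" using a by (intro mult_right_mono) auto
  then have av: "?a * v < 2 ^ w" using v_fits[OF v(2)] by linarith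
  have Mr: "reg s ''M'' = M" using assms(1) by (simp add: env_def)
  have vv: "v ^ 2 \<le> (2 ^ e) ^ 2" using v(2) by (rule power_mono) simp
  have "v \<le> v ^ 2" unfolding power2_eq_square by simp
  then have v1: "v \<le> (2 ^ e) ^ 2" using vv by (rule order_trans)
  have fm: "runs w find_mult s (\<lambda>T s'. T \<le> 80 * v ^ 2 \<and> reg s' ''a'' = ?a \<and> reg s' ''s'' = cw \<and> frame find_mult s s')"
    unfolding mults_def cw_def
    by (rule runs_find_mult) (use assms(2) v v_fits[OF v(2)] Mr M(1) M_fits W S sumw sum_def in simp_all)
  have "runs w body_j s (\<lambda>T s'. T \<le> time_body \<and> reg s' ''j'' = Suc j \<and>
    (\<forall>d\<in>{1..<v}. arr s' ''W'' d = weights M v (Suc j) d) \<and> reg s' ''S'' = sum' \<and>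
    out s' = out s @ tables n (codes v j))"
    unfolding body_j_def
  proof (rule runs_SeqI[OF fm], goal_cases)
    case A1: (1 T1 s1)
    then have fr1: "frame find_mult s s1" by blast
    have env1: "env s1" by (rule env_frame[OF fr1]) (use assms(1) in auto)
    have r1: "reg s1 ''v'' = v" "reg s1 ''S'' = sum" "reg s1 ''j'' = j" "arr s1 ''W'' = arr s ''W''" "out s1 = out s"
      using fr1 assms(2,3) S sum_def by (simp_all add: frame_def)
    have dc: "runs w double_clashes s1 (\<lambda>T s'. T \<le> 50 * v \<and>
      (\<forall>d\<in>{1..<v}. arr s' ''W'' d = (if clash M v ?a d then 2 * weights M v j d else weights M v j d)) \<and>
      frame double_clashes s1 s')"
      by (rule runs_double_clashes)
        (use A1 r1 env1 v2 v_fits[OF v(2)] M_fits av a W sumw sum_def in \<open>simp_all add: env_def\<close>)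
    show ?case
    proof (rule runs_SeqI[OF dc], goal_cases)
      case A2: (1 T2 s2)
      then have fr2: "frame double_clashes s1 s2" by blast
      have env2: "env s2" by (rule env_frame[OF fr2]) (use env1 in auto)
      have r2: "reg s2 ''v'' = v" "reg s2 ''S'' = sum" "reg s2 ''j'' = j" "reg s2 ''a'' = ?a" "reg s2 ''s'' = cw"
        "out s2 = out s"
        using fr2 r1 A1 by (simp_all add: frame_def)
      have W2: "\<forall>d\<in>{1..<v}. arr s2 ''W'' d = weights M v (Suc j) d" using A2 by (simp add: mults_def)
      let ?s3 = "s2\<lparr>reg := (reg s2)(''S'' := sum')\<rparr>"
      have env3: "env ?s3" using env2 by simp
      have l: "runs w loop_N ?s3 (\<lambda>T s'. T \<le> time_N \<and>
        out s' = out ?s3 @ tables n (map (code_value p m t b M v ?a) [0..<Tot]) \<and> frame loop_N ?s3 s')"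
        by (rule runs_loop_N[OF env3]) (use r2 v2 v a in simp_all)
      have rest: "runs w (loop_N;; Assign ''j'' (Add (Reg ''j'') (Const 1))) ?s3
        (\<lambda>T s'. 1 + T1 + (1 + T2 + (1 + 4 + T)) \<le> time_body \<and> reg s' ''j'' = Suc j \<and>
        (\<forall>d\<in>{1..<v}. arr s' ''W'' d = weights M v (Suc j) d) \<and> reg s' ''S'' = sum' \<and>
        out s' = out s @ tables n (codes v j))"
      proof (rule runs_SeqI[OF l], goal_cases)
        case A4: (1 T4 s4)
        then have fr4: "frame loop_N ?s3 s4" by blast
        have r4: "reg s4 ''j'' = j" "reg s4 ''S'' = sum'" "arr s4 ''W'' = arr s2 ''W''"
          using fr4 r2 by (simp_all add: frame_def)
        have jw: "j < 2 ^ w" "Suc j < 2 ^ w" using j L by linarith+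
        have tb: "1 + T1 + (1 + T2 + (1 + 4 + (1 + T4 + 4))) \<le> time_body"
          unfolding time_body_def using A1 A2 A4 vv v1 by linarith
        show ?case
          using tb r4 A4 r2 W2 jw w by (simp add: runs_Assign codes_def del: weights.simps)
      qed
      show ?case
        unfolding runs_Assign_Seq using sumw cww
        by (auto simp add: r2 sums[symmetric] simp del: weights.simps intro!: runs_mono[OF rest])
    qed
  qed
  then show ?thesis unfolding sum'_def by (rule runs_frame[THEN runs_mono]) auto
qed

definition time_j :: nat where "time_j = L * (time_body + 10) + 20"

lemma runs_loop_j:
  assumes "env s" "reg s ''v'' = v" and v: "prime v" "v \<le> 2 ^ e"
    and W: "\<And>d. d \<in> {1..<v} \<Longrightarrow> arr s ''W'' d = 1"
  shows "runs w loop_j s (\<lambda>T s'. T \<le> time_j \<and>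
    out s' = out s @ tables n (concat (map (codes v) [0..<L])) \<and> frame loop_j s s')"
proof -
  let ?b = "Less (Reg ''j'') (Reg ''L'')"
  let ?s = "s\<lparr>reg := (reg s)(''S'' := v - 1, ''j'' := 0)\<rparr>"
  let ?I = "\<lambda>i (s'::state). reg s' ''j'' = i \<and>
    (\<forall>d\<in>{1..<v}. arr s' ''W'' d = weights M v i d) \<and>
    reg s' ''S'' = (\<Sum>d\<in>{1..<v}. weights M v i d) \<and>
    out s' = out s @ tables n (concat (map (codes v) [0..<i]))"
  have W: "runs w (While ?b body_j) ?s
    (\<lambda>T s'. T \<le> L * (1 + bcost ?b + time_body) + (1 + bcost ?b) \<and> ?I L s' \<and> frame body_j ?s s')"
  proof (rule runs_While[where I = ?I])
    show "?I 0 ?s" using W by (simp add: tables_def)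
    fix i and s' :: state assume i: "i < L" and I: "?I i s'" and fr: "frame body_j ?s s'"
    have env': "env s'" by (rule env_frame[OF fr]) (use assms(1) in \<open>auto simp: env_def\<close>)
    have r: "reg s' ''v'' = v" using fr assms by (simp add: frame_def)
    have iw: "i < 2 ^ w" using i L by linarith
    have "runs w body_j s' (\<lambda>T s'. T \<le> time_body \<and> ?I (Suc i) s')"
      by (rule runs_mono[OF runs_body_j[OF env' r _ v i]])
        (use I in \<open>simp_all add: tables_append del: weights.simps\<close>)
    moreover have "bfits w ?b s' \<and> bval ?b s'" using I i iw L(1) env' by (simp add: env_def)
    ultimately show "bfits w ?b s' \<and> bval ?b s' \<and> runs w body_j s' (\<lambda>T s'. T \<le> time_body \<and> ?I (Suc i) s')"
      by blast
  next
    fix s' :: state assume I: "?I L s'" and fr: "frame body_j ?s s'"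
    have env': "env s'" by (rule env_frame[OF fr]) (use assms(1) in \<open>auto simp: env_def\<close>)
    then show "bfits w ?b s' \<and> \<not> bval ?b s'" using I L(1) by (simp add: env_def)
  qed
  show ?thesis
    by (rule runs_frame2, unfold loop_j_def runs_Assign_Seq)
      (use w v_fits[OF v(2)] in \<open>auto simp: assms(2) time_j_def algebra_simps intro!: runs_mono[OF W]\<close>)
qed

definition time_v :: nat where "time_v = K * (60 * (2 ^ e) ^ 2 + time_j + 20) + 20"

lemma runs_loop_v:
  assumes "env s" "reg s ''v'' = Q" "1 \<le> Q" and P: "\<And>i. i < K \<Longrightarrow> nth_prime_above Q i \<le> 2 ^ e"
  shows "runs w loop_v s (\<lambda>T s'. T \<le> time_v \<and>
    out s' = out s @ tables n (concat (map (\<lambda>i. concat (map (codes (nth_prime_above Q i)) [0..<L])) [0..<K])))"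
proof -
  let ?b = "Less (Reg ''c'') (Reg ''K'')"
  let ?c = "find_prime;; init_weights;; loop_j;; Assign ''c'' (Add (Reg ''c'') (Const 1))"
  let ?s = "s\<lparr>reg := (reg s)(''c'' := 0)\<rparr>"
  let ?f = "\<lambda>i. concat (map (codes (nth_prime_above Q i)) [0..<L])"
  \<comment> \<open>Register \<open>v\<close> holds the start value \<open>Q\<close> before
    iteration 0 and the previous prime before each later one.\<close>
  let ?P = "\<lambda>i. if i = 0 then Q else nth_prime_above Q (i - 1)"
  let ?I = "\<lambda>i (s'::state). reg s' ''c'' = i \<and> reg s' ''v'' = ?P i \<and>
    out s' = out s @ tables n (concat (map ?f [0..<i]))"
  have next_P: "next_prime (?P i) = nth_prime_above Q i" for i by (cases i) auto
  have P1: "1 \<le> ?P i" for i using assms(3) nth_prime_above(2)[of Q "i - 1"] by (cases i) auto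
  have W: "runs w (While ?b ?c) ?s
    (\<lambda>T s'. T \<le> K * (1 + bcost ?b + (60 * (2 ^ e) ^ 2 + time_j + 10)) + (1 + bcost ?b) \<and> ?I K s' \<and> frame ?c ?s s')"
  proof (rule runs_While[where I = ?I])
    fix i and s' :: state assume i: "i < K" and I: "?I i s'" and fr: "frame ?c ?s s'"
    define v where "v = nth_prime_above Q i"
    have v: "prime v" "v \<le> 2 ^ e" unfolding v_def using nth_prime_above(1) P[OF i] by auto
    have v2: "2 \<le> v" using v(1) by (rule prime_ge_2_nat)
    have np: "next_prime (?P i) = v" unfolding v_def by (rule next_P)
    have env': "env s'" by (rule env_frame[OF fr]) (use assms(1) in auto)
    have vv: "v ^ 2 \<le> (2 ^ e) ^ 2" using v(2) by (rule power_mono) simp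
    have "v \<le> v ^ 2" unfolding power2_eq_square by simp
    then have v1: "v \<le> (2 ^ e) ^ 2" using vv by (rule order_trans)
    have iw: "i < 2 ^ w" "Suc i < 2 ^ w" using i K by linarith+
    have fp: "runs w find_prime s' (\<lambda>T s''. T \<le> 40 * v ^ 2 \<and> reg s'' ''v'' = v \<and> frame find_prime s' s'')"
      unfolding np[symmetric]
      by (rule runs_find_prime) (use I P1 np v_fits[OF v(2)] in simp_all)
    have "runs w ?c s' (\<lambda>T s'. T \<le> 60 * (2 ^ e) ^ 2 + time_j + 10 \<and> ?I (Suc i) s')"
    proof (rule runs_SeqI[OF fp], goal_cases)
      case A1: (1 T1 s1)
      then have fr1: "frame find_prime s' s1" by blast
      have env1: "env s1" by (rule env_frame[OF fr1]) (use env' in auto)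
      have iwt: "runs w init_weights s1 (\<lambda>T s''. T \<le> 12 * v \<and>
        (\<forall>d\<in>{1..<v}. arr s'' ''W'' d = 1) \<and> frame init_weights s1 s'')"
        by (rule runs_init_weights) (use A1 v2 v_fits[OF v(2)] in simp_all)
      show ?case
      proof (rule runs_SeqI[OF iwt], goal_cases)
        case A2: (1 T2 s2)
        then have fr2: "frame init_weights s1 s2" by blast
        have env2: "env s2" by (rule env_frame[OF fr2]) (use env1 in auto)
        have r2: "reg s2 ''v'' = v" using fr2 A1 by (simp add: frame_def)
        have lj: "runs w loop_j s2 (\<lambda>T s''. T \<le> time_j \<and> out s'' = out s2 @ tables n (?f i) \<and> frame loop_j s2 s'')"
          unfolding v_def[symmetric] by (rule runs_loop_j[OF env2 r2 v]) (use A2 in simp)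
        show ?case
        proof (rule runs_SeqI[OF lj], goal_cases)
          case A3: (1 T3 s3)
          then have fr3: "frame loop_j s2 s3" by blast
          have r3: "reg s3 ''v'' = v" "reg s3 ''c'' = i"
            using fr3 fr2 fr1 I r2 by (simp_all add: frame_def)
          have "out s2 = out s'" using fr2 fr1 by (simp add: frame_def)
          then have o3: "out s3 = out s @ tables n (concat (map ?f [0..<Suc i]))"
            using A3 I by (simp add: tables_append)
          have tb: "1 + T1 + (1 + T2 + (1 + T3 + 4)) \<le> 60 * (2 ^ e) ^ 2 + time_j + 10"
            using A1 A2 A3 vv v1 by linarith
          show ?case
            using tb r3 o3 iw w by (simp add: runs_Assign v_def)
        qed
      qed
    qed
    then show "bfits w ?b s' \<and> bval ?b s' \<and>
      runs w ?c s' (\<lambda>T s'. T \<le> 60 * (2 ^ e) ^ 2 + time_j + 10 \<and> ?I (Suc i) s')"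
      using I i iw K env' by (simp add: env_def)
  next
    fix s' :: state assume I: "?I K s'" and fr: "frame ?c ?s s'"
    have env': "env s'" by (rule env_frame[OF fr]) (use assms(1) in auto)
    then show "bfits w ?b s' \<and> \<not> bval ?b s'" using I K by (simp add: env_def)
  qed (use assms(2) in \<open>simp add: tables_def\<close>)
  show ?thesis
    unfolding loop_v_def runs_Assign_Seq using w
    by (auto simp: time_v_def algebra_simps intro!: runs_mono[OF W])
qed

end

section \<open>Computing the parameters\<close>

text \<open>The logarithm of \<open>B\<close> to base 2, rounded up, but never below
  \<open>e\<close>; the program obtains it by repeated doubling from \<open>2 ^ e\<close>.\<close>

definition least_exp :: "nat \<Rightarrow> nat \<Rightarrow> nat" where
  "least_exp e B = (LEAST i. e \<le> i \<and> B \<le> 2 ^ i)"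

lemma least_exp: "e \<le> least_exp e B" "B \<le> 2 ^ least_exp e B"
proof -
  have "e \<le> max e B \<and> B \<le> 2 ^ max e B"
  proof
    have "B \<le> 2 ^ B" by (rule less_imp_le) (rule less_exp)
    also have "\<dots> \<le> 2 ^ max e B" by (intro power_increasing) auto
    finally show "B \<le> 2 ^ max e B" .
  qed simp
  then have "e \<le> least_exp e B \<and> B \<le> 2 ^ least_exp e B" unfolding least_exp_def by (rule LeastI)
  then show "e \<le> least_exp e B" "B \<le> 2 ^ least_exp e B" by auto
qed

lemma less_least_exp: "e \<le> i \<Longrightarrow> i < least_exp e B \<Longrightarrow> 2 ^ i < B"
  unfolding least_exp_def using not_less_Least by (metis not_le)

definition loop_exp :: "name \<Rightarrow> name \<Rightarrow> aexp \<Rightarrow> com" where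
  "loop_exp x y a =
     While (Less (Reg y) a) (Assign y (Mul (Reg y) (Const 2));; Assign x (Add (Reg x) (Const 1)))"

lemma loop_exp_frame [simp]: "regs (loop_exp x y a) = {x, y}" "arrs (loop_exp x y a) = {}" "\<not> outputs (loop_exp x y a)"
  by (auto simp: loop_exp_def)

lemma runs_loop_exp:
  assumes "reg s x = e" "reg s y = 2 ^ e" "x \<noteq> y"
    and a: "\<And>s'. frame (loop_exp x y a) s s' \<Longrightarrow> aval a s' = B \<and> afits w a s'"
    and w: "2 ^ least_exp e B < (2::nat) ^ w" "2 < (2::nat) ^ w"
  shows "runs w (loop_exp x y a) s (\<lambda>T s'. T \<le> least_exp e B * (14 + acost a) + 3 + acost a \<and>
    reg s' x = least_exp e B \<and> reg s' y = 2 ^ least_exp e B \<and> frame (loop_exp x y a) s s')"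
proof -
  let ?b = "Less (Reg y) a"
  let ?c = "Assign y (Mul (Reg y) (Const 2));; Assign x (Add (Reg x) (Const 1))"
  define l where "l = least_exp e B"
  have l: "e \<le> l" "B \<le> 2 ^ l" unfolding l_def by (rule least_exp)+
  let ?I = "\<lambda>i (s'::state). reg s' x = e + i \<and> reg s' y = 2 ^ (e + i)"
  have W: "runs w (While ?b ?c) s
    (\<lambda>T s'. T \<le> (l - e) * (1 + bcost ?b + 10) + (1 + bcost ?b) \<and> ?I (l - e) s' \<and> frame ?c s s')"
  proof (rule runs_While[where I = ?I])
    fix i and s' :: state assume i: "i < l - e" and I: "?I i s'" and fr: "frame ?c s s'"
    have "frame (loop_exp x y a) s s'" using fr by (simp add: frame_def loop_exp_def)
    note a' = a[OF this]
    have "2 ^ (e + i) < B" using less_least_exp[of e "e + i" B] i l_def by simp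
    have il: "Suc (e + i) \<le> l" using i by simp
    have "2 * 2 ^ (e + i) = (2::nat) ^ Suc (e + i)" by simp
    also have "\<dots> \<le> 2 ^ l" using il by (intro power_increasing) auto
    finally have p: "2 * 2 ^ (e + i) < (2::nat) ^ w" using w unfolding l_def by linarith
    have ei: "Suc (e + i) < 2 ^ w" using less_exp[of "e + i"] p by linarith
    define Y where "Y = (2::nat) ^ (e + i)"
    have YS: "(2::nat) ^ (e + Suc i) = 2 * Y" unfolding Y_def by simp
    show "bfits w ?b s' \<and> bval ?b s' \<and> runs w ?c s' (\<lambda>T s'. T \<le> 10 \<and> ?I (Suc i) s')"
      using I a' \<open>2 ^ (e + i) < B\<close> p ei w(2) assms(3) unfolding YS Y_def[symmetric]
      by (simp add: runs_simps mult.commute)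
  next
    fix s' :: state assume I: "?I (l - e) s'" and fr: "frame ?c s s'"
    have "frame (loop_exp x y a) s s'" using fr by (simp add: frame_def loop_exp_def)
    note a' = a[OF this]
    show "bfits w ?b s' \<and> \<not> bval ?b s'" using I l a' w unfolding l_def by simp
  qed (use assms in auto)
  define Z where "Z = l * (14 + acost a)"
  have "(l - e) * (1 + bcost ?b + 10) \<le> Z" unfolding Z_def by (intro mult_mono) auto
  then have "T \<le> Z + 3 + acost a" if "T \<le> (l - e) * (1 + bcost ?b + 10) + (1 + bcost ?b)" for T
    using that by simp
  then have "runs w (loop_exp x y a) s (\<lambda>T s'. T \<le> l * (14 + acost a) + 3 + acost a \<and> reg s' x = l \<and> reg s' y = 2 ^ l)"
    unfolding loop_exp_def Z_def[symmetric] by - (rule runs_mono[OF W], use l in simp)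
  then show ?thesis unfolding l_def by (rule runs_frame[THEN runs_mono]) auto
qed

text \<open>Iterates the guaranteed decay from \<open>t\<close>, so it suffices for every set
  \<open>C\<close> of \<open>t\<close> elements and can be computed from \<open>t\<close> and
  \<open>k\<close> alone.\<close>

definition decay_rounds :: "nat \<Rightarrow> nat \<Rightarrow> nat" where
  "decay_rounds t k = (LEAST r. (decay t k ^^ r) t = 0)"

lemma decay_le:
  assumes "t \<le> k"
  shows "2 * decay t k x \<le> x"
proof (cases "k = 0")
  case False
  have "x * t div (2 * k) \<le> x * k div (2 * k)" using assms by (intro div_le_mono mult_left_mono) auto
  also have "\<dots> = x div 2" using False by simp
  finally show ?thesis unfolding decay_def by linarith
qed (simp add: decay_def)

lemma decay_funpow_le: "t \<le> k \<Longrightarrow> 2 ^ r * (decay t k ^^ r) x \<le> x"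
proof (induction r)
  case (Suc r)
  have "2 ^ Suc r * (decay t k ^^ Suc r) x = 2 ^ r * (2 * decay t k ((decay t k ^^ r) x))" by simp
  also have "\<dots> \<le> 2 ^ r * (decay t k ^^ r) x" by (intro mult_left_mono decay_le Suc.prems) simp
  also have "\<dots> \<le> x" by (rule Suc.IH[OF Suc.prems])
  finally show ?case .
qed simp

lemma decay_rounds:
  assumes "t \<le> k"
  shows "(decay t k ^^ decay_rounds t k) t = 0" "i < decay_rounds t k \<Longrightarrow> 0 < (decay t k ^^ i) t"
    and "t < 2 ^ r \<Longrightarrow> decay_rounds t k \<le> r"
proof -
  have z: "(decay t k ^^ r) t = 0" if "t < 2 ^ r" for r
  proof (rule ccontr)
    assume "(decay t k ^^ r) t \<noteq> 0"
    then have "2 ^ r * 1 \<le> 2 ^ r * (decay t k ^^ r) t" by (intro mult_left_mono) auto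
    then show False using decay_funpow_le[OF assms, of r t] that by linarith
  qed
  show "(decay t k ^^ decay_rounds t k) t = 0" unfolding decay_rounds_def
    by (rule LeastI[of _ t], rule z, rule less_exp)
  show "i < decay_rounds t k \<Longrightarrow> 0 < (decay t k ^^ i) t" unfolding decay_rounds_def
    using not_less_Least by auto
  show "t < 2 ^ r \<Longrightarrow> decay_rounds t k \<le> r" unfolding decay_rounds_def using z by (intro Least_le)
qed

definition loop_rounds :: com where
  "loop_rounds =
     Assign ''T'' (Const 1);; Assign ''X'' (Reg ''t'');;
     While (Less (Const 0) (Reg ''X''))
       (Assign ''X'' (Div (Mul (Reg ''X'') (Reg ''t'')) (Mul (Const 2) (Reg ''k'')));;
        Assign ''T'' (Mul (Reg ''T'') (Mul (Const 3) (Reg ''p''))))"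

lemma loop_rounds_frame [simp]:
  "regs loop_rounds = {''T'', ''X''}" "arrs loop_rounds = {}" "\<not> outputs loop_rounds"
  by (auto simp: loop_rounds_def)

lemma runs_loop_rounds:
  assumes s: "reg s ''t'' = t" "reg s ''k'' = k" "reg s ''p'' = p" and tk: "t \<le> k" "1 \<le> p"
    and w: "t * t < 2 ^ w" "2 * k < 2 ^ w" "3 * p < 2 ^ w" "(3 * p) ^ decay_rounds t k < 2 ^ w" "3 < (2::nat) ^ w"
  shows "runs w loop_rounds s (\<lambda>T s'. T \<le> 30 * decay_rounds t k + 20 \<and>
    reg s' ''T'' = (3 * p) ^ decay_rounds t k \<and> frame loop_rounds s s')"
proof -
  let ?b = "Less (Const 0) (Reg ''X'')"
  let ?c = "Assign ''X'' (Div (Mul (Reg ''X'') (Reg ''t'')) (Mul (Const 2) (Reg ''k'')));;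
        Assign ''T'' (Mul (Reg ''T'') (Mul (Const 3) (Reg ''p'')))"
  let ?s = "s\<lparr>reg := (reg s)(''T'' := 1, ''X'' := t)\<rparr>"
  define r where "r = decay_rounds t k"
  note dr = decay_rounds[OF tk(1), folded r_def]
  define D where "D = (\<lambda>i. (decay t k ^^ i) t)"
  have D: "D 0 = t" "D (Suc i) = D i * t div (2 * k)" for i unfolding D_def by (simp_all add: decay_def)
  have Dle: "D i \<le> t" for i
  proof -
    have "1 * D i \<le> 2 ^ i * D i" by (intro mult_right_mono) auto
    then show ?thesis using decay_funpow_le[OF tk(1), of i t] unfolding D_def by linarith
  qed
  have t_le: "t \<le> t * t" by simp
  have tw: "t < 2 ^ w" using t_le w(1) by linarith
  let ?I = "\<lambda>i (s'::state). reg s' ''X'' = D i \<and> reg s' ''T'' = (3 * p) ^ i"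
  have W: "runs w (While ?b ?c) ?s
    (\<lambda>T s'. T \<le> r * (1 + bcost ?b + 20) + (1 + bcost ?b) \<and> ?I r s' \<and> frame ?c ?s s')"
  proof (rule runs_While[where I = ?I])
    show "?I 0 ?s" using D by simp
    fix i and s' :: state assume i: "i < r" and I: "?I i s'" and fr: "frame ?c ?s s'"
    have [simp]: "reg s' ''t'' = t" "reg s' ''k'' = k" "reg s' ''p'' = p"
      using fr s by (simp_all add: frame_def)
    have "D i * t \<le> t * t" using Dle by (rule mult_right_mono) simp
    then have Dt: "D i * t < 2 ^ w" using w by linarith
    have Di: "D i < 2 ^ w" "0 < D i" using Dle[of i] tw dr(2)[OF i] unfolding D_def by linarith+
    have "(3 * p) ^ Suc i \<le> (3 * p) ^ r" using i tk(2) by (intro power_increasing) auto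
    then have p1: "(3 * p) ^ Suc i < 2 ^ w" using w(4) unfolding r_def by linarith
    have "(3 * p) ^ i \<le> (3 * p) ^ r" using i tk(2) by (intro power_increasing) auto
    then have p2: "(3 * p) ^ i < 2 ^ w" using w(4) unfolding r_def by linarith
    have pw: "p < 2 ^ w" "k < 2 ^ w" "2 < (2::nat) ^ w" using w by linarith+
    define Y where "Y = (3 * p) ^ i"
    have YS: "(3 * p) ^ Suc i = Y * (3 * p)" unfolding Y_def by simp
    show "bfits w ?b s' \<and> bval ?b s' \<and> runs w ?c s' (\<lambda>T s'. T \<le> 20 \<and> ?I (Suc i) s')"
      using I Di Dt p1 p2 pw w(2,3,5) tw unfolding YS Y_def[symmetric]
      by (simp add: runs_simps D)
  next
    fix s' :: state assume I: "?I r s'" and fr: "frame ?c ?s s'"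
    then show "bfits w ?b s' \<and> \<not> bval ?b s'" using dr(1) unfolding D_def by simp
  qed
  have "runs w loop_rounds s (\<lambda>T s'. T \<le> 30 * r + 20 \<and> reg s' ''T'' = (3 * p) ^ r)"
    unfolding loop_rounds_def runs_Assign_Seq using w tw
    by (auto simp: s intro!: runs_mono[OF W])
  then show ?thesis unfolding r_def by (rule runs_frame[THEN runs_mono]) auto
qed

definition loop_blocks :: com where
  "loop_blocks =
     Assign ''F'' (Const 0);;
     While (Less (Reg ''F'') (Reg ''t''))
       (Assign ''T'' (Mul (Reg ''T'') (Mul (Const 108) (Reg ''b'')));;
        Assign ''F'' (Add (Reg ''F'') (Const 1)))"

lemma loop_blocks_frame [simp]:
  "regs loop_blocks = {''T'', ''F''}" "arrs loop_blocks = {}" "\<not> outputs loop_blocks"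
  by (auto simp: loop_blocks_def)

lemma runs_loop_blocks:
  assumes s: "reg s ''t'' = t" "reg s ''b'' = b" "reg s ''T'' = R" and b: "1 \<le> b" "1 \<le> R"
    and w: "t + 1 < 2 ^ w" "108 * b < 2 ^ w" "R * (108 * b) ^ t < 2 ^ w"
  shows "runs w loop_blocks s (\<lambda>T s'. T \<le> 20 * t + 10 \<and>
    reg s' ''T'' = R * (108 * b) ^ t \<and> frame loop_blocks s s')"
proof -
  let ?b = "Less (Reg ''F'') (Reg ''t'')"
  let ?c = "Assign ''T'' (Mul (Reg ''T'') (Mul (Const 108) (Reg ''b'')));;
        Assign ''F'' (Add (Reg ''F'') (Const 1))"
  let ?s = "s\<lparr>reg := (reg s)(''F'' := 0)\<rparr>"
  let ?I = "\<lambda>i (s'::state). reg s' ''F'' = i \<and> reg s' ''T'' = R * (108 * b) ^ i"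
  have w108: "108 < (2::nat) ^ w" "b < 2 ^ w" "1 < (2::nat) ^ w" using w(2) b by linarith+
  have W: "runs w (While ?b ?c) ?s
    (\<lambda>T s'. T \<le> t * (1 + bcost ?b + 12) + (1 + bcost ?b) \<and> ?I t s' \<and> frame ?c ?s s')"
  proof (rule runs_While[where I = ?I])
    fix i and s' :: state assume i: "i < t" and I: "?I i s'" and fr: "frame ?c ?s s'"
    have [simp]: "reg s' ''t'' = t" "reg s' ''b'' = b"
      using fr s by (simp_all add: frame_def)
    have le: "R * (108 * b) ^ i' < 2 ^ w" if "i' \<le> t" for i'
    proof -
      have "R * (108 * b) ^ i' \<le> R * (108 * b) ^ t" using that b by (intro mult_left_mono power_increasing) auto
      then show ?thesis using w(3) by linarith
    qed
    define Y where "Y = R * (108 * b) ^ i"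
    have YS: "R * (108 * b) ^ Suc i = Y * (108 * b)" unfolding Y_def by simp
    have iw: "Suc i < 2 ^ w" "i < 2 ^ w" using i w(1) by linarith+
    show "bfits w ?b s' \<and> bval ?b s' \<and> runs w ?c s' (\<lambda>T s'. T \<le> 12 \<and> ?I (Suc i) s')"
      using I le[of i] le[of "Suc i"] i iw w(1,2) w108 unfolding YS Y_def[symmetric]
      by (simp add: runs_simps)
  next
    fix s' :: state assume I: "?I t s'" and fr: "frame ?c ?s s'"
    have [simp]: "reg s' ''t'' = t" using fr s by (simp add: frame_def)
    then show "bfits w ?b s' \<and> \<not> bval ?b s'" using w I by simp
  qed (use s in simp)
  show ?thesis
    by (rule runs_frame2, unfold loop_blocks_def runs_Assign_Seq)
      (auto intro!: runs_mono[OF W])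
qed

definition compute_logs :: com where
  "compute_logs =
     Assign ''l'' (Const 1);; Assign ''X'' (Const 2);; loop_exp ''l'' ''X'' (Reg ''n'');;
     Assign ''q'' (Const 3);; Assign ''Q'' (Const 8);;
     loop_exp ''q'' ''Q'' (Mul (Mul (Reg ''k'') (Reg ''k'')) (Reg ''l''))"

definition compute_moduli :: com where
  "compute_moduli =
     Assign ''M'' (Mul (Const 8) (Mul (Reg ''k'') (Reg ''k'')));; Assign ''v'' (Reg ''M'');; find_prime;;
     Assign ''p'' (Reg ''v'');; Assign ''b'' (Add (Div (Reg ''k'') (Reg ''t'')) (Const 1));;
     Assign ''b'' (Mul (Const 2) (Mul (Reg ''b'') (Reg ''b'')));;
     Assign ''m'' (Mul (Reg ''t'') (Mul (Const 2) (Reg ''b'')))"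

definition compute_counts :: com where
  "compute_counts =
     loop_rounds;; loop_blocks;;
     Assign ''K'' (Add (Mul (Mul (Reg ''k'') (Reg ''k'')) (Div (Reg ''l'') (Reg ''q''))) (Const 1));;
     Assign ''L'' (Mul (Reg ''M'') (Mul (Const 3) (Reg ''q'')));;
     Assign ''v'' (Reg ''Q'')"

definition algorithm :: com where
  "algorithm = compute_logs;; compute_moduli;; compute_counts;; loop_v"

lemma compute_logs_frame [simp]:
  "regs compute_logs = {''l'', ''X'', ''q'', ''Q''}" "\<not> outputs compute_logs"
  by (auto simp: compute_logs_def)

lemma compute_moduli_frame [simp]:
  "regs compute_moduli = {''M'', ''v'', ''f'', ''d'', ''p'', ''b'', ''m''}" "\<not> outputs compute_moduli"
  by (auto simp: compute_moduli_def)

lemma compute_counts_frame [simp]: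
  "regs compute_counts = {''T'', ''X'', ''F'', ''K'', ''L'', ''v''}" "\<not> outputs compute_counts"
  by (auto simp: compute_counts_def)

section \<open>The parameters as functions of \<open>n\<close>, \<open>t\<close> and
  \<open>k\<close>\<close>

locale params =
  fixes n t k :: nat
  assumes t1: "1 \<le> t" and tn: "t \<le> n" and tk: "t \<le> k"
begin

definition l :: nat where "l = least_exp 1 n"
text \<open>\<open>2 ^ q\<close> is at least the largest index of a prime in use, so that
  \<open>nth_prime_above_le\<close>, which asks for \<open>q\<close> at least 3, places all of them
  below \<open>2 ^ (3 * q)\<close>.\<close>

definition q :: nat where "q = least_exp 3 (k * k * l)"
definition M :: nat where "M = 8 * k ^ 2"
definition p :: nat where "p = next_prime M"
text \<open>The \<open>m\<close> cells form exactly \<open>t\<close> blocks of length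
  \<open>2 * b\<close>, the block length of the first round, and
  \<open>m * t = 4 * (t * (k div t + 1)) ^ 2\<close> is at least \<open>4 * k ^ 2\<close>, as
  \<open>exists_code\<close> demands.\<close>

definition b :: nat where "b = 2 * ((k div t + 1) * (k div t + 1))"
definition m :: nat where "m = t * (2 * b)"
definition r :: nat where "r = decay_rounds t k"
text \<open>The bound of \<open>exists_code\<close> for \<open>t\<close> blocks and \<open>t\<close>
  elements, where \<open>9 ^ t * (12 * b) ^ t = (108 * b) ^ t\<close>.\<close>

definition Tot :: nat where "Tot = (3 * p) ^ r * (108 * b) ^ t"
definition K :: nat where "K = k * k * (l div q) + 1"
definition L :: nat where "L = M * (3 * q)"

lemma k_pos: "1 \<le> k" and n_pos: "1 \<le> n"
  using t1 tk tn by simp_all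

lemma q3: "3 \<le> q"
  unfolding q_def by (rule least_exp)

lemma k2l_le: "k * k * l \<le> 2 ^ q"
  unfolding q_def by (rule least_exp)

lemma nth_prime_le: "i < K \<Longrightarrow> nth_prime_above (2 ^ q) i \<le> 2 ^ (3 * q)"
proof -
  assume i: "i < K"
  have "k * k * (l div q) \<le> k * k * l" by (intro mult_left_mono) auto
  also have "\<dots> \<le> 2 ^ q" by (rule k2l_le)
  finally have "i \<le> 2 ^ q" using i unfolding K_def by simp
  then show ?thesis by (intro nth_prime_above_le q3)
qed

end

locale params_word = params +
  fixes w :: nat
  assumes fits: "n + 1 < 2 ^ w" "2 ^ l < (2::nat) ^ w" "2 ^ q < (2::nat) ^ w" "k * k * l < 2 ^ w"
    "p * M < 2 ^ w" "m < 2 ^ w" "Tot < 2 ^ w" "K < 2 ^ w" "L < 2 ^ w" "108 * b < 2 ^ w" "3 * p < 2 ^ w"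
    "(4 * t + 2) * (b * 2 ^ (4 * t)) < 2 ^ w" "2 * M * 2 ^ (5 * (3 * q)) < 2 ^ w"
    "2 ^ (2 * (3 * q)) < (2::nat) ^ w"
begin

lemma M1: "8 \<le> M" unfolding M_def using k_pos by simp

lemma p1: "M < p" "prime p" unfolding p_def by (rule next_prime)+

lemma small: "M < 2 ^ w" "p < 2 ^ w" "k * k < 2 ^ w" "8 < (2::nat) ^ w" "b < 2 ^ w" "2 * b < 2 ^ w"
proof -
  show "p < 2 ^ w" "b < 2 ^ w" "2 * b < 2 ^ w" using fits by linarith+
  then show "M < 2 ^ w" using p1 by linarith
  then show "8 < (2::nat) ^ w" using M1 p1 \<open>p < 2 ^ w\<close> by linarith
  show "k * k < 2 ^ w" using \<open>M < 2 ^ w\<close> unfolding M_def power2_eq_square by linarith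
qed

lemma runs_compute_logs:
  assumes s: "reg s ''n'' = n" "reg s ''k'' = k"
  shows "runs w compute_logs s (\<lambda>T s'. T \<le> 20 * l + 20 * q + 40 \<and>
    reg s' ''l'' = l \<and> reg s' ''q'' = q \<and> reg s' ''Q'' = 2 ^ q \<and> frame compute_logs s s')"
proof -
  let ?a = "Mul (Mul (Reg ''k'') (Reg ''k'')) (Reg ''l'')"
  let ?s2 = "s\<lparr>reg := (reg s)(''l'' := 1, ''X'' := 2)\<rparr>"
  have lx: "runs w (loop_exp ''l'' ''X'' (Reg ''n'')) ?s2 (\<lambda>T s'. T \<le> l * (14 + acost (Reg ''n'')) + 3 + acost (Reg ''n'') \<and>
    reg s' ''l'' = l \<and> reg s' ''X'' = 2 ^ l \<and> frame (loop_exp ''l'' ''X'' (Reg ''n'')) ?s2 s')"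
    unfolding l_def
  proof (rule runs_loop_exp)
    fix s' assume fr: "frame (loop_exp ''l'' ''X'' (Reg ''n'')) ?s2 s'"
    show "aval (Reg ''n'') s' = n \<and> afits w (Reg ''n'') s'"
      using fr s fits(1) by (simp add: frame_def)
  qed (use fits(2)[unfolded l_def] small in simp_all)
  have first: "runs w (loop_exp ''l'' ''X'' (Reg ''n'');;
    Assign ''q'' (Const 3);; Assign ''Q'' (Const 8);; loop_exp ''q'' ''Q'' ?a) ?s2
    (\<lambda>T s'. T \<le> 20 * l + 20 * q + 30 \<and> reg s' ''l'' = l \<and> reg s' ''q'' = q \<and> reg s' ''Q'' = 2 ^ q)"
  proof (rule runs_SeqI[OF lx], goal_cases)
    case (1 T3 s3)
    then have fr3: "frame (loop_exp ''l'' ''X'' (Reg ''n'')) ?s2 s3" and T3: "T3 \<le> l * 15 + 4" by auto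
    have r3: "reg s3 ''l'' = l" "reg s3 ''k'' = k" using 1 fr3 s by (simp_all add: frame_def)
    let ?s5 = "s3\<lparr>reg := (reg s3)(''q'' := 3, ''Q'' := 8)\<rparr>"
    have lx2: "runs w (loop_exp ''q'' ''Q'' ?a) ?s5 (\<lambda>T s'. T \<le> q * (14 + acost ?a) + 3 + acost ?a \<and>
      reg s' ''q'' = q \<and> reg s' ''Q'' = 2 ^ q \<and> frame (loop_exp ''q'' ''Q'' ?a) ?s5 s')"
      unfolding q_def
    proof (rule runs_loop_exp)
      fix s' assume fr: "frame (loop_exp ''q'' ''Q'' ?a) ?s5 s'"
      have kw: "k < 2 ^ w" using small(3) k_pos by (metis le_square order_le_less_trans)
      have "l < 2 ^ w" using less_exp[of l] fits(2) by linarith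
      then show "aval ?a s' = k * k * l \<and> afits w ?a s'"
        using fr r3 fits(4) small(3) kw by (simp add: frame_def)
    qed (use fits(3)[unfolded q_def] small in simp_all)
    have "reg s6 ''l'' = l" if "frame (loop_exp ''q'' ''Q'' ?a) ?s5 s6" for s6
      using that r3 by (simp add: frame_def)
    then show ?case
      using small T3 by (auto simp add: runs_Assign_Seq intro!: runs_mono[OF lx2])
  qed
  have "runs w compute_logs s (\<lambda>T s'. T \<le> 20 * l + 20 * q + 40 \<and>
    reg s' ''l'' = l \<and> reg s' ''q'' = q \<and> reg s' ''Q'' = 2 ^ q)"
    unfolding compute_logs_def using small by (auto simp add: runs_Assign_Seq intro!: runs_mono[OF first])
  then show ?thesis by (rule runs_frame[THEN runs_mono]) auto
qed

lemma runs_compute_moduli: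
  assumes s: "reg s ''k'' = k" "reg s ''t'' = t"
  shows "runs w compute_moduli s (\<lambda>T s'. T \<le> 40 * p ^ 2 + 60 \<and>
    reg s' ''M'' = M \<and> reg s' ''p'' = p \<and> reg s' ''b'' = b \<and> reg s' ''m'' = m \<and> frame compute_moduli s s')"
proof -
  let ?s1 = "s\<lparr>reg := (reg s)(''M'' := M, ''v'' := M)\<rparr>"
  have kw: "k < 2 ^ w" using small(3) k_pos by (metis le_square order_le_less_trans)
  have tw: "t < 2 ^ w" using kw tk by linarith
  have M: "8 * (k * k) = M" by (simp add: M_def power2_eq_square)
  have dw: "(k div t + 1) * (k div t + 1) < 2 ^ w" "k div t + 1 < 2 ^ w"
  proof -
    show dd: "(k div t + 1) * (k div t + 1) < 2 ^ w" using small(5) unfolding b_def by linarith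
    then show "k div t + 1 < 2 ^ w" by (metis le_square order_le_less_trans)
  qed
  have fp: "runs w find_prime ?s1 (\<lambda>T s'. T \<le> 40 * p ^ 2 \<and> reg s' ''v'' = p \<and> frame find_prime ?s1 s')"
    unfolding p_def by (rule runs_find_prime) (use M1 small p_def in simp_all)
  have "runs w compute_moduli s (\<lambda>T s'. T \<le> 40 * p ^ 2 + 60 \<and>
    reg s' ''M'' = M \<and> reg s' ''p'' = p \<and> reg s' ''b'' = b \<and> reg s' ''m'' = m)"
  proof -
    have "runs w (find_prime;; Assign ''p'' (Reg ''v'');; Assign ''b'' (Add (Div (Reg ''k'') (Reg ''t'')) (Const 1));;
      Assign ''b'' (Mul (Const 2) (Mul (Reg ''b'') (Reg ''b'')));;
      Assign ''m'' (Mul (Reg ''t'') (Mul (Const 2) (Reg ''b'')))) ?s1 (\<lambda>T s'. T \<le> 40 * p ^ 2 + 40 \<and>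
      reg s' ''M'' = M \<and> reg s' ''p'' = p \<and> reg s' ''b'' = b \<and> reg s' ''m'' = m)"
    proof (rule runs_SeqI[OF fp], goal_cases)
      case (1 T3 s3)
      then have T3: "T3 \<le> 40 * p ^ 2" and v3: "reg s3 ''v'' = p" and fr3: "frame find_prime ?s1 s3" by auto
      have r3: "reg s3 ''M'' = M" "reg s3 ''k'' = k" "reg s3 ''t'' = t"
        using fr3 s by (simp_all add: frame_def)
      have bd: "2 * ((k div t + 1) * (k div t + 1)) = b" "4 * ((k div t + 1) * (k div t + 1)) = 2 * b"
        "t * (2 * b) = m" unfolding b_def m_def by simp_all
      show ?case
        using T3 v3 r3 small kw tw dw(1,2) fits(6) by (simp add: runs_simps bd)
    qed
    note find = this
    show ?thesis
      unfolding compute_moduli_def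
      using small kw by (auto simp add: s M runs_Assign_Seq intro!: runs_mono[OF find])
  qed
  then show ?thesis by (rule runs_frame[THEN runs_mono]) auto
qed

lemma runs_compute_counts:
  assumes s: "reg s ''k'' = k" "reg s ''t'' = t" "reg s ''l'' = l" "reg s ''q'' = q" "reg s ''Q'' = 2 ^ q"
    "reg s ''M'' = M" "reg s ''p'' = p" "reg s ''b'' = b"
  shows "runs w compute_counts s (\<lambda>T s'. T \<le> 30 * r + 20 * t + 80 \<and>
    reg s' ''T'' = Tot \<and> reg s' ''K'' = K \<and> reg s' ''L'' = L \<and> reg s' ''v'' = 2 ^ q \<and> frame compute_counts s s')"
proof -
  let ?R = "(3 * p) ^ r"
  have "0 < b" unfolding b_def by simp
  then have b1: "1 \<le> b" by linarith
  have p0: "1 \<le> p" using p1 by simp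
  have "1 \<le> (108 * b) ^ t" using b1 by (intro one_le_power) linarith
  then have "?R * 1 \<le> Tot" unfolding Tot_def by (rule mult_left_mono) simp
  then have Rw: "?R < 2 ^ w" using fits(7) by linarith
  have kw: "k < 2 ^ w" using small(3) k_pos by (metis le_square order_le_less_trans)
  have k8: "8 * (k * k) < 2 ^ w" using small(1) unfolding M_def power2_eq_square .
  have "k * 1 \<le> k * k" using k_pos by (intro mult_left_mono) auto
  then have k2: "2 * k < 2 ^ w" using k8 by linarith
  have "t * t \<le> k * k" using tk by (intro mult_mono) auto
  then have tt: "t * t < 2 ^ w" using small(3) by linarith
  have tw: "t + 1 < 2 ^ w" using fits(1) tn by linarith
  have ql: "q < 2 ^ w" "l < 2 ^ w" "l div q < 2 ^ w"
    using less_exp[of l] less_exp[of q] fits(2,3) div_le_dividend[of l q] by linarith+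
  have "1 * (3 * q) \<le> L" unfolding L_def using M1 by (intro mult_right_mono) auto
  then have q3: "3 * q < 2 ^ w" using fits(9) by linarith
  have kl: "k * k * (l div q) < 2 ^ w" using fits(8) unfolding K_def by linarith
  have lr: "runs w loop_rounds s (\<lambda>T s'. T \<le> 30 * r + 20 \<and> reg s' ''T'' = ?R \<and> frame loop_rounds s s')"
    unfolding r_def
    by (rule runs_loop_rounds) (use s tk p0 tt k2 fits(11) Rw[unfolded r_def] small in simp_all)
  have "runs w compute_counts s (\<lambda>T s'. T \<le> 30 * r + 20 * t + 80 \<and>
    reg s' ''T'' = Tot \<and> reg s' ''K'' = K \<and> reg s' ''L'' = L \<and> reg s' ''v'' = 2 ^ q)"
    unfolding compute_counts_def
  proof (rule runs_SeqI[OF lr], goal_cases)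
    case (1 T1 s1)
    then have T1: "T1 \<le> 30 * r + 20" and R1: "reg s1 ''T'' = ?R" and fr1: "frame loop_rounds s s1" by auto
    have r1: "reg s1 ''t'' = t" "reg s1 ''b'' = b"
      using fr1 s by (simp_all add: frame_def)
    have R0: "1 \<le> ?R" using p0 by (intro one_le_power) linarith
    have lb: "runs w loop_blocks s1 (\<lambda>T s'. T \<le> 20 * t + 10 \<and>
      reg s' ''T'' = ?R * (108 * b) ^ t \<and> frame loop_blocks s1 s')"
      by (rule runs_loop_blocks[OF r1 R1 b1 R0 tw fits(10) fits(7)[unfolded Tot_def]])
    show ?case
    proof (rule runs_SeqI[OF lb], goal_cases)
      case (1 T2 s2)
      then have T2: "T2 \<le> 20 * t + 10" and R2: "reg s2 ''T'' = Tot" and fr2: "frame loop_blocks s1 s2"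
        unfolding Tot_def by auto
      have r2: "reg s2 ''k'' = k" "reg s2 ''l'' = l" "reg s2 ''q'' = q" "reg s2 ''Q'' = 2 ^ q" "reg s2 ''M'' = M"
        using fr1 fr2 s by (simp_all add: frame_def)
      have KL: "k * k * (l div q) + 1 = K" "M * (3 * q) = L" unfolding K_def L_def by simp_all
      define Q where "Q = (2::nat) ^ q"
      show ?case
        using T1 T2 R2 r2 kw small ql q3 kl fits(3,8,9) unfolding Q_def[symmetric]
        by (simp add: runs_simps KL)
    qed
  qed
  then show ?thesis by (rule runs_frame[THEN runs_mono]) auto
qed

sublocale machine n t w p m b M Tot L K "3 * q"
proof
  show "t + 1 < 2 ^ w" using fits(1) tn by linarith
  show "0 < p" using p1 by simp
  show "4 < (2::nat) ^ w" using small by linarith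
  show "0 < b" unfolding b_def by simp
  show "0 < M" using M1 by simp
  show "L = M * (3 * q)" by (rule L_def)
qed (rule fits small)+

definition family :: "(nat \<Rightarrow> nat) list" where
  "family = concat (map (\<lambda>i. concat (map (codes (nth_prime_above (2 ^ q) i)) [0..<L])) [0..<K])"

definition time_total :: nat where
  "time_total = 20 * l + 20 * q + 40 * p ^ 2 + 30 * r + 20 * t + 200 + time_v"

lemma runs_algorithm:
  "runs w algorithm (input n t k) (\<lambda>T s'. T \<le> time_total \<and> out s' = tables n family)"
  unfolding algorithm_def
proof (rule runs_SeqI[OF runs_compute_logs], goal_cases)
  case (3 T1 s1)
  then have 1: "T1 \<le> 20 * l + 20 * q + 40" "reg s1 ''l'' = l" "reg s1 ''q'' = q" "reg s1 ''Q'' = 2 ^ q"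
    and fr1: "frame compute_logs (input n t k) s1" by auto
  have r1: "reg s1 ''n'' = n" "reg s1 ''k'' = k" "reg s1 ''t'' = t" "out s1 = []"
    using fr1 by (simp_all add: frame_def input_def)
  show ?case
  proof (rule runs_SeqI[OF runs_compute_moduli[OF r1(2,3)]], goal_cases)
    case (1 T2 s2)
    then have 2: "T2 \<le> 40 * p ^ 2 + 60" "reg s2 ''M'' = M" "reg s2 ''p'' = p" "reg s2 ''b'' = b" "reg s2 ''m'' = m"
      and fr2: "frame compute_moduli s1 s2" by auto
    have r2: "reg s2 ''n'' = n" "reg s2 ''k'' = k" "reg s2 ''t'' = t" "out s2 = []"
      "reg s2 ''l'' = l" "reg s2 ''q'' = q" "reg s2 ''Q'' = 2 ^ q"
      using fr2 r1 \<open>reg s1 ''l'' = l\<close> \<open>reg s1 ''q'' = q\<close> \<open>reg s1 ''Q'' = 2 ^ q\<close> by (simp_all add: frame_def)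
    show ?case
    proof (rule runs_SeqI[OF runs_compute_counts[OF r2(2,3,5,6,7) 2(2,3,4)]], goal_cases)
      case (1 T3 s3)
      then have 3: "T3 \<le> 30 * r + 20 * t + 80" "reg s3 ''T'' = Tot" "reg s3 ''K'' = K" "reg s3 ''L'' = L"
        "reg s3 ''v'' = 2 ^ q" and fr3: "frame compute_counts s2 s3" by auto
      have env3: "env s3" unfolding env_def
        using fr3 r2 2 3 by (simp add: frame_def)
      have o3: "out s3 = []" using fr3 r2 by (simp add: frame_def)
      have lv: "runs w loop_v s3 (\<lambda>T s'. T \<le> time_v \<and> out s' = out s3 @ tables n family)"
        unfolding family_def
        by (rule runs_loop_v[OF env3 3(5)]) (simp_all add: nth_prime_le)
      show ?case
        by (rule runs_mono[OF lv]) (use \<open>T1 \<le> _\<close> \<open>T2 \<le> _\<close> 3 o3 in \<open>simp add: time_total_def\<close>)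
    qed
  qed
qed (simp_all add: input_def)

end

section \<open>Correctness and bounds\<close>

context params
begin

lemma r_le_t: "r \<le> t"
  unfolding r_def using less_exp[of t] by (rule decay_rounds(3)[OF tk])

text \<open>Prime, multiplier and code are chosen in turn, each for the image of
  \<open>C \<union> D\<close> under the earlier choices. These are injective on it, so the
  cardinalities and the disjointness of the two parts persist.\<close>

lemma exists_separating_code:
  assumes CD: "C \<subseteq> {1..n}" "D \<subseteq> {1..n}" "C \<inter> D = {}" "card C = t" "card D \<le> k - t"
  shows "\<exists>i<K. \<exists>j<L. \<exists>N<Tot.
    let v = nth_prime_above (2 ^ q) i; h = code_value p m t b M v (mults M v j) N
    in h ` C = {1..t} \<and> h ` D \<subseteq> {t + 1}"
proof -
  let ?S = "C \<union> D"
  have fin: "finite C" "finite D" using CD(1,2) by (meson finite_subset finite_atLeastAtMost)+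
  have cardS: "card ?S \<le> k" using card_Un_le[of C D] CD(4,5) tk by simp
  have n_le: "n \<le> 2 ^ l" unfolding l_def by (rule least_exp)
  have "\<exists>i<k ^ 2 * (l div q) + 1. inj_on (\<lambda>x. x mod nth_prime_above (2 ^ q) i) ?S"
  proof (rule exists_injective_prime)
    show "?S \<subseteq> {..2 ^ l}" using CD n_le by (auto intro: order_trans)
    show "0 \<notin> ?S" using CD by auto
  qed (use cardS q3 in auto)
  then obtain i where i: "i < K" "inj_on (\<lambda>x. x mod nth_prime_above (2 ^ q) i) ?S"
    unfolding K_def power2_eq_square by blast
  define v where "v = nth_prime_above (2 ^ q) i"
  have v: "prime v" "v \<le> 2 ^ (3 * q)" unfolding v_def using nth_prime_above(1) nth_prime_le[OF i(1)] by auto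
  let ?S1 = "(\<lambda>x. x mod v) ` ?S"
  have "\<exists>j<8 * k ^ 2 * (3 * q). inj_on (\<lambda>x. (mults (8 * k ^ 2) v j * x mod v) mod (8 * k ^ 2)) ?S1"
  proof (rule exists_injective_mult[OF v])
    show "?S1 \<subseteq> {..<v}" using prime_gt_0_nat[OF v(1)] by auto
    show "card ?S1 \<le> k" using card_image_le[of ?S "\<lambda>x. x mod v"] fin cardS by simp
  qed (use q3 k_pos in auto)
  then obtain j where j: "j < L" "inj_on (\<lambda>x. (mults M v j * x mod v) mod M) ?S1"
    unfolding L_def M_def by blast
  define h where "h = (\<lambda>x. (mults M v j * (x mod v) mod v) mod M)"
  have inj: "inj_on h ?S"
    using comp_inj_on[OF i(2)[folded v_def] j(2)] unfolding h_def comp_def .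
  have M: "0 < M" unfolding M_def using k_pos by simp
  have p: "prime p" "M < p" unfolding p_def by (rule next_prime)+
  have range: "h x < p" for x using M p(2) unfolding h_def by (meson less_trans mod_less_divisor)
  have b: "0 < b" unfolding b_def by simp
  have cardC: "card (h ` C) = t" using inj CD(4) by (metis card_image inj_on_subset sup_ge1)
  have div: "m div (2 * b) = t" unfolding m_def using b by simp
  have "\<exists>N \<sigma>. N < (3 * p) ^ r * 9 ^ (m div (2 * b)) * (12 * b) ^ card (h ` C) \<and>
    bij_betw \<sigma> (h ` C) {1..<1 + card (h ` C)} \<and>
    (\<forall>f a c. r + 2 * (m div (2 * b)) + card (h ` C) \<le> f \<longrightarrow>
      (\<forall>y\<in>h ` C. decode p m t y f N b a c 1 = \<sigma> y) \<and> (\<forall>y\<in>h ` D. decode p m t y f N b a c 1 = t + 1))"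
  proof (rule exists_code[where X = t])
    have "t * (k div t) + k mod t = k" by simp
    moreover have "k mod t < t" using t1 by simp
    ultimately have "k \<le> t * (k div t) + t" by linarith
    then have "k \<le> t * (k div t + 1)" by (simp only: add_mult_distrib2 mult_1_right)
    then have "k * k \<le> (t * (k div t + 1)) * (t * (k div t + 1))" by (intro mult_mono) auto
    then show "4 * k ^ 2 \<le> m * t" unfolding m_def b_def power2_eq_square
      by (simp only: mult_ac)
    show "h ` C \<inter> h ` D = {}" using inj CD(3) by (auto dest: inj_onD)
    show "card (h ` C \<union> h ` D) \<le> k"
      using card_image_le[of ?S h] fin cardS by (simp add: image_Un)
    show "(decay t k ^^ r) t = 0" unfolding r_def by (rule decay_rounds(1)[OF tk])
  qed (use p t1 tk range cardC b in auto)
  then obtain N \<sigma> where N: "N < (3 * p) ^ r * 9 ^ t * (12 * b) ^ t" "bij_betw \<sigma> (h ` C) {1..<1 + t}"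
    and decode: "\<forall>f a c. r + 2 * t + t \<le> f \<longrightarrow>
      (\<forall>y\<in>h ` C. decode p m t y f N b a c 1 = \<sigma> y) \<and> (\<forall>y\<in>h ` D. decode p m t y f N b a c 1 = t + 1)"
    unfolding div cardC by blast
  have "(3 * p) ^ r * 9 ^ t * (12 * b) ^ t = (3 * p) ^ r * (9 * (12 * b)) ^ t"
    by (simp only: power_mult_distrib[of 9] mult.assoc)
  also have "9 * (12 * b) = 108 * b" by simp
  finally have NT: "N < Tot" using N(1) unfolding Tot_def by (simp only:)
  let ?h = "code_value p m t b M v (mults M v j) N"
  have "r + 2 * t + t \<le> 4 * t" using r_le_t by simp
  note decode' = decode[rule_format, OF this]
  have hC: "?h x = \<sigma> (h x)" if "x \<in> C" for x
    using decode'[of 0 0] that unfolding code_value_def h_def by blast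
  have hD: "?h x = t + 1" if "x \<in> D" for x
    using decode'[of 0 0] that unfolding code_value_def h_def by blast
  have "?h ` C = \<sigma> ` h ` C" using hC by (auto simp: image_image)
  also have "\<dots> = {1..t}" using N(2) by (auto simp: bij_betw_def)
  finally have "?h ` C = {1..t} \<and> ?h ` D \<subseteq> {t + 1}" using hD by auto
  then show ?thesis using i(1) j(1) NT unfolding v_def[symmetric] Let_def
    by (intro exI[of _ i] conjI exI[of _ j] exI[of _ N]) (auto simp: v_def)
qed

end

text \<open>Rounding up to a power of two at most doubles \<open>B\<close>, unless the start
  \<open>2 ^ e\<close> already suffices.\<close>

lemma least_exp_le:
  assumes "1 \<le> e" "1 \<le> B"
  shows "2 ^ least_exp e B \<le> 2 ^ e * B"
proof (cases "least_exp e B = e")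
  case True
  then show ?thesis using assms by simp
next
  case False
  then obtain i where i: "least_exp e B = Suc i" "e \<le> i"
    using least_exp(1)[of e B] by (cases "least_exp e B") auto
  then have "2 ^ i < B" using less_least_exp[of e i B] by simp
  moreover have "2 * B \<le> 2 ^ e * B"
    using power_increasing[OF assms(1), of "2::nat"] by (intro mult_right_mono) auto
  ultimately show ?thesis unfolding i(1) power_Suc by linarith
qed

text \<open>From \<open>x <= j * 2 ^ (x div j)\<close>. Applied to \<open>l\<close>, it trades a
  fixed power of \<open>log n\<close> for one factor \<open>n\<close>.\<close>

lemma power_le_exp:
  fixes x j :: nat
  shows "x ^ j \<le> j ^ j * 2 ^ x"
proof (cases "j = 0")
  case False
  have "x = j * (x div j) + x mod j" by simp
  also have "\<dots> \<le> j * (x div j) + j" using False by (intro add_left_mono less_imp_le) simp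
  also have "\<dots> = j * Suc (x div j)" by simp
  also have "\<dots> \<le> j * 2 ^ (x div j)" by (intro mult_left_mono Suc_leI less_exp) simp
  finally have "x ^ j \<le> (j * 2 ^ (x div j)) ^ j" by (rule power_mono) simp
  also have "\<dots> = j ^ j * 2 ^ (x div j * j)" by (simp only: power_mult_distrib power_mult)
  also have "\<dots> \<le> j ^ j * 2 ^ x" by (intro mult_left_mono power_increasing) auto
  finally show ?thesis .
qed simp

section \<open>Bounds on the parameters\<close>

context params
begin

lemma l_le: "2 ^ l \<le> 2 * n"
  unfolding l_def using least_exp_le[of 1 n] n_pos by simp

lemma l_pos: "1 \<le> l"
  unfolding l_def by (rule least_exp)

lemma l_power_le: "l ^ j \<le> j ^ j * (2 * n)"
  using power_le_exp[of l j] l_le by (meson mult_le_mono2 order_trans)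

lemma q_le: "2 ^ q \<le> 8 * k ^ 2 * l"
proof -
  have "1 * 1 * 1 \<le> k * k * l" using k_pos l_pos by (intro mult_mono) auto
  then show ?thesis unfolding q_def using least_exp_le[of 3 "k * k * l"] by (simp add: power2_eq_square)
qed

lemma p_le: "p \<le> 2 ^ 18 * k ^ 6"
proof -
  have "1 \<le> k ^ 2" using k_pos by (intro one_le_power)
  then have "1 \<le> M" unfolding M_def by linarith
  then have "p \<le> (8 * M) ^ 3" unfolding p_def by (rule next_prime_bound)
  also have "\<dots> = 2 ^ 18 * k ^ 6" unfolding M_def by (simp add: power_mult_distrib flip: power_mult)
  finally show ?thesis .
qed

lemma b_le: "b \<le> 8 * k ^ 2"
proof -
  have "k div t + 1 \<le> 2 * k" using k_pos div_le_dividend[of k t] by linarith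
  then have "(k div t + 1) * (k div t + 1) \<le> (2 * k) * (2 * k)" by (intro mult_mono) auto
  then show ?thesis unfolding b_def by (simp add: power2_eq_square)
qed

lemma b_le_ratio: "real b \<le> 8 * (real k / real t) ^ 2"
proof -
  have "real (k div t) \<le> real k / real t" by (rule of_nat_div_le_of_nat)
  moreover have "1 \<le> real k / real t" using t1 tk by simp
  ultimately have "real (k div t + 1) \<le> 2 * (real k / real t)" by simp
  then have "real (k div t + 1) * real (k div t + 1) \<le> (2 * (real k / real t)) * (2 * (real k / real t))"
    by (intro mult_mono) auto
  then show ?thesis unfolding b_def by (simp add: power2_eq_square)
qed

lemma KL_pos: "1 \<le> K" "1 \<le> L" "1 \<le> Tot"
proof -
  show "1 \<le> K" unfolding K_def by simp
  have "0 < L" unfolding L_def M_def using q3 k_pos by simp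
  then show "1 \<le> L" by simp
  have "0 < Tot" unfolding Tot_def b_def p_def using prime_gt_0_nat[OF next_prime(1)] by simp
  then show "1 \<le> Tot" by simp
qed

lemma KL_le: "K * L \<le> 216 * k ^ 4 * l"
proof -
  have "K * q = k * k * ((l div q) * q) + q" unfolding K_def by (simp add: algebra_simps)
  also have "\<dots> \<le> k * k * l + q" by (intro add_right_mono mult_left_mono) auto
  \<comment> \<open>The \<open>+ 1\<close> in \<open>K\<close> leaves a term \<open>q\<close>; it is
    below \<open>2 ^ q\<close>, hence of the same order as the main term.\<close>
  also have "q \<le> 8 * k ^ 2 * l" using less_exp[of q] q_le by linarith
  finally have Kq: "K * q \<le> 9 * (k ^ 2 * l)" by (simp add: power2_eq_square)
  have "K * L = 24 * k ^ 2 * (K * q)" unfolding L_def M_def by simp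
  also have "\<dots> \<le> 24 * k ^ 2 * (9 * (k ^ 2 * l))" using Kq by (rule mult_left_mono) simp
  also have "\<dots> = 216 * k ^ 4 * l" by (simp add: power2_eq_square power4_eq_xxxx)
  finally show ?thesis .
qed

text \<open>\<open>A c\<close> is the factor \<open>k\<^sup>O\<^sup>(\<^sup>1\<^sup>) * 2\<^sup>O\<^sup>(\<^sup>t\<^sup>)\<close> of the bounds.\<close>

definition A :: "nat \<Rightarrow> real" where "A c = real k ^ c * 2 ^ (c * t)"

lemma A_mult: "A c * A d = A (c + d)"
  unfolding A_def by (simp add: power_add add_mult_distrib)

lemma A_le: "a \<le> c \<Longrightarrow> d \<le> c \<Longrightarrow> 2 ^ d * real k ^ a \<le> A c"
proof -
  assume "a \<le> c" "d \<le> c"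
  have "d \<le> c * t" using \<open>d \<le> c\<close> t1 by (metis le_trans mult_le_mono2 nat_mult_1_right)
  then have "(2::real) ^ d * real k ^ a \<le> 2 ^ (c * t) * real k ^ c"
    using \<open>a \<le> c\<close> k_pos by (intro mult_mono power_increasing) auto
  then show ?thesis unfolding A_def by (simp add: mult.commute)
qed

lemma A_ge_1: "1 \<le> A c"
  using A_le[of 0 c 0] by simp

lemma A_mono: "c \<le> d \<Longrightarrow> A c \<le> A d"
  using A_mult[of c "d - c"] A_ge_1[of c] A_ge_1[of "d - c"]
    mult_left_mono[of 1 "A (d - c)" "A c"] by simp

text \<open>
  If \<open>t\<^sup>2 < 2 * k\<close>, one round suffices.  Otherwise \<open>p\<close> is polynomial in \<open>t\<close> and there are
  at most \<open>log t + O(1)\<close> rounds, so that \<open>p ^ r\<close> is quasipolynomial in \<open>t\<close>.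
\<close>

lemma rounds_le: "real ((3 * p) ^ r) \<le> A 512"
proof (cases "t * t < 2 * k")
  case True
  then have "(decay t k ^^ 1) t = 0" by (simp add: decay_def One_nat_def)
  then have "r \<le> 1" unfolding r_def decay_rounds_def by (rule Least_le)
  moreover have "0 < p" unfolding p_def using prime_gt_0_nat next_prime(1) by blast
  ultimately have "(3 * p) ^ r \<le> (3 * p) ^ 1" by (intro power_increasing) auto
  also have "\<dots> \<le> 2 ^ 20 * k ^ 6" using p_le by simp
  finally have "real ((3 * p) ^ r) \<le> real (2 ^ 20 * k ^ 6)" by (simp only: of_nat_le_iff)
  also have "\<dots> \<le> A 20" using A_le[of 6 20 20] by simp
  also have "\<dots> \<le> A 512" by (rule A_mono) simp
  finally show ?thesis .
next
  case False
  define s where "s = least_exp 1 (t + 1)"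
  have s: "t + 1 \<le> 2 ^ s" "2 ^ s \<le> 2 * (t + 1)"
    unfolding s_def using least_exp(2)[of "t + 1" 1] least_exp_le[of 1 "t + 1"] by simp_all
  have s1: "1 \<le> s" unfolding s_def by (rule least_exp)
  have rs: "r \<le> s" unfolding r_def using s by (intro decay_rounds(3)[OF tk]) simp
  have "k \<le> t * t" using False by simp
  also have "t * t \<le> 2 ^ s * 2 ^ s" using s by (intro mult_mono) auto
  also have "\<dots> = 2 ^ (2 * s)" by (simp add: mult_2 power_add)
  finally have "k ^ 6 \<le> (2 ^ (2 * s)) ^ 6" by (rule power_mono) simp
  then have k6: "k ^ 6 \<le> 2 ^ (12 * s)" by (simp flip: power_mult)
  have "3 * p \<le> 2 ^ 20 * k ^ 6" using p_le by simp
  also have "\<dots> \<le> 2 ^ 20 * 2 ^ (12 * s)" using k6 by (rule mult_left_mono) simp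
  also have "\<dots> = 2 ^ (20 + 12 * s)" by (simp only: power_add)
  also have "\<dots> \<le> 2 ^ (32 * s)" using s1 by (intro power_increasing) auto
  finally have "(3 * p) ^ r \<le> (2 ^ (32 * s)) ^ r" by (rule power_mono) simp
  also have "\<dots> = 2 ^ (32 * s * r)" by (simp only: power_mult)
  also have "\<dots> \<le> 2 ^ (512 * t)"
  proof (rule power_increasing)
    \<comment> \<open>The squared logarithm is absorbed by \<open>t\<close>:
      \<open>s ^ 2 <= 4 * 2 ^ s <= 8 * (t + 1) <= 16 * t\<close>. The constant 512 is
      \<open>32 * 16\<close>.\<close>
    have "s * r \<le> s ^ 2" using rs by (simp add: power2_eq_square)
    also have "\<dots> \<le> 2 ^ 2 * 2 ^ s" by (rule power_le_exp)
    also have "\<dots> \<le> 16 * t" using s(2) t1 by simp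
    finally show "32 * s * r \<le> 512 * t" by simp
  qed simp
  finally have "real ((3 * p) ^ r) \<le> real (2 ^ (512 * t))" by (simp only: of_nat_le_iff)
  also have "\<dots> \<le> 2 ^ (512 * t) * real k ^ 512"
    using k_pos mult_left_mono[of 1 "real k ^ 512" "2 ^ (512 * t)"] by simp
  also have "\<dots> = A 512" unfolding A_def by simp
  finally show ?thesis .
qed

definition ratio :: real where "ratio = (real k / real t) ^ (2 * t)"

lemma ratio_ge_1: "1 \<le> ratio"
  unfolding ratio_def using t1 tk by (intro one_le_power) simp

text \<open>Only \<open>b ^ t\<close> carries the main factor, since
  \<open>b <= 8 * (k / t) ^ 2\<close> and \<open>108 * 8 <= 2 ^ 10\<close>; the choice of
  multipliers over all rounds disappears in \<open>A 512\<close>.\<close>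

lemma Tot_le: "real Tot \<le> A 522 * ratio"
proof -
  have "real ((108 * b) ^ t) = (108 * real b) ^ t" by simp
  also have "\<dots> \<le> (2 ^ 10 * (real k / real t) ^ 2) ^ t"
  proof (rule power_mono)
    have "0 \<le> (real k / real t) ^ 2" by simp
    then have "108 * real b \<le> 1024 * (real k / real t) ^ 2" using b_le_ratio by linarith
    then show "108 * real b \<le> 2 ^ 10 * (real k / real t) ^ 2" by simp
  qed simp
  also have "\<dots> = 2 ^ (10 * t) * ratio"
    unfolding ratio_def by (simp only: power_mult_distrib power_mult)
  also have "\<dots> \<le> A 10 * ratio"
  proof (rule mult_right_mono)
    show "2 ^ (10 * t) \<le> A 10" unfolding A_def
      using k_pos mult_right_mono[of 1 "real k ^ 10" "2 ^ (10 * t)"] by simp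
  qed (use ratio_ge_1 in simp)
  finally have "real ((3 * p) ^ r) * real ((108 * b) ^ t) \<le> A 512 * (A 10 * ratio)"
    using rounds_le A_ge_1[of 512] by (intro mult_mono) auto
  then show ?thesis unfolding Tot_def using A_mult[of 512 10] by (simp flip: mult.assoc)
qed

definition lg :: real where "lg = max 1 (log 2 (real n))"

lemma lg_ge_1: "1 \<le> lg" unfolding lg_def by simp

lemma l_le_lg: "real l \<le> 2 * lg"
proof -
  have "real (2 ^ l) \<le> real (2 * n)" using l_le by (simp only: of_nat_le_iff)
  then have "log 2 (2 ^ l) \<le> log 2 (2 * real n)" using n_pos by (subst log_le_cancel_iff) auto
  also have "\<dots> = 1 + log 2 (real n)" using n_pos by (subst log_mult) auto
  finally have "real l \<le> 1 + log 2 (real n)" by (simp add: log_nat_power)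
  then show ?thesis unfolding lg_def by linarith
qed

lemma size_bound_eq: "size_bound c n t k = A c * ratio * lg"
  unfolding size_bound_def A_def ratio_def lg_def by simp

lemma time_bound_eq: "time_bound c n t k = A c * ratio * lg * real n"
  unfolding time_bound_def A_def ratio_def lg_def by simp

lemma length_le: "real (K * (L * Tot)) \<le> size_bound 600 n t k"
proof -
  have "real (K * L) \<le> real (216 * k ^ 4 * l)" using KL_le by (simp only: of_nat_le_iff)
  also have "\<dots> = 216 * real k ^ 4 * real l" by simp
  also have "\<dots> \<le> 2 ^ 8 * real k ^ 4 * (2 * lg)"
    using l_le_lg by (intro mult_mono) auto
  also have "\<dots> = 2 ^ 9 * real k ^ 4 * lg" by simp
  also have "\<dots> \<le> A 9 * lg" using lg_ge_1 by (intro mult_right_mono A_le) auto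
  finally have "real (K * L) * real Tot \<le> (A 9 * lg) * (A 522 * ratio)"
    using Tot_le lg_ge_1 A_ge_1[of 9] by (intro mult_mono) auto
  also have "\<dots> = A 531 * ratio * lg" using A_mult[of 9 522] by (simp add: mult_ac)
  also have "\<dots> \<le> A 600 * ratio * lg"
    using ratio_ge_1 lg_ge_1 by (intro mult_right_mono A_mono) auto
  finally show ?thesis unfolding size_bound_eq by (simp add: mult_ac)
qed

text \<open>For quantities bounded by a monomial in \<open>k\<close> and \<open>n\<close>: the
  factors \<open>ratio\<close> and \<open>lg\<close> of the time bound are at least 1.\<close>

lemma le_time_boundI:
  assumes "x \<le> 2 ^ d * k ^ a * n" "a \<le> 600" "d \<le> 600"
  shows "real x \<le> time_bound 600 n t k"
proof -
  have "real x \<le> real (2 ^ d * k ^ a * n)" using assms(1) by (simp only: of_nat_le_iff)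
  also have "\<dots> = (2 ^ d * real k ^ a) * real n" by simp
  also have "\<dots> \<le> A 600 * real n" using assms by (intro mult_right_mono A_le) auto
  also have "\<dots> \<le> (A 600 * ratio * lg) * real n"
  proof (rule mult_right_mono)
    have "A 600 * 1 * 1 \<le> A 600 * ratio * lg"
      using A_ge_1[of 600] ratio_ge_1 lg_ge_1 by (intro mult_mono) auto
    then show "A 600 \<le> A 600 * ratio * lg" by simp
  qed simp
  finally show ?thesis unfolding time_bound_eq .
qed

end

section \<open>All values fit into words of logarithmic length\<close>

context params
begin

text \<open>\<open>2 ^ q\<close> is \<open>O(k ^ 2 * l)\<close>, and \<open>l_power_le\<close> turns
  the power of \<open>l\<close> into \<open>2 * n\<close>. This keeps exhaustive search among the
  residues modulo \<open>v\<close> linear in \<open>n\<close>.\<close>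

lemma two_power_q_le: "(2 ^ q) ^ j \<le> (8 * j) ^ j * k ^ (2 * j) * (2 * n)"
proof -
  have "(2 ^ q) ^ j \<le> (8 * k ^ 2 * l) ^ j" using q_le by (rule power_mono) simp
  also have "\<dots> = 8 ^ j * k ^ (2 * j) * l ^ j" by (simp only: power_mult_distrib power_mult)
  also have "\<dots> \<le> 8 ^ j * k ^ (2 * j) * (j ^ j * (2 * n))" using l_power_le by (rule mult_left_mono) simp
  also have "\<dots> = (8 * j) ^ j * k ^ (2 * j) * (2 * n)" by (simp only: power_mult_distrib mult_ac)
  finally show ?thesis .
qed

lemma two_power_15q_le: "2 ^ (5 * (3 * q)) \<le> 2 ^ 110 * k ^ 30 * n"
proof -
  have "5 * (3 * q) = q * 15" by simp
  then have "(2::nat) ^ (5 * (3 * q)) = (2 ^ q) ^ 15" by (simp only: power_mult)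
  also have "\<dots> \<le> (8 * 15) ^ 15 * k ^ (2 * 15) * (2 * n)" by (rule two_power_q_le)
  also have "\<dots> = ((8 * 15) ^ 15 * 2) * k ^ 30 * n" by simp
  also have "\<dots> \<le> 2 ^ 110 * k ^ 30 * n" by (intro mult_right_mono) auto
  finally show ?thesis .
qed

lemma l_le_n: "l \<le> 2 * n"
  using less_exp[of l] l_le by linarith

lemma l_le_2q: "l \<le> 2 ^ q"
proof -
  have "1 * 1 * l \<le> k * k * l" using k_pos by (intro mult_mono) auto
  then show ?thesis using k2l_le by linarith
qed

text \<open>The quadratic search cost for one multiplier, times the factor \<open>l\<close>
  contained in the number \<open>K * L\<close> of reductions; \<open>l <= 2 ^ q\<close> makes it a
  seventh power of \<open>2 ^ q\<close>.\<close>

lemma two_power_6q_le: "(2 ^ (3 * q)) ^ 2 * l \<le> 2 ^ 50 * k ^ 14 * n"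
proof -
  have "((2::nat) ^ (3 * q)) ^ 2 = 2 ^ (3 * q * 2)" by (rule power_mult[symmetric])
  also have "3 * q * 2 = q * 6" by simp
  also have "(2::nat) ^ (q * 6) = (2 ^ q) ^ 6" by (rule power_mult)
  finally have "(2 ^ (3 * q)) ^ 2 * l \<le> (2 ^ q) ^ 6 * 2 ^ q" using l_le_2q by (simp only: mult_left_mono)
  also have "\<dots> = (2 ^ q) ^ 7" using power_add[of "(2::nat) ^ q" 6 1] by simp
  also have "\<dots> \<le> (8 * 7) ^ 7 * k ^ (2 * 7) * (2 * n)" by (rule two_power_q_le)
  also have "\<dots> = (56 ^ 7 * 2) * k ^ 14 * n" by simp
  also have "\<dots> \<le> 2 ^ 50 * k ^ 14 * n" by (intro mult_right_mono) auto
  finally show ?thesis .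
qed

lemma le_monomial: "x \<le> c * k ^ i \<Longrightarrow> c \<le> d \<Longrightarrow> x \<le> d * k ^ i * n"
proof -
  assume "x \<le> c * k ^ i" "c \<le> d"
  moreover have "c * k ^ i \<le> d * k ^ i" using \<open>c \<le> d\<close> by (rule mult_right_mono) simp
  moreover have "d * k ^ i * 1 \<le> d * k ^ i * n" using n_pos by (rule mult_left_mono) simp
  ultimately show ?thesis by linarith
qed

lemma word_values:
  shows "real (n + 1) \<le> time_bound 600 n t k" "real (2 ^ l) \<le> time_bound 600 n t k"
    "real (2 ^ q) \<le> time_bound 600 n t k" "real (k * k * l) \<le> time_bound 600 n t k"
    "real (p * M) \<le> time_bound 600 n t k" "real m \<le> time_bound 600 n t k"
    "real K \<le> time_bound 600 n t k" "real L \<le> time_bound 600 n t k"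
    "real (108 * b) \<le> time_bound 600 n t k" "real (3 * p) \<le> time_bound 600 n t k"
    "real (2 * M * 2 ^ (5 * (3 * q))) \<le> time_bound 600 n t k"
    "real (2 ^ (2 * (3 * q))) \<le> time_bound 600 n t k"
proof -
  let ?B = "time_bound 600 n t k"
  show "real (n + 1) \<le> ?B"
    by (rule le_time_boundI[where d = 1 and a = 0]) (use n_pos in auto)
  show "real (2 ^ l) \<le> ?B"
    by (rule le_time_boundI[where d = 1 and a = 0]) (use l_le in auto)
  have "8 * k ^ 2 * l \<le> 8 * k ^ 2 * (2 * n)" using l_le_n by (rule mult_left_mono) simp
  also have "\<dots> = 2 ^ 4 * k ^ 2 * n" by simp
  finally have q': "2 ^ q \<le> 2 ^ 4 * k ^ 2 * n" using q_le by linarith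
  then show "real (2 ^ q) \<le> ?B"
    by (rule le_time_boundI) auto
  have "k * k * l \<le> 2 ^ 4 * k ^ 2 * n" using k2l_le q' by (rule order_trans)
  then show "real (k * k * l) \<le> ?B" by (rule le_time_boundI) auto
  have "p * M \<le> 2 ^ 18 * k ^ 6 * M" using p_le by (rule mult_right_mono) simp
  also have "\<dots> = 2 ^ 21 * k ^ 8" unfolding M_def by (simp add: power_add[of k 6 2, simplified])
  finally have "p * M \<le> 2 ^ 21 * k ^ 8 * n" by (rule le_monomial) simp
  then show "real (p * M) \<le> ?B" by (rule le_time_boundI) auto
  have "m \<le> k * (2 * (8 * k ^ 2))" unfolding m_def using tk b_le by (intro mult_mono) auto
  also have "\<dots> = 16 * k ^ 3" by (simp add: power_add[of k 1 2, simplified])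
  finally have "m \<le> 2 ^ 4 * k ^ 3 * n" by (rule le_monomial) simp
  then show "real m \<le> ?B" by (rule le_time_boundI) auto
  have "216 * k ^ 4 * l \<le> 216 * k ^ 4 * (2 * n)" using l_le_n by (rule mult_left_mono) simp
  also have "\<dots> = 432 * k ^ 4 * n" by simp
  also have "\<dots> \<le> 2 ^ 9 * k ^ 4 * n" by (intro mult_right_mono) auto
  finally have KL: "K * L \<le> 2 ^ 9 * k ^ 4 * n" using KL_le by linarith
  have "K * 1 \<le> K * L" "1 * L \<le> K * L" using KL_pos by (intro mult_mono; simp)+
  then have "K \<le> 2 ^ 9 * k ^ 4 * n" "L \<le> 2 ^ 9 * k ^ 4 * n" using KL by linarith+
  then show "real K \<le> ?B" "real L \<le> ?B"
    by (auto intro!: le_time_boundI[of _ 9 4])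
  have "108 * b \<le> 864 * k ^ 2" using b_le by simp
  then have "108 * b \<le> 2 ^ 10 * k ^ 2 * n" by (rule le_monomial) simp
  then show "real (108 * b) \<le> ?B" by (rule le_time_boundI) auto
  have "3 * p \<le> (3 * 2 ^ 18) * k ^ 6" using p_le by simp
  then have "3 * p \<le> 2 ^ 20 * k ^ 6 * n" by (rule le_monomial) simp
  then show "real (3 * p) \<le> ?B" by (rule le_time_boundI) auto
  have "2 * M * 2 ^ (5 * (3 * q)) \<le> 2 * M * (2 ^ 110 * k ^ 30 * n)"
    using two_power_15q_le by (rule mult_left_mono) simp
  also have "\<dots> = 2 ^ 114 * k ^ 32 * n" unfolding M_def by (simp add: power_add[of k 30 2, simplified])
  finally show "real (2 * M * 2 ^ (5 * (3 * q))) \<le> ?B"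
    by (rule le_time_boundI) auto
  have square: "(2::nat) ^ (2 * (3 * q)) = (2 ^ (3 * q)) ^ 2"
    by (simp only: mult.commute[of 2 "3 * q"] power_mult)
  have "((2::nat) ^ (3 * q)) ^ 2 * 1 \<le> (2 ^ (3 * q)) ^ 2 * l" using l_pos by (rule mult_left_mono) simp
  then have "2 ^ (2 * (3 * q)) \<le> (2 ^ (3 * q)) ^ 2 * l" unfolding square by (simp only: mult_1_right)
  then have "2 ^ (2 * (3 * q)) \<le> 2 ^ 50 * k ^ 14 * n" using two_power_6q_le by (rule order_trans)
  then show "real (2 ^ (2 * (3 * q))) \<le> ?B" by (rule le_time_boundI) auto
qed

lemma Tot_le_time_bound: "real Tot \<le> time_bound 600 n t k"
proof -
  have "A 522 * ratio * 1 * 1 \<le> A 600 * ratio * lg * real n"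
    using A_mono[of 522 600] A_ge_1[of 600] A_ge_1[of 522] ratio_ge_1 lg_ge_1 n_pos
    by (intro mult_mono mult_nonneg_nonneg) auto
  then show ?thesis using Tot_le unfolding time_bound_eq by simp
qed

text \<open>The block length in the decoder may grow exponentially in the fuel \<open>4 * t\<close>,
  which the factor \<open>2 ^ (c * t)\<close> permits.\<close>

lemma depth_le_time_bound: "real ((4 * t + 2) * (b * 2 ^ (4 * t))) \<le> time_bound 600 n t k"
proof -
  have "(4 * t + 2) * b \<le> (6 * k) * (8 * k ^ 2)" using tk k_pos b_le by (intro mult_mono) auto
  also have "\<dots> \<le> 2 ^ 6 * k ^ 3" by (simp add: power_add[of k 1 2, simplified])
  finally have "real ((4 * t + 2) * b) \<le> real (2 ^ 6 * k ^ 3)" by (simp only: of_nat_le_iff)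
  also have "\<dots> \<le> A 6" using A_le[of 3 6 6] by simp
  finally have 1: "real ((4 * t + 2) * b) \<le> A 6" .
  have "2 ^ (4 * t) * 1 \<le> 2 ^ (4 * t) * real k ^ 4" using k_pos by (intro mult_left_mono) auto
  then have 2: "real (2 ^ (4 * t)) \<le> A 4" unfolding A_def by (simp add: mult.commute)
  have "real ((4 * t + 2) * b) * real (2 ^ (4 * t)) \<le> A 6 * A 4"
    using 1 2 A_ge_1[of 6] by (intro mult_mono) auto
  also have "\<dots> = A 10" using A_mult[of 6 4] by simp
  also have "\<dots> = A 10 * 1 * 1 * 1" by simp
  also have "\<dots> \<le> A 600 * ratio * lg * real n"
    using A_mono[of 10 600] A_ge_1[of 600] A_ge_1[of 10] ratio_ge_1 lg_ge_1 n_pos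
    by (intro mult_mono mult_nonneg_nonneg) auto
  finally show ?thesis unfolding time_bound_eq by (simp only: of_nat_mult mult.assoc)
qed

end

section \<open>Total running time and correctness of the family\<close>

context params_word
begin

text \<open>The squared term collects the searches for primes and multipliers; the other one is the
  enumeration of \<open>Tot\<close> codes with \<open>O(t)\<close> decoding steps at each of
  \<open>n\<close> points. The term \<open>40 * p ^ 2\<close> is the search for \<open>p\<close>,
  and loop overheads are absorbed by the constants.\<close>

lemma time_total_le: "time_total \<le> K * L * (230 * (2 ^ (3 * q)) ^ 2 + 780 * (Tot * (t * n))) + 40 * p ^ 2"
proof -
  define P where "P = ((2::nat) ^ (3 * q)) ^ 2"
  define tn where "tn = t * n"
  define Y where "Y = Tot * tn"
  have tn1: "1 \<le> tn" "n \<le> tn" "t \<le> tn"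
  proof -
    have "1 * 1 \<le> t * n" "1 * n \<le> t * n" "t * 1 \<le> t * n" using t1 n_pos by (intro mult_mono; simp)+
    then show "1 \<le> tn" "n \<le> tn" "t \<le> tn" unfolding tn_def by simp_all
  qed
  have "1 * 1 \<le> Tot * tn" using KL_pos tn1 by (intro mult_mono) auto
  then have Y1: "1 \<le> Y" unfolding Y_def by simp
  have "1 * tn \<le> Tot * tn" using KL_pos by (intro mult_mono) auto
  then have tY: "t \<le> Y" using tn1 unfolding Y_def by linarith
  have "time_x = 280 * tn + 90 * n + 20" unfolding time_x_def tn_def by (simp add: algebra_simps)
  then have "time_x + 40 \<le> 430 * tn" using tn1 by linarith
  then have "Tot * (time_x + 40) \<le> Tot * (430 * tn)" by (rule mult_left_mono) simp
  then have "Tot * (time_x + 40) \<le> 430 * Y" unfolding Y_def by simp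
  moreover have "time_N \<le> Tot * (time_x + 40)"
    unfolding time_N_def using KL_pos by (simp add: algebra_simps)
  ultimately have N: "time_N \<le> 430 * Y" by linarith
  have body: "time_body + 30 \<le> 130 * P + 490 * Y"
    unfolding time_body_def P_def[symmetric] using N Y1 by linarith
  have "time_j \<le> L * (time_body + 30)" unfolding time_j_def using KL_pos by (simp add: algebra_simps)
  also have "\<dots> \<le> L * (130 * P + 490 * Y)" using body by (rule mult_left_mono) simp
  finally have j: "time_j \<le> L * (130 * P + 490 * Y)" .
  have "time_v \<le> K * (60 * P + time_j + 40)"
    unfolding time_v_def P_def[symmetric] using KL_pos by (simp add: algebra_simps)
  also have "\<dots> \<le> K * (L * (190 * P + 530 * Y))"
  proof (rule mult_left_mono)
    have L1: "1 * (60 * P + 40 * Y) \<le> L * (60 * P + 40 * Y)" using KL_pos by (intro mult_right_mono) auto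
    define U V where "U = L * (60 * P + 40 * Y)" and "V = L * (130 * P + 490 * Y)"
    have "60 * P + 40 * Y \<le> U" using L1 unfolding U_def by (simp only: mult_1)
    moreover have "time_j \<le> V" using j unfolding V_def .
    ultimately have "60 * P + time_j + 40 \<le> U + V" using Y1 by linarith
    then have "60 * P + time_j + 40 \<le> L * (60 * P + 40 * Y) + L * (130 * P + 490 * Y)"
      unfolding U_def V_def .
    also have "\<dots> = L * (190 * P + 530 * Y)" by (simp add: algebra_simps)
    finally show "60 * P + time_j + 40 \<le> L * (190 * P + 530 * Y)" .
  qed simp
  finally have v: "time_v \<le> K * L * (190 * P + 530 * Y)" by simp
  have qP': "2 ^ q \<le> P"
  proof -
    have "(2::nat) ^ q \<le> 2 ^ (3 * q * 2)" by (intro power_increasing) auto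
    also have "\<dots> = P" unfolding P_def by (rule power_mult)
    finally show ?thesis .
  qed
  then have qP: "q \<le> P" using less_exp[of q] by linarith
  have lP: "l \<le> P" using l_le_2q qP' by (rule order_trans)
  have "1 * 1 \<le> K * L" using KL_pos by (intro mult_mono) auto
  then have KL1: "1 * (40 * P + 250 * Y) \<le> K * L * (40 * P + 250 * Y)" by (intro mult_right_mono) auto
  define U V where "U = K * L * (40 * P + 250 * Y)" and "V = K * L * (190 * P + 530 * Y)"
  have "40 * P + 250 * Y \<le> U" using KL1 unfolding U_def by (simp only: mult_1)
  moreover have "time_v \<le> V" using v unfolding V_def .
  moreover have "20 * l + 20 * q + 30 * r + 20 * t + 200 \<le> 40 * P + 250 * Y"
    using lP qP r_le_t tY Y1 by linarith
  ultimately have "time_total \<le> U + V + 40 * p ^ 2"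
    unfolding time_total_def by linarith
  also have "\<dots> = K * L * (230 * P + 780 * Y) + 40 * p ^ 2" unfolding U_def V_def by (simp add: algebra_simps)
  finally show ?thesis unfolding P_def Y_def tn_def .
qed

lemma time_total_le_time_bound: "real time_total \<le> time_bound 600 n t k"
proof -
  \<comment> \<open>Each of the three parts is bounded with exponent 590; the remaining 10 pays for
    the factor 3 of their sum.\<close>
  define W where "W = A 590 * ratio * lg * real n"
  have unit: "A c * real n \<le> W" if "c \<le> 590" for c
  proof -
    have "A c * 1 * 1 * real n \<le> W" unfolding W_def
      using A_mono[OF that] A_ge_1[of c] A_ge_1[of 590] ratio_ge_1 lg_ge_1
      by (intro mult_mono mult_nonneg_nonneg) auto
    then show ?thesis by simp
  qed
  have "K * L * (2 ^ (3 * q)) ^ 2 \<le> 216 * k ^ 4 * l * (2 ^ (3 * q)) ^ 2"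
    using KL_le by (rule mult_right_mono) simp
  also have "\<dots> = 216 * k ^ 4 * ((2 ^ (3 * q)) ^ 2 * l)" by simp
  also have "\<dots> \<le> 216 * k ^ 4 * (2 ^ 50 * k ^ 14 * n)" using two_power_6q_le by (rule mult_left_mono) simp
  also have "\<dots> = (216 * 2 ^ 50) * k ^ 18 * n" by (simp add: power_add[of k 4 14, simplified])
  finally have "230 * (K * L * (2 ^ (3 * q)) ^ 2) \<le> 230 * ((216 * 2 ^ 50) * k ^ 18 * n)"
    by (rule mult_left_mono) simp
  also have "\<dots> = (230 * 216 * 2 ^ 50) * k ^ 18 * n" by simp
  also have "\<dots> \<le> 2 ^ 70 * k ^ 18 * n" by (intro mult_right_mono) auto
  finally have "real (230 * (K * L * (2 ^ (3 * q)) ^ 2)) \<le> real (2 ^ 70 * k ^ 18 * n)"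
    by (simp only: of_nat_le_iff)
  also have "\<dots> = (2 ^ 70 * real k ^ 18) * real n" by simp
  also have "\<dots> \<le> A 70 * real n" by (intro mult_right_mono A_le) auto
  also have "\<dots> \<le> W" by (rule unit) simp
  finally have 1: "real (230 * (K * L * (2 ^ (3 * q)) ^ 2)) \<le> W" .
  have "real (K * L) \<le> real (216 * k ^ 4 * l)" using KL_le by (simp only: of_nat_le_iff)
  also have "\<dots> = 216 * real k ^ 4 * real l" by simp
  also have "\<dots> \<le> 216 * real k ^ 4 * (2 * lg)" using l_le_lg by (intro mult_left_mono) auto
  finally have "780 * real (K * L) * real t \<le> 780 * (216 * real k ^ 4 * (2 * lg)) * real k"
    using tk lg_ge_1 by (intro mult_mono mult_nonneg_nonneg) auto
  also have "\<dots> = (780 * 216 * 2) * real k ^ 5 * lg" by (simp add: power_add[of "real k" 4 1, simplified])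
  also have "\<dots> \<le> 2 ^ 20 * real k ^ 5 * lg" using lg_ge_1 by (intro mult_right_mono) auto
  also have "\<dots> \<le> A 20 * lg" using lg_ge_1 by (intro mult_right_mono A_le) auto
  finally have "780 * real (K * L) * real t * real Tot \<le> (A 20 * lg) * (A 522 * ratio)"
    using Tot_le by (rule mult_mono) (use lg_ge_1 A_ge_1[of 20] in auto)
  also have "\<dots> = A 542 * ratio * lg" using A_mult[of 20 522] by (simp add: mult_ac)
  also have "\<dots> \<le> A 590 * ratio * lg" using ratio_ge_1 lg_ge_1 by (intro mult_right_mono A_mono) auto
  finally have "780 * real (K * L) * real t * real Tot * real n \<le> W" unfolding W_def by (rule mult_right_mono) simp
  then have 2: "real (780 * (K * L * (Tot * (t * n)))) \<le> W" by (simp add: mult_ac)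
  have "p ^ 2 \<le> (2 ^ 18 * k ^ 6) ^ 2" using p_le by (rule power_mono) simp
  also have "\<dots> = 2 ^ 36 * k ^ 12" by (simp add: power_mult_distrib flip: power_mult)
  finally have "40 * p ^ 2 \<le> (40 * 2 ^ 36) * k ^ 12" by simp
  then have "40 * p ^ 2 \<le> 2 ^ 42 * k ^ 12 * n" by (rule le_monomial) simp
  then have "real (40 * p ^ 2) \<le> real (2 ^ 42 * k ^ 12 * n)" by (simp only: of_nat_le_iff)
  also have "\<dots> = (2 ^ 42 * real k ^ 12) * real n" by simp
  also have "\<dots> \<le> A 42 * real n" by (intro mult_right_mono A_le) auto
  also have "\<dots> \<le> W" by (rule unit) simp
  finally have 3: "real (40 * p ^ 2) \<le> W" .
  have "real time_total \<le> real (K * L * (230 * (2 ^ (3 * q)) ^ 2 + 780 * (Tot * (t * n))) + 40 * p ^ 2)"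
    using time_total_le by (simp only: of_nat_le_iff)
  also have "\<dots> = real (230 * (K * L * (2 ^ (3 * q)) ^ 2)) + real (780 * (K * L * (Tot * (t * n)))) + real (40 * p ^ 2)"
    by (simp add: algebra_simps)
  also have "\<dots> \<le> 3 * W" using 1 2 3 by linarith
  also have "\<dots> \<le> A 10 * W"
  proof (rule mult_right_mono)
    have "3 \<le> 2 ^ 10 * real k ^ 0" by simp
    also have "\<dots> \<le> A 10" by (rule A_le) auto
    finally show "3 \<le> A 10" .
    show "0 \<le> W" unfolding W_def using A_ge_1[of 590] ratio_ge_1 lg_ge_1 by (intro mult_nonneg_nonneg) auto
  qed
  also have "\<dots> = time_bound 600 n t k"
    unfolding W_def time_bound_eq using A_mult[of 10 590] by (simp add: mult.assoc[symmetric])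
  finally show ?thesis .
qed

lemma length_family: "length family = K * (L * Tot)"
  unfolding family_def codes_def by (simp add: length_concat comp_def sum_list_triv)

text \<open>A separating family consists of extensional functions, whereas \<open>code_value\<close>
  is defined everywhere; the output only shows arguments in \<open>{1..n}\<close>, so restriction
  leaves it unchanged.\<close>

lemma tables_restrict: "tables n (map (\<lambda>h. restrict h {1..n}) hs) = tables n hs"
  unfolding tables_def map_map comp_def by (intro arg_cong[of _ _ concat] map_cong) auto

lemma minimal_separating_family:
  "minimal_separating n t k (set (map (\<lambda>h. restrict h {1..n}) family))"
  unfolding minimal_separating_def
proof (intro conjI allI impI)
  show "set (map (\<lambda>h. restrict h {1..n}) family) \<subseteq> {1..n} \<rightarrow>\<^sub>E {1..t + 1}"
    unfolding family_def codes_def code_value_def using decode_le decode_ge by auto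
next
  fix C D assume CD: "C \<subseteq> {1..n} \<and> D \<subseteq> {1..n} \<and> C \<inter> D = {} \<and> card C = t \<and> card D \<le> k - t"
  define h where "h = (\<lambda>i j N. code_value p m t b M (nth_prime_above (2 ^ q) i) (mults M (nth_prime_above (2 ^ q) i) j) N)"
  have "\<exists>i<K. \<exists>j<L. \<exists>N<Tot. h i j N ` C = {1..t} \<and> h i j N ` D \<subseteq> {t + 1}"
    unfolding h_def by (rule exists_separating_code[unfolded Let_def]) (use CD in simp_all)
  then obtain i j N where ij: "i < K" "j < L" "N < Tot"
    and h: "h i j N ` C = {1..t}" "h i j N ` D \<subseteq> {t + 1}"
    by blast
  let ?h = "h i j N"
  let ?v = "nth_prime_above (2 ^ q) i"
  have "?h \<in> set (codes ?v j)" using ij unfolding codes_def h_def by simp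
  then have "?h \<in> set (concat (map (codes ?v) [0..<L]))" using ij by (auto simp: Bex_def)
  then have "?h \<in> set family" using ij unfolding family_def set_concat by auto
  then have "restrict ?h {1..n} \<in> set (map (\<lambda>h. restrict h {1..n}) family)" by simp
  moreover have "restrict ?h {1..n} ` C = ?h ` C" "restrict ?h {1..n} ` D = ?h ` D"
    using CD by (auto intro!: image_cong)
  ultimately show "\<exists>h\<in>set (map (\<lambda>h. restrict h {1..n}) family). h ` C = {1..t} \<and> h ` D \<subseteq> {t + 1}"
    using h by (intro bexI[of _ "restrict ?h {1..n}"]) auto
qed

end

theorem theorem3p1:
  "\<exists>(P :: com) (c :: nat). \<forall>(n :: nat) (t :: nat) (k :: nat). 1 \<le> t \<and> t \<le> min n k \<longrightarrow>
     (\<exists>(w :: nat) (T :: nat) (s :: state) (hs :: (nat \<Rightarrow> nat) list).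
        real w \<le> word_length_bound c n t k \<and>
        exec w P (input n t k) T s \<and>
        out s = tables n hs \<and>
        minimal_separating n t k (set hs) \<and>
        real (length hs) \<le> size_bound c n t k \<and>
        real T \<le> time_bound c n t k)"
\<comment> \<open>One constant serves word length, size and time: 600 is the exponent reached by the
  time estimate, and the size estimate, which ends at 531, is padded to it.\<close>
proof (rule exI[of _ algorithm], rule exI[of _ 600], intro allI impI)
  fix n t k :: nat assume "1 \<le> t \<and> t \<le> min n k"
  then interpret params n t k by unfold_locales auto
  define B where "B = time_bound 600 n t k"
  \<comment> \<open>The least length with \<open>B < 2 ^ w\<close>; since \<open>log 2 B\<close> is
    at least 1, the extra bit is covered by the factor 600.\<close>
  define w where "w = Suc (nat \<lfloor>log 2 B\<rfloor>)"
  have "real 2 \<le> B" unfolding B_def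
    by (rule le_time_boundI[where d = 1 and a = 0]) (use n_pos in auto)
  then have B: "2 \<le> B" by simp
  then have log1: "1 \<le> log 2 B" by (simp add: le_log_iff)
  have w_le: "real w \<le> word_length_bound 600 n t k"
  proof -
    have "real w \<le> log 2 B + 1" unfolding w_def using log1 by simp
    also have "\<dots> \<le> 600 * log 2 B" using log1 by linarith
    finally show ?thesis unfolding word_length_bound_def B_def by simp
  qed
  have "log 2 B < real w" unfolding w_def using log1 by linarith
  then have "B < 2 powr real w" using B by (subst (asm) log_less_iff) auto
  then have fits: "x < 2 ^ w" if "real x \<le> B" for x :: nat
  proof -
    have "B < 2 ^ w" using \<open>B < 2 powr real w\<close> by (simp add: powr_realpow)
    then have "real x < 2 ^ w" using that by linarith
    then show ?thesis by simp
  qed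
  interpret params_word n t k w
    by unfold_locales
      (rule fits, unfold B_def, rule word_values Tot_le_time_bound depth_le_time_bound)+
  let ?hs = "map (\<lambda>h. restrict h {1..n}) family"
  obtain T s where run: "exec w algorithm (input n t k) T s" "T \<le> time_total" "out s = tables n family"
    using runs_algorithm unfolding runs_def by blast
  have "real T \<le> time_bound 600 n t k"
    using run(2) time_total_le_time_bound by linarith
  moreover have "real (length ?hs) \<le> size_bound 600 n t k"
    using length_le by (simp add: length_family)
  ultimately show "\<exists>w T s hs. real w \<le> word_length_bound 600 n t k \<and> exec w algorithm (input n t k) T s \<and>
      out s = tables n hs \<and> minimal_separating n t k (set hs) \<and>
      real (length hs) \<le> size_bound 600 n t k \<and> real T \<le> time_bound 600 n t k"
    using w_le run(1,3) minimal_separating_family tables_restrict by metis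
qed

end
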